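(* Let $\gamma,\kappa\in\,]0,1[$, $d>0$, let $\psi$ be an approximation function of the form $\psi(m)=\gamma e^{-\alpha m}$, and let $K=\{q=e^{2\pi ix}:\ x\in C_{\psi,\kappa,d}\}$. Let $A$ be a totally bounded closed subset of $c_0(\mathbb R)$ such that $\|s\|\le\alpha$ for all $s\in A$, and let $K^*=\{q=e^{2\pi ix}:\ x\in W^A_{8\gamma,\kappa,d/2}\}$. Then $K^*\subset K$ and, for every complex Banach space $B$, $\mathcal C^1_{hol}(K,B)\subset\mathcal C^\infty_{hol}(K^*,B)$ (that is, the restriction to $K^*$ of every function in $\mathcal C^1_{hol}(K,B)$ is $\mathcal C^\infty$-holomorphic on $K^*$).
   Context: **Continued fractions.** An irrational class $x\in(\mathbb R\setminus\mathbb Q)/\mathbb Z$ is represented in $]0,1[$ as $x=[0,a_1,a_2,\dots]$, with convergents $n_k(x)/m_k(x)=[0,a_1,\dots,a_k]$ in lowest terms, $k\ge0$ ($n_0/m_0=0/1$). **Approximation functions and $C_{\psi,\kappa,d}$.** An approximation function is a decreasing function $\psi$ on $\mathbb N^*$ with $2\sum_{m\ge1}\psi(m)<1$ and $0<\psi(m)\le\frac1{2m}$ for all $m\ge1$. Put $C_\psi=\{x\in(\mathbb R\setminus\mathbb Q)/\mathbb Z:\ m_{k+1}(x)\le 1/\psi(m_k(x))\ \forall k\ge0\}$, and let $C_{\psi,\kappa,d}\subset\mathbb C/\mathbb Z$ be the set of classes of those $\tilde x\in\mathbb C$ for which there is a lift $\tilde y\in\mathbb R$ of a point of $C_\psi$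 with $\kappa|\mathrm{Re}(\tilde x-\tilde y)|\le|\mathrm{Im}\,\tilde x|\le d$. **The sets $W^A$.** $c_0(\mathbb R)$ is the Banach space of real sequences $s=(s_k)_{k\ge0}$ tending to $0$, with $\|s\|=\sup|s_k|$. For $\gamma>0$ and $A$ a totally bounded closed subset of $c_0(\mathbb R)$, $W^A_\gamma$ is the set of $x\in(\mathbb R\setminus\mathbb Q)/\mathbb Z$ for which there exists $s\in A$ with $m_{k+1}(x)\le\gamma^{-1}e^{s_km_k(x)}$ for all $k\in\mathbb N$. For $\kappa\in\,]0,1[$, $d>0$, $W^A_{\gamma,\kappa,d}\subset\mathbb C/\mathbb Z$ is the set of classes of those $\tilde x\in\mathbb C$ for which there is a lift $\tilde y\in\mathbb R$ of a point of $W^A_\gamma$ with $\kappa|\mathrm{Re}(\tilde x-\tilde y)|\le|\mathrm{Im}\,\tilde x|\le d$. **$\mathcal C^1$- and $\mathcal C^\infty$-holomorphic functions.** Let $C\subset\mathbb C$ be closed. A continuous $f:C\to B$ is $\mathcal C^1$-holomorphic if there is a continuous $f^{(1)}:C\to B$ such that for all $z\in C$, $\varepsilon>0$ there is $\delta>0$ with $\|f(z_2)-f(z_1)-f^{(1)}(z_1)(z_2-z_1)\|\le\varepsilon|z_1-z_2|$ for all $z_1,z_2\in C$ with $|z_1-z|<\delta$, $|z_2-z|<\delta$. A function $f:C\to B$ is $\mathcal C^\infty$-holomorphic if there is a sequence of continuous functions $f^{(n)}:C\to B$, $n\in\mathbb N$, with $f^{(0)}=f$ and such that for all $n,m\ge0$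 the function $R^{(n,m)}$ defined by $f^{(n)}(z_2)=\sum_{h=0}^m\frac{f^{(n+h)}(z_1)}{h!}(z_2-z_1)^h+R^{(n,m)}(z_1,z_2)$ satisfies: for all $z\in C$, $\varepsilon>0$ there is $\delta>0$ such that $\|R^{(n,m)}(z_1,z_2)\|\le\varepsilon|z_1-z_2|^m$ for all $z_1,z_2\in C$ with $|z_1-z|<\delta$, $|z_2-z|<\delta$. The spaces of such functions on $K$ are denoted $\mathcal C^1_{hol}(K,B)$, $\mathcal C^\infty_{hol}(K,B)$. *)

theory Defs
  imports "HOL-Analysis.Analysis"
begin

section \<open>Continued fractions\<close>

text \<open>
  A class in $(\mathbb{R} - \mathbb{Q}) / \mathbb{Z}$ is handled through its real lifts: every
  function of \<open>x\<close> below depends on \<open>x\<close> only through \<open>frac x\<close>, and subsets of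
  $(\mathbb{R} - \mathbb{Q}) / \mathbb{Z}$ and $\mathbb{C} / \mathbb{Z}$ are given as their
  $\mathbb{Z}$-invariant preimages.

  For irrational \<open>x\<close>, \<open>cf_rest x k\<close> lies in the open interval from 0 to 1 and equals
  $[0, a_{k+1}, a_{k+2}, \dots]$, where $[0, a_1, a_2, \dots]$ is the expansion of \<open>frac x\<close>.
\<close>

fun cf_rest :: "real \<Rightarrow> nat \<Rightarrow> real" where
  "cf_rest x 0 = frac x"
| "cf_rest x (Suc k) = frac (1 / cf_rest x k)"

text \<open>The partial quotient $a_k$, meaningful for \<open>k \<ge> 1\<close>.\<close>

definition cf_quot :: "real \<Rightarrow> nat \<Rightarrow> int" where
  "cf_quot x k = \<lfloor>1 / cf_rest x (k - 1)\<rfloor>"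

text \<open>\<open>cf_value [a\<^sub>1, \<dots>, a\<^sub>k]\<close> is $[0, a_1, \dots, a_k]$.\<close>

fun cf_value :: "int list \<Rightarrow> rat" where
  "cf_value [] = 0"
| "cf_value (a # as) = 1 / (of_int a + cf_value as)"

definition convergent_cf :: "real \<Rightarrow> nat \<Rightarrow> rat" where
  "convergent_cf x k = cf_value (map (cf_quot x) [1..<Suc k])"

text \<open>The denominator $m_k(x)$ of the convergent in lowest terms.\<close>

definition cf_denom :: "real \<Rightarrow> nat \<Rightarrow> nat" where
  "cf_denom x k = nat (snd (quotient_of (convergent_cf x k)))"


section \<open>Approximation functions and the associated sets\<close>

text \<open>The value \<open>\<psi> 0\<close> is irrelevant.\<close>

definition approximation_function :: "(nat \<Rightarrow> real) \<Rightarrow> bool" where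
  "approximation_function \<psi> \<longleftrightarrow>
     antimono_on {1..} \<psi> \<and>
     summable (\<lambda>m. \<psi> (Suc m)) \<and> 2 * (\<Sum>m. \<psi> (Suc m)) < 1 \<and>
     (\<forall>m\<ge>1. 0 < \<psi> m \<and> \<psi> m \<le> 1 / (2 * real m))"

definition C_set :: "(nat \<Rightarrow> real) \<Rightarrow> real set" where
  "C_set \<psi> = {x. x \<notin> \<rat> \<and> (\<forall>k. real (cf_denom x (Suc k)) \<le> 1 / \<psi> (cf_denom x k))}"

definition cone_thickening :: "real set \<Rightarrow> real \<Rightarrow> real \<Rightarrow> complex set" where
  "cone_thickening Y \<kappa> d = {x. \<exists>y\<in>Y. \<kappa> * \<bar>Re x - y\<bar> \<le> \<bar>Im x\<bar> \<and> \<bar>Im x\<bar> \<le> d}"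

text \<open>
  The sequences tending to 0, as a subspace of the space of all bounded real sequences
  (every function on the discrete space \<open>nat\<close> is continuous) with the supremum norm.
\<close>

definition c0 :: "(nat \<Rightarrow>\<^sub>C real) set" where
  "c0 = {s. apply_bcontfun s \<longlonglongrightarrow> 0}"

definition W_set :: "(nat \<Rightarrow>\<^sub>C real) set \<Rightarrow> real \<Rightarrow> real set" where
  "W_set A \<gamma> = {x. x \<notin> \<rat> \<and>
     (\<exists>s\<in>A. \<forall>k. real (cf_denom x (Suc k))
        \<le> inverse \<gamma> * exp (apply_bcontfun s k * real (cf_denom x k)))}"


section \<open>Complex Banach spaces\<close>

class complex_banach = banach +
  fixes scaleC :: "complex \<Rightarrow> 'a \<Rightarrow> 'a"
  assumes scaleC_add_right: "scaleC a (x + y) = scaleC a x + scaleC a y"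
    and scaleC_add_left: "scaleC (a + b) x = scaleC a x + scaleC b x"
    and scaleC_scaleC: "scaleC a (scaleC b x) = scaleC (a * b) x"
    and scaleC_of_real: "scaleC (complex_of_real r) x = scaleR r x"
    and norm_scaleC: "norm (scaleC a x) = cmod a * norm x"

instantiation complex :: complex_banach
begin

definition scaleC_complex :: "complex \<Rightarrow> complex \<Rightarrow> complex" where
  "scaleC_complex a x = a * x"

instance
  by standard (auto simp: scaleC_complex_def algebra_simps norm_mult scaleR_conv_of_real)

end


section \<open>$\mathcal{C}^1$- and $\mathcal{C}^\infty$-holomorphic functions\<close>

text \<open>
  Both notions are used for closed \<open>C\<close>. They involve only the values of \<open>f\<close> on \<open>C\<close>, so that
  restriction to a smaller set leaves the total function \<open>f\<close> unchanged.
\<close>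

definition C1_holomorphic_on :: "(complex \<Rightarrow> 'b::complex_banach) \<Rightarrow> complex set \<Rightarrow> bool" where
  "C1_holomorphic_on f C \<longleftrightarrow> continuous_on C f \<and>
     (\<exists>f1. continuous_on C f1 \<and>
       (\<forall>z\<in>C. \<forall>\<epsilon>>0. \<exists>\<delta>>0. \<forall>z1\<in>C. \<forall>z2\<in>C. cmod (z1 - z) < \<delta> \<longrightarrow> cmod (z2 - z) < \<delta> \<longrightarrow>
          norm (f z2 - f z1 - scaleC (z2 - z1) (f1 z1)) \<le> \<epsilon> * cmod (z1 - z2)))"

definition taylor_remainder ::
    "(nat \<Rightarrow> complex \<Rightarrow> 'b::complex_banach) \<Rightarrow> nat \<Rightarrow> nat \<Rightarrow> complex \<Rightarrow> complex \<Rightarrow> 'b" where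
  "taylor_remainder F n m z1 z2 =
     F n z2 - (\<Sum>h=0..m. scaleC ((z2 - z1) ^ h / fact h) (F (n + h) z1))"

definition Cinf_holomorphic_on :: "(complex \<Rightarrow> 'b::complex_banach) \<Rightarrow> complex set \<Rightarrow> bool" where
  "Cinf_holomorphic_on f C \<longleftrightarrow>
     (\<exists>F. (\<forall>n. continuous_on C (F n)) \<and> (\<forall>z\<in>C. F 0 z = f z) \<and>
       (\<forall>n m. \<forall>z\<in>C. \<forall>\<epsilon>>0. \<exists>\<delta>>0. \<forall>z1\<in>C. \<forall>z2\<in>C.
          cmod (z1 - z) < \<delta> \<longrightarrow> cmod (z2 - z) < \<delta> \<longrightarrow>
          norm (taylor_remainder F n m z1 z2) \<le> \<epsilon> * cmod (z1 - z2) ^ m))"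

end

theory Submission
  imports Defs
begin

text \<open>
  In the coordinate $q = e^{2 \pi i x}$ the set $K$ lies between two curves over the circle, of
  heights $\pm \kappa \cdot dist(t, C_\psi)$, and the circles $|{\rm Im}\, x| = d$. One chooses a
  $C^1$ function $u \ge \kappa \cdot dist(\cdot, C_\psi)$ that is positive only near the rationals
  whose gaps are removed from $C_\psi$, and such that $u + |u'|$ is bounded by every power of the
  distance to $K^*$: a gap around $n/m$ has size $O(e^{-\alpha m})$, while the distance of $n/m$
  to $K^*$ decays more slowly than any $e^{-\eta m}$, because the sequences in the totally bounded
  set $A$ tend to $0$ uniformly.

  For $z \in K^*$ the quotient $(f(q) - f(z)) / (q - z)$ is continuous on $K$ by
  $C^1$-holomorphy, even for $z$ on the unit circle, so deforming the curves $\pm u$ to the outer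
  boundary shows that its integral over the whole contour vanishes. This gives a Cauchy formula
  for $f$ on $K^*$. The contributions of $u$ and $-u$ almost cancel: their difference is
  $O(u + |u'|)$, which absorbs all powers of the singular factors $1 / (q - z)$. The formula can
  thus be differentiated arbitrarily often, with uniformly bounded Taylor remainders.
\<close>

section \<open>Continued fractions and best approximation\<close>

text \<open>The distance to \<open>C_set \<psi>\<close> cannot itself serve as u: its slope has
  modulus 1 on every gap, however short, whereas |u'| has to be flat too. So u is \<kappa> times a
  smoothed minorant of the distance, which vanishes where the distance is small, plus a series of
  bumps around the rationals n/m that makes up the deficit. A bump as narrow as its gap would be too
  steep; for large m it can be made much wider, since \<open>W_set A (8 * \<gamma>)\<close> stays
  far from n/m. For small m only multiples of \<open>\<rho> m\<close>, which is \<psi>(m)/m, are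
  available: the factor 8 keeps these points 4 \<open>\<rho> m\<close> away from n/m, while the
  points of a gap lie within 5/4 \<open>\<rho> m\<close> of some n/m and within 9/4
  \<open>\<rho> m\<close> of \<open>C_set \<psi>\<close>, and 5/4 + 9/4 < 4. Points of K on the unit
  circle are not interior to K, and the inner curves may run through z. Hence all integrals are
  pulled back to the parameter t in [0, 1], and the two inner curves are kept in one integrand;
  separately they need not be integrable.\<close>

fun cf_real :: "int list \<Rightarrow> real \<Rightarrow> real" where
  "cf_real [] \<tau> = \<tau>"
| "cf_real (a # as) \<tau> = 1 / (of_int a + cf_real as \<tau>)"

text \<open>Indices are shifted by one so that the recursion starts at the formal convergent 1/0:
  \<open>cf_p a (Suc k)\<close> and \<open>cf_q a (Suc k)\<close> belong to the k-th convergent. The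
  quotients are counted from 0, so \<open>a k\<close> is a_{k+1}.\<close>

fun cf_p :: "(nat \<Rightarrow> int) \<Rightarrow> nat \<Rightarrow> int" where
  "cf_p a 0 = 1"
| "cf_p a (Suc 0) = 0"
| "cf_p a (Suc (Suc k)) = a k * cf_p a (Suc k) + cf_p a k"

fun cf_q :: "(nat \<Rightarrow> int) \<Rightarrow> nat \<Rightarrow> int" where
  "cf_q a 0 = 0"
| "cf_q a (Suc 0) = 1"
| "cf_q a (Suc (Suc k)) = a k * cf_q a (Suc k) + cf_q a k"

text \<open>The fractional linear map that turns the k-th remainder into the whole fraction. Its
  value at 0 is the k-th convergent, so the convergent and all numbers with the same first k
  quotients are compared through one map.\<close>

definition cf_moebius :: "(nat \<Rightarrow> int) \<Rightarrow> nat \<Rightarrow> real \<Rightarrow> real" where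
  "cf_moebius a k \<tau> = (real_of_int (cf_p a (Suc k)) + \<tau> * real_of_int (cf_p a k)) /
     (real_of_int (cf_q a (Suc k)) + \<tau> * real_of_int (cf_q a k))"

lemma cf_det: "cf_p a (Suc k) * cf_q a k - cf_p a k * cf_q a (Suc k) = (-1) ^ Suc k"
  by (induction k) (auto simp: algebra_simps)

lemma cf_q_nonneg_pos:
  assumes "\<And>i. i < k \<Longrightarrow> a i \<ge> 1"
  shows "cf_q a k \<ge> 0 \<and> cf_q a (Suc k) \<ge> 1"
  using assms
proof (induction k)
  case (Suc k)
  then have "cf_q a k \<ge> 0" "cf_q a (Suc k) \<ge> 1" "a k \<ge> 1" by auto
  then have "1 \<le> a k * cf_q a (Suc k)" by (metis mult_mono' mult_1 zero_le_one)
  then show ?case using \<open>cf_q a k \<ge> 0\<close> \<open>cf_q a (Suc k) \<ge> 1\<close> by auto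
qed auto

lemma cf_q_cong:
  assumes "\<And>i. i < k \<Longrightarrow> a i = b i" "j \<le> Suc k"
  shows "cf_q a j = cf_q b j \<and> cf_p a j = cf_p b j"
  using assms(2)
proof (induction j rule: less_induct)
  case (less j)
  show ?case
  proof (cases j)
    case 0 then show ?thesis by simp
  next
    case (Suc i)
    show ?thesis
    proof (cases i)
      case 0 then show ?thesis using Suc by simp
    next
      case (Suc l)
      then show ?thesis using \<open>j = Suc i\<close> less assms(1)[of l] by auto
    qed
  qed
qed

lemma cf_moebius_denom_pos:
  assumes "\<And>i. i < k \<Longrightarrow> a i \<ge> 1" "\<tau> \<ge> 0"
  shows "real_of_int (cf_q a (Suc k)) + \<tau> * real_of_int (cf_q a k) \<ge> 1"
proof -
  have "cf_q a k \<ge> 0" "cf_q a (Suc k) \<ge> 1" using cf_q_nonneg_pos[of k a] assms by auto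
  then have "\<tau> * real_of_int (cf_q a k) \<ge> 0" "real_of_int (cf_q a (Suc k)) \<ge> 1" using assms by auto
  then show ?thesis by linarith
qed

lemma cf_moebius_Suc:
  assumes "\<And>i. i \<le> k \<Longrightarrow> a i \<ge> 1" "\<tau> \<ge> 0"
  shows "cf_moebius a (Suc k) \<tau> = cf_moebius a k (1 / (real_of_int (a k) + \<tau>))"
proof -
  let ?s = "real_of_int (a k) + \<tau>"
  have s: "?s \<ge> 1" using assms(1)[of k] assms(2) by simp
  have 1: "real_of_int (cf_p a (Suc (Suc k))) + \<tau> * real_of_int (cf_p a (Suc k)) =
    ?s * (real_of_int (cf_p a (Suc k)) + 1 / ?s * real_of_int (cf_p a k))"
    using s by (simp add: field_simps)
  have 2: "real_of_int (cf_q a (Suc (Suc k))) + \<tau> * real_of_int (cf_q a (Suc k)) =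
    ?s * (real_of_int (cf_q a (Suc k)) + 1 / ?s * real_of_int (cf_q a k))"
    using s by (simp add: field_simps)
  show ?thesis unfolding cf_moebius_def 1 2 using s by (subst mult_divide_mult_cancel_left) auto
qed

lemma cf_real_append: "cf_real (as @ [a]) \<tau> = cf_real as (1 / (real_of_int a + \<tau>))"
  by (induction as) auto

lemma cf_real_moebius:
  assumes "\<And>i. i < k \<Longrightarrow> a i \<ge> 1" "\<tau> \<ge> 0"
  shows "cf_real (map a [0..<k]) \<tau> = cf_moebius a k \<tau>"
  using assms
proof (induction k arbitrary: \<tau>)
  case 0
  then show ?case by (simp add: cf_moebius_def)
next
  case (Suc k)
  have "1 / (real_of_int (a k) + \<tau>) \<ge> 0" using Suc.prems(1)[of k] Suc.prems(2) by simp
  then have "cf_real (map a [0..<k]) (1 / (real_of_int (a k) + \<tau>)) = cf_moebius a k (1 / (real_of_int (a k) + \<tau>))"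
    using Suc by auto
  then show ?case using cf_moebius_Suc[of k a \<tau>] Suc.prems by (simp add: cf_real_append less_Suc_eq_le)
qed

text \<open>By \<open>cf_det\<close> the map has determinant 1 or -1, so only the difference of the
  arguments survives in the numerator, up to sign.\<close>

lemma cf_moebius_minus:
  assumes "\<And>i. i < k \<Longrightarrow> a i \<ge> 1" "\<sigma> \<ge> 0" "\<tau> \<ge> 0"
  shows "cf_moebius a k \<sigma> - cf_moebius a k \<tau> = (-1) ^ k * (\<sigma> - \<tau>) /
     ((real_of_int (cf_q a (Suc k)) + \<sigma> * real_of_int (cf_q a k)) *
      (real_of_int (cf_q a (Suc k)) + \<tau> * real_of_int (cf_q a k)))"
proof -
  let ?p = "real_of_int (cf_p a k)" and ?p' = "real_of_int (cf_p a (Suc k))"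
  let ?q = "real_of_int (cf_q a k)" and ?q' = "real_of_int (cf_q a (Suc k))"
  have d: "?p' * ?q - ?p * ?q' = (-1) ^ Suc k"
    using arg_cong[OF cf_det[of a k], of real_of_int] by simp
  have n: "?q' + \<sigma> * ?q \<noteq> 0" "?q' + \<tau> * ?q \<noteq> 0"
    using cf_moebius_denom_pos[of k a] assms by (smt (verit))+
  have "(?p' + \<sigma> * ?p) * (?q' + \<tau> * ?q) - (?p' + \<tau> * ?p) * (?q' + \<sigma> * ?q) = (\<tau> - \<sigma>) * (?p' * ?q - ?p * ?q')"
    by (simp add: algebra_simps)
  also have "\<dots> = (-1) ^ k * (\<sigma> - \<tau>)" unfolding d by (simp add: algebra_simps)
  finally show ?thesis unfolding cf_moebius_def using n by (simp add: diff_frac_eq)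
qed

lemma cf_value_eq_cf_real: "real_of_rat (cf_value as) = cf_real as 0"
  by (induction as) (auto simp: of_rat_divide of_rat_add)

abbreviation quots :: "real \<Rightarrow> nat \<Rightarrow> int" where
  "quots x k \<equiv> cf_quot x (Suc k)"

lemma cf_rest_irrational:
  assumes "x \<notin> \<rat>"
  shows "cf_rest x k \<notin> \<rat> \<and> 0 < cf_rest x k \<and> cf_rest x k < 1"
proof (induction k)
  have *: "frac y \<notin> \<rat> \<and> 0 < frac y \<and> frac y < 1" if "y \<notin> \<rat>" for y :: real
  proof -
    have "frac y \<notin> \<rat>"
    proof
      assume "frac y \<in> \<rat>"
      then have "frac y + of_int \<lfloor>y\<rfloor> \<in> \<rat>" by (intro Rats_add) auto
      then show False using that by (simp add: frac_def)
    qed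
    moreover have "frac y \<noteq> 0" using calculation by (metis Rats_0)
    ultimately show ?thesis using frac_ge_0[of y] frac_lt_1[of y] by auto
  qed
  {
    case 0
    then show ?case using *[OF assms] by simp
  next
    case (Suc k)
    have "1 / cf_rest x k \<notin> \<rat>"
    proof
      assume "1 / cf_rest x k \<in> \<rat>"
      then have "1 / (1 / cf_rest x k) \<in> \<rat>" by (rule Rats_divide[OF Rats_1])
      then show False using Suc by simp
    qed
    then show ?case using *[of "1 / cf_rest x k"] by simp
  }
qed

lemma quots_ge_1:
  assumes "x \<notin> \<rat>"
  shows "quots x k \<ge> 1"
proof -
  have "1 / cf_rest x k \<ge> 1" using cf_rest_irrational[OF assms, of k] by (simp add: field_simps)
  then show ?thesis by (simp add: cf_quot_def)
qed

lemma cf_rest_step: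
  shows "1 / cf_rest x k = real_of_int (quots x k) + cf_rest x (Suc k)"
  by (simp add: cf_quot_def frac_def)

lemma frac_eq_moebius:
  assumes "x \<notin> \<rat>"
  shows "frac x = cf_moebius (quots x) k (cf_rest x k)"
proof (induction k)
  case 0
  then show ?case by (simp add: cf_moebius_def)
next
  case (Suc k)
  have "cf_rest x k = 1 / (real_of_int (quots x k) + cf_rest x (Suc k))"
    unfolding cf_rest_step[symmetric] by simp
  then show ?case unfolding Suc
    using cf_moebius_Suc[of k "quots x" "cf_rest x (Suc k)"] quots_ge_1[OF assms] cf_rest_irrational[OF assms, of "Suc k"]
    by simp
qed

text \<open>By \<open>cf_det\<close> a common divisor of numerator and denominator divides a power
  of -1, so the recursion already yields lowest terms and \<open>quotient_of\<close> reads them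
  off.\<close>

lemma cf_denom_eq:
  assumes "x \<notin> \<rat>"
  shows "int (cf_denom x k) = cf_q (quots x) (Suc k)"
proof -
  let ?a = "quots x"
  have pos: "cf_q ?a (Suc k) \<ge> 1" using cf_q_nonneg_pos[of k ?a] quots_ge_1[OF assms] by blast
  have "real_of_rat (convergent_cf x k) = cf_moebius ?a k 0"
    unfolding convergent_cf_def cf_value_eq_cf_real
    using cf_real_moebius[of k ?a 0] quots_ge_1[OF assms]
    by (simp add: map_Suc_upt[symmetric] o_def del: upt_Suc)
  also have "\<dots> = real_of_rat (Fract (cf_p ?a (Suc k)) (cf_q ?a (Suc k)))"
    using pos by (simp add: cf_moebius_def of_rat_rat)
  finally have "convergent_cf x k = Fract (cf_p ?a (Suc k)) (cf_q ?a (Suc k))"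
    by simp
  moreover have "coprime (cf_p ?a (Suc k)) (cf_q ?a (Suc k))"
  proof (rule coprimeI)
    fix c assume c: "c dvd cf_p ?a (Suc k)" "c dvd cf_q ?a (Suc k)"
    have "c dvd cf_p ?a (Suc k) * cf_q ?a k - cf_p ?a k * cf_q ?a (Suc k)"
      using c by (intro dvd_diff) auto
    then have "c dvd (-1) ^ Suc k" by (simp only: cf_det)
    then show "is_unit c" by (rule dvd_unit_imp_unit) simp
  qed
  ultimately have "quotient_of (convergent_cf x k) = (cf_p ?a (Suc k), cf_q ?a (Suc k))"
    using pos by (simp add: quotient_of_Fract normalize_def)
  then show ?thesis using pos by (simp add: cf_denom_def)
qed

lemma cf_denom_0 [simp]: "x \<notin> \<rat> \<Longrightarrow> cf_denom x 0 = 1"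
  using cf_denom_eq[of x 0] by simp

lemma cf_denom_ge_1: "x \<notin> \<rat> \<Longrightarrow> cf_denom x k \<ge> 1"
  using cf_denom_eq[of x k] cf_q_nonneg_pos[of k "quots x"] quots_ge_1[of x] by (metis of_nat_1 of_nat_le_iff)

lemma cf_denom_Suc_Suc:
  assumes "x \<notin> \<rat>"
  shows "int (cf_denom x (Suc (Suc k))) = quots x (Suc k) * cf_denom x (Suc k) + cf_denom x k"
  using cf_denom_eq[OF assms] by simp

lemma cf_denom_mono_Suc:
  assumes "x \<notin> \<rat>"
  shows "cf_denom x k \<le> cf_denom x (Suc k)"
proof (cases k)
  case 0
  then show ?thesis using assms cf_denom_ge_1 by simp
next
  case (Suc j)
  have "int (cf_denom x (Suc j)) * 1 \<le> quots x (Suc j) * cf_denom x (Suc j)"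
    by (subst mult.commute) (intro mult_right_mono quots_ge_1[OF assms], simp)
  then have "int (cf_denom x (Suc j)) \<le> cf_denom x (Suc (Suc j))"
    using cf_denom_Suc_Suc[OF assms, of j] by simp
  then show ?thesis using Suc by simp
qed

lemma cf_denom_ge: "x \<notin> \<rat> \<Longrightarrow> cf_denom x (Suc k) \<ge> k"
proof (induction k)
  case (Suc k)
  have "int (cf_denom x (Suc k)) * 1 \<le> quots x (Suc k) * cf_denom x (Suc k)"
    by (subst mult.commute) (intro mult_right_mono quots_ge_1[OF Suc.prems], simp)
  then have "cf_denom x (Suc k) + 1 \<le> cf_denom x (Suc (Suc k))"
    using cf_denom_Suc_Suc[OF Suc.prems, of k] cf_denom_ge_1[OF Suc.prems, of k] by linarith
  then show ?case using Suc by simp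
qed simp

lemma cf_denom_bracket:
  assumes "x \<notin> \<rat>" "m \<ge> 1"
  obtains k where "cf_denom x k \<le> m" "m < cf_denom x (Suc k)"
proof -
  have "\<exists>k. m < cf_denom x k" using cf_denom_ge[OF assms(1), of "Suc m"] by (intro exI[of _ "Suc (Suc m)"]) simp
  then have *: "m < cf_denom x (LEAST k. m < cf_denom x k)" by (rule LeastI_ex)
  \<comment> \<open>The least index is a successor because \<open>cf_denom x 0\<close> is 1 and m is
    at least 1.\<close>
  then obtain k where k: "(LEAST k. m < cf_denom x k) = Suc k"
    using assms by (cases "LEAST k. m < cf_denom x k") auto
  then have "\<not> m < cf_denom x k" by (intro not_less_Least) simp
  then show ?thesis using that[of k] * k by simp
qed

text \<open>The vectors of denominator and numerator of two consecutive convergents form a basis of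
  the integer lattice, so (m, n), after removing the integer part of x, has integer coordinates A
  and B. The bound 0 < m < m_{k+1} gives A and B opposite signs unless B = 0, so the errors of the
  two convergents, which also have opposite signs, add up instead of cancelling. The factor 2 is the
  loss in D \<le> 2 m_{k+1}.\<close>

lemma best_approximation:
  fixes n :: int and m :: nat and x :: real
  assumes "x \<notin> \<rat>" "m \<ge> 1" "m < cf_denom x (Suc k)"
  shows "\<bar>real m * x - of_int n\<bar> \<ge> 1 / (2 * real (cf_denom x (Suc k)))"
proof -
  let ?a = "quots x"
  define \<theta> where "\<theta> = cf_rest x (Suc k)"
  have \<theta>: "0 < \<theta>" "\<theta> < 1" using cf_rest_irrational[OF assms(1), of "Suc k"] by (auto simp: \<theta>_def)
  let ?p = "cf_p ?a (Suc k)" and ?p' = "cf_p ?a (Suc (Suc k))"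
  let ?q = "cf_q ?a (Suc k)" and ?q' = "cf_q ?a (Suc (Suc k))"
  define s :: int where "s = (-1) ^ k"
  have s: "s * s = 1" "\<bar>s\<bar> = 1" by (auto simp: s_def power_mult_distrib[symmetric])
  have det: "?p' * ?q - ?p * ?q' = s" using cf_det[of ?a "Suc k"] by (simp add: s_def)
  have q: "?q \<ge> 1" "?q' \<ge> 1" "?q \<le> ?q'"
    using cf_denom_eq[OF assms(1), of k] cf_denom_eq[OF assms(1), of "Suc k"]
      cf_denom_ge_1[OF assms(1), of k] cf_denom_ge_1[OF assms(1), of "Suc k"] cf_denom_mono_Suc[OF assms(1), of k]
    by linarith+
  define D where "D = real_of_int ?q' + \<theta> * real_of_int ?q"
  have D0: "D \<ge> 1" unfolding D_def using cf_moebius_denom_pos[of "Suc k" ?a \<theta>] quots_ge_1[OF assms(1)] \<theta> by auto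
  have "\<theta> * real_of_int ?q \<le> 1 * real_of_int ?q" using \<theta> q by (intro mult_right_mono) auto
  then have D2: "D \<le> 2 * real_of_int ?q'" unfolding D_def using q by linarith
  define N where "N = n - m * \<lfloor>x\<rfloor>"
  have fr: "frac x = (real_of_int ?p' + \<theta> * real_of_int ?p) / D"
    using frac_eq_moebius[OF assms(1), of "Suc k"] by (simp add: cf_moebius_def D_def \<theta>_def)
  \<comment> \<open>Cramer's rule for the coordinates; dividing by the determinant s is multiplying
    by s.\<close>
  define A where "A = s * (m * ?p' - N * ?q')"
  define B where "B = s * (N * ?q - m * ?p)"
  have m: "int m = A * ?q + B * ?q'"
  proof -
    have "A * ?q + B * ?q' = s * (int m * (?p' * ?q - ?p * ?q'))" unfolding A_def B_def by (simp add: algebra_simps)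
    then show ?thesis unfolding det using s by (simp add: algebra_simps)
  qed
  have mq: "int m < ?q'" using cf_denom_eq[OF assms(1), of "Suc k"] assms(3) by linarith
  have "1 \<le> \<bar>real_of_int A - real_of_int B * \<theta>\<bar>"
  proof -
    consider "B = 0" | "B \<ge> 1" | "B \<le> -1" by linarith
    then show ?thesis
    proof cases
      case 1
      then have "A \<noteq> 0" using m assms(2) by auto
      then show ?thesis using 1 by simp
    next
      case 2
      then have "B * ?q' \<ge> ?q'" using q by (simp add: mult_le_cancel_right1)
      then have "A * ?q < 0" using m mq by linarith
      then have "A \<le> -1" using q by (simp add: mult_less_0_iff)
      moreover have "real_of_int B * \<theta> \<ge> 0" using 2 \<theta> by simp
      ultimately show ?thesis by linarith
    next
      case 3
      then have "B * ?q' \<le> 0" using q by (simp add: mult_nonpos_nonneg)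
      then have "A * ?q > 0" using m assms(2) by linarith
      then have "A \<ge> 1" using q by (simp add: zero_less_mult_iff)
      moreover have "real_of_int B * \<theta> \<le> 0" using 3 \<theta> by (simp add: mult_nonpos_nonneg)
      ultimately show ?thesis by linarith
    qed
  qed
  moreover have "m * x - n = real_of_int s * (real_of_int A - real_of_int B * \<theta>) / D"
  proof -
    have "m * x - n = m * frac x - N" by (simp add: N_def frac_def algebra_simps)
    also have "\<dots> = (m * (real_of_int ?p' + \<theta> * real_of_int ?p) - N * D) / D" unfolding fr using D0 by (simp add: field_simps)
    also have "m * (real_of_int ?p' + \<theta> * real_of_int ?p) - N * D =
      real_of_int (m * ?p' - N * ?q') - real_of_int (N * ?q - m * ?p) * \<theta>"
      unfolding D_def by (simp add: algebra_simps)
    also have "\<dots> = real_of_int s * (real_of_int A - real_of_int B * \<theta>)"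
    proof -
      have ss: "real_of_int s * real_of_int s = 1" using s(1) by (metis of_int_1 of_int_mult)
      have "real_of_int s * (real_of_int A - real_of_int B * \<theta>) =
        (real_of_int s * real_of_int s) *
        (real_of_int (m * ?p' - N * ?q') - real_of_int (N * ?q - m * ?p) * \<theta>)"
        unfolding A_def B_def of_int_mult[of s] by (simp only: right_diff_distrib mult.assoc)
      then show ?thesis by (simp only: ss mult_1)
    qed
    finally show ?thesis .
  qed
  moreover have "\<bar>real_of_int s\<bar> = 1" using s(2) by (metis of_int_abs of_int_1)
  ultimately have "\<bar>m * x - n\<bar> \<ge> 1 / D" using D0 by (simp add: abs_mult divide_right_mono)
  moreover have "1 / (2 * real_of_int ?q') \<le> 1 / D" using D2 D0 by (intro divide_left_mono) auto
  moreover have "real_of_int ?q' = cf_denom x (Suc k)" using cf_denom_eq[OF assms(1), of "Suc k"] by (metis of_int_of_nat_eq)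
  ultimately show ?thesis by (metis order_trans)
qed

section \<open>Numbers with prescribed partial quotients\<close>

lemma cf_rest_Suc_shift: "cf_rest x (Suc j) = cf_rest (1 / frac x) j"
  by (induction j) auto

lemma cf_rest_add_int: "cf_rest (of_int a + x) j = cf_rest x j"
  by (induction j) (auto simp: frac_def)

lemma cf_real_bounds:
  assumes "\<And>a. a \<in> set as \<Longrightarrow> a \<ge> 1" "0 < \<tau>" "\<tau> < 1"
  shows "0 < cf_real as \<tau> \<and> cf_real as \<tau> < 1"
  using assms(1)
proof (induction as)
  case (Cons a as)
  then have "0 < cf_real as \<tau>" "a \<ge> 1" by auto
  then show ?case by (simp add: field_simps add_pos_pos)
qed (use assms in auto)

lemma cf_real_irrational: "\<tau> \<notin> \<rat> \<Longrightarrow> cf_real as \<tau> \<notin> \<rat>"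
proof (induction as)
  case (Cons a as)
  show ?case
  proof
    assume "cf_real (a # as) \<tau> \<in> \<rat>"
    then have "1 / cf_real (a # as) \<tau> - of_int a \<in> \<rat>" by (intro Rats_diff Rats_divide[OF Rats_1]) auto
    then show False using Cons by simp
  qed
qed simp

lemma cf_rest_cf_real_Cons:
  assumes "\<And>b. b \<in> set (a # as) \<Longrightarrow> b \<ge> 1" "0 < \<tau>" "\<tau> < 1"
  shows "cf_rest (cf_real (a # as) \<tau>) (Suc j) = cf_rest (cf_real as \<tau>) j"
proof -
  have "0 < cf_real (a # as) \<tau>" "cf_real (a # as) \<tau> < 1"
    using cf_real_bounds[of "a # as" \<tau>] assms by blast+
  then have "frac (cf_real (a # as) \<tau>) = cf_real (a # as) \<tau>" by (simp add: frac_eq)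
  then show ?thesis by (simp add: cf_rest_Suc_shift cf_rest_add_int del: cf_rest.simps)
qed

lemma cf_rest_cf_real_drop:
  assumes "\<And>a. a \<in> set as \<Longrightarrow> a \<ge> 1" "0 < \<tau>" "\<tau> < 1" "i \<le> length as"
  shows "cf_rest (cf_real as \<tau>) i = cf_real (drop i as) \<tau>"
  using assms(1,4)
proof (induction as arbitrary: i)
  case Nil
  then show ?case using assms by (simp add: frac_eq)
next
  case (Cons a as)
  show ?case
  proof (cases i)
    case 0
    then show ?thesis using cf_real_bounds[of "a # as" \<tau>] Cons.prems assms by (simp add: frac_eq)
  next
    case (Suc l)
    have "cf_rest (cf_real as \<tau>) l = cf_real (drop l as) \<tau>" using Cons Suc by simp
    then show ?thesis using cf_rest_cf_real_Cons[of a as \<tau> l] Cons.prems assms Suc by (simp del: cf_rest.simps cf_real.simps)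
  qed
qed

lemma cf_rest_cf_real_add:
  assumes "\<And>a. a \<in> set as \<Longrightarrow> a \<ge> 1" "0 < \<tau>" "\<tau> < 1"
  shows "cf_rest (cf_real as \<tau>) (length as + j) = cf_rest \<tau> j"
  using assms(1)
proof (induction as)
  case (Cons a as)
  then have "cf_rest (cf_real as \<tau>) (length as + j) = cf_rest \<tau> j" by simp
  then show ?case using cf_rest_cf_real_Cons[of a as \<tau> "length as + j"] Cons.prems assms
    by (simp del: cf_rest.simps cf_real.simps)
qed simp

text \<open>Every partial value lies strictly between 0 and 1, so inversion followed by
  \<open>frac\<close> removes exactly one prescribed quotient; once the list is used up, the
  expansion of \<tau> takes over.\<close>

lemma quots_cf_real:
  assumes "\<And>a. a \<in> set as \<Longrightarrow> a \<ge> 1" "0 < \<tau>" "\<tau> < 1"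
  shows "i < length as \<Longrightarrow> quots (cf_real as \<tau>) i = as ! i"
    and "quots (cf_real as \<tau>) (length as + j) = quots \<tau> j"
proof -
  assume i: "i < length as"
  have "0 < cf_real (drop (Suc i) as) \<tau> \<and> cf_real (drop (Suc i) as) \<tau> < 1"
    using assms by (intro cf_real_bounds) (auto dest: in_set_dropD)
  moreover have "drop i as = as ! i # drop (Suc i) as" using i by (simp add: Cons_nth_drop_Suc)
  ultimately show "quots (cf_real as \<tau>) i = as ! i"
    using cf_rest_cf_real_drop[of as \<tau> i] assms i
    by (simp add: cf_quot_def floor_eq_iff)
qed (use cf_rest_cf_real_add[of as \<tau> j] assms in \<open>simp add: cf_quot_def\<close>)

text \<open>The number [0, 1, 1, 1, ...]. As a tail it makes the denominators at most double at each
  step, which \<psi>(m) \<le> 1/(2m) always permits. It also serves as an explicit irrational for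
  small perturbations.\<close>

definition golden :: real where "golden = (sqrt 5 - 1) / 2"

lemma golden_bounds: "0 < golden" "golden < 1"
proof -
  have "sqrt 5 > sqrt 1" by (subst real_sqrt_less_iff) simp
  then show "0 < golden" by (simp add: golden_def)
  have "sqrt 5 < sqrt 9" by (subst real_sqrt_less_iff) simp
  then show "golden < 1" by (simp add: golden_def)
qed

lemma golden_eq: "golden * golden + golden = 1"
  by (simp add: golden_def field_simps)

lemma golden_irrational: "golden \<notin> \<rat>"
proof
  assume "golden \<in> \<rat>"
  then obtain p q :: int where pq: "q > 0" "coprime p q" "golden = of_int p / of_int q" by (rule Rats_cases')
  then have "of_int (p * p + p * q) = (of_int (q * q) :: real)"
  proof -
    have "real_of_int p / real_of_int q * (real_of_int p / real_of_int q) + real_of_int p / real_of_int q = 1"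
      using golden_eq unfolding pq(3) .
    then show ?thesis using pq(1) by (simp add: field_simps)
  qed
  then have e: "p * p + p * q = q * q" by linarith
  have "p * (p + q) = q * q" using e by (simp add: algebra_simps)
  then have "p dvd q * q" by (metis dvd_triv_left)
  moreover have "coprime p (q * q)" using pq(2) by simp
  ultimately have "is_unit p" using coprime_common_divisor[of p "q * q" p] by simp
  moreover have "p > 0"
  proof -
    have "0 < real_of_int p / real_of_int q" using golden_bounds(1) unfolding pq(3) .
    then show ?thesis using pq(1) by (simp add: zero_less_divide_iff)
  qed
  ultimately have p: "p = 1" by simp
  have "q * q = 1 + q" using e p by simp
  then have "q * (q - 1) = 1" by (simp add: algebra_simps)
  then show False using pq(1) zmult_eq_1_iff[of q "q - 1"] by auto
qed

lemma cf_rest_golden: "cf_rest golden j = golden"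
proof (induction j)
  case 0
  then show ?case using golden_bounds by (simp add: frac_eq)
next
  case (Suc j)
  have "1 / golden = 1 + golden" using golden_eq golden_bounds by (simp add: field_simps)
  then have "frac (1 / golden) = golden" using golden_bounds by (simp add: frac_unique_iff)
  then show ?case using Suc by simp
qed

lemma quots_golden: "quots golden j = 1"
proof -
  have "1 / golden = 1 + golden" using golden_eq golden_bounds by (simp add: field_simps)
  then show ?thesis using golden_bounds by (simp add: cf_quot_def cf_rest_golden floor_eq_iff)
qed

lemma cf_quot_add_int: "cf_quot (of_int a + x) j = cf_quot x j"
  by (simp add: cf_quot_def cf_rest_add_int)

section \<open>The gaps of \<open>C_set \<psi>\<close>\<close>

locale exp_approximation =
  fixes \<gamma> \<alpha> :: real and \<psi> :: "nat \<Rightarrow> real"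
  assumes \<gamma>: "0 < \<gamma>" "\<gamma> < 1"
    and approx: "approximation_function \<psi>"
    and \<psi>_eq: "\<forall>m\<ge>1. \<psi> m = \<gamma> * exp (- \<alpha> * real m)"
begin

lemma \<psi>_pos: "m \<ge> 1 \<Longrightarrow> 0 < \<psi> m"
  and \<psi>_le: "m \<ge> 1 \<Longrightarrow> \<psi> m \<le> 1 / (2 * real m)"
  using approx by (auto simp: approximation_function_def)

lemma \<psi>_mono: "1 \<le> m \<Longrightarrow> m \<le> n \<Longrightarrow> \<psi> n \<le> \<psi> m"
  using approx unfolding approximation_function_def by (auto dest!: monotone_onD[of _ _ _ _ m n])

text \<open>Otherwise \<psi> would stay above \<gamma>, against \<psi>(m) \<le> 1/(2m).\<close>

lemma \<alpha>_pos: "0 < \<alpha>"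
proof (rule ccontr)
  assume "\<not> 0 < \<alpha>"
  then have "exp (- \<alpha> * real m) \<ge> 1" for m :: nat by (simp add: mult_nonpos_nonneg)
  then have ge: "\<gamma> \<le> \<psi> m" if "m \<ge> 1" for m using \<psi>_eq that \<gamma> by simp
  obtain m :: nat where m: "1 / \<gamma> < real m" using reals_Archimedean2 by blast
  have "1 / \<gamma> > 0" using \<gamma> by simp
  then have "real m > 0" using m by linarith
  then have m1: "m \<ge> 1" by simp
  have "\<gamma> \<le> 1 / (2 * real m)" using ge[OF m1] \<psi>_le[OF m1] by linarith
  then have "\<gamma> * (2 * real m) \<le> 1" using m1 by (simp add: field_simps)
  moreover have "1 < \<gamma> * real m" using m \<gamma> by (simp add: field_simps)
  ultimately show False by linarith
qed

text \<open>Summing the geometric series turns the summability condition into q (1 + 2 \<gamma>) < 1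
  with q = exp(-\<alpha>), and \<gamma> < 1 gives 3 \<gamma> q \<le> q (1 + 2 \<gamma>). The value
  1/3 keeps the bump radius 3/2 \<psi>(m) at most 1/2, as \<open>rational_bump\<close>
  requires.\<close>

lemma \<psi>_less: assumes "m \<ge> 1" shows "\<psi> m < 1 / 3"
proof -
  define q where "q = exp (- \<alpha>)"
  have q: "0 < q" "q < 1" using \<alpha>_pos by (auto simp: q_def)
  have "\<psi> (Suc m) = \<gamma> * q * q ^ m" for m
  proof -
    have "\<psi> (Suc m) = \<gamma> * exp (- \<alpha> * real (Suc m))" using \<psi>_eq by simp
    also have "exp (- \<alpha> * real (Suc m)) = q ^ Suc m" unfolding q_def exp_of_nat_mult[symmetric] by (simp add: algebra_simps)
    finally show ?thesis by simp
  qed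
  moreover have "(\<lambda>m. \<gamma> * q * q ^ m) sums (\<gamma> * q * (1 / (1 - q)))"
    by (rule sums_mult[OF geometric_sums]) (use q in simp)
  ultimately have "(\<lambda>m. \<psi> (Suc m)) sums (\<gamma> * q * (1 / (1 - q)))" by (simp only:)
  then have "2 * (\<gamma> * q * (1 / (1 - q))) < 1"
    using approx by (auto simp: approximation_function_def sums_iff)
  then have "2 * \<gamma> * q < 1 - q" using q by (simp add: field_simps)
  then have a: "q * (1 + 2 * \<gamma>) < 1" by (simp add: algebra_simps)
  have "\<psi> 1 = \<gamma> * q" using \<psi>_eq by (simp add: q_def)
  moreover have "3 * (\<gamma> * q) \<le> q * (1 + 2 * \<gamma>)"
  proof -
    have "q * \<gamma> \<le> q * 1" using \<gamma> q by (intro mult_left_mono) auto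
    then show ?thesis by (simp add: algebra_simps)
  qed
  ultimately have "\<psi> 1 < 1 / 3" using a by linarith
  then show ?thesis using \<psi>_mono[of 1 m] assms by simp
qed

text \<open>The size of a gap around a fraction with denominator m: a violation of the condition at
  m_k = m puts the number within \<open>\<rho> m\<close> of its k-th convergent.\<close>

definition \<rho> :: "nat \<Rightarrow> real" where "\<rho> m = \<psi> m / real m"

lemma \<rho>_pos: "m \<ge> 1 \<Longrightarrow> \<rho> m > 0"
  using \<psi>_pos by (simp add: \<rho>_def)

lemma \<rho>_mono: "1 \<le> m \<Longrightarrow> m \<le> n \<Longrightarrow> \<rho> n \<le> \<rho> m"
  unfolding \<rho>_def using \<psi>_mono[of m n] \<psi>_pos[of m] by (intro frac_le) auto

text \<open>Cut the expansion of t at its first violation, replace the excessive quotient by the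
  largest admissible one and continue with the golden tail. Then t and the new point x are images of
  small remainders under the same \<open>cf_moebius\<close>, hence close to the same convergent and
  to each other.\<close>

lemma C_set_near_irrational:
  assumes t: "t \<notin> \<rat>" and viol: "real (cf_denom t (Suc k0)) > 1 / \<psi> (cf_denom t k0)"
  obtains i n x where "i \<le> k0" "x \<in> C_set \<psi>"
    "\<bar>t - of_int n / cf_denom t i\<bar> \<le> \<rho> (cf_denom t i)" "\<bar>t - x\<bar> \<le> 2 * \<rho> (cf_denom t i)"
proof -
  define k where "k = (LEAST k. real (cf_denom t (Suc k)) > 1 / \<psi> (cf_denom t k))"
  have kk: "real (cf_denom t (Suc k)) > 1 / \<psi> (cf_denom t k)"
    unfolding k_def using viol by (rule LeastI)
  have k_le: "k \<le> k0" unfolding k_def using viol by (rule Least_le)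
  have k_less: "real (cf_denom t (Suc i)) \<le> 1 / \<psi> (cf_denom t i)" if "i < k" for i
    using not_less_Least[OF that[unfolded k_def]] by simp
  let ?a = "quots t"
  have a1: "?a i \<ge> 1" for i using quots_ge_1[OF t] .
  define m where "m = cf_denom t k"
  define r where "r = real_of_int (cf_q ?a k)"
  have mq: "int m = cf_q ?a (Suc k)" using cf_denom_eq[OF t] by (simp add: m_def)
  have mr: "real_of_int (cf_q ?a (Suc k)) = real m" by (simp flip: mq)
  have m1: "m \<ge> 1" using cf_denom_ge_1[OF t] by (simp add: m_def)
  have r0: "0 \<le> r" using cf_q_nonneg_pos[of k ?a] a1 by (simp add: r_def)
  have rm: "r \<le> real m"
  proof (cases k)
    case 0 then show ?thesis by (simp add: r_def)
  next
    case (Suc j)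
    then have "r = real (cf_denom t j)" unfolding r_def using cf_denom_eq[OF t, of j] by (metis of_int_of_nat_eq)
    then show ?thesis using cf_denom_mono_Suc[OF t, of j] Suc by (simp add: m_def)
  qed
  define \<Psi> where "\<Psi> = 1 / \<psi> m"
  have \<psi>0: "\<psi> m > 0" using \<psi>_pos[OF m1] .
  have \<Psi>: "\<Psi> \<ge> 2 * real m" using \<psi>_le[OF m1] \<psi>0 m1 by (simp add: \<Psi>_def field_simps)
  \<comment> \<open>The largest quotient for which the next denominator A m + r is at most \<Psi>.
    It is at least 1 because r \<le> m and \<Psi> \<ge> 2 m.\<close>
  define A where "A = \<lfloor>(\<Psi> - r) / real m\<rfloor>"
  have "(\<Psi> - r) / real m \<ge> 1" using \<Psi> rm m1 by (simp add: field_simps)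
  then have A1: "A \<ge> 1" by (simp add: A_def)
  have "real_of_int A \<le> (\<Psi> - r) / real m" "(\<Psi> - r) / real m < real_of_int A + 1"
    by (auto simp: A_def)
  then have A_le: "real_of_int A * real m + r \<le> \<Psi>" and A_gt: "\<Psi> < real_of_int A * real m + r + real m"
    using m1 by (auto simp: field_simps)
  have den_t: "real (cf_denom t (Suc k)) = real_of_int (?a k) * real m + r"
  proof -
    have "int (cf_denom t (Suc k)) = ?a k * int m + cf_q ?a k" using cf_denom_eq[OF t, of "Suc k"] by (simp add: mq)
    then have "real_of_int (int (cf_denom t (Suc k))) = real_of_int (?a k * int m + cf_q ?a k)" by simp
    then show ?thesis by (simp add: r_def)
  qed
  have viol': "\<Psi> < real_of_int (?a k) * real m + r" using kk den_t by (simp add: \<Psi>_def m_def)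
  have "real_of_int A * real m < real_of_int (?a k) * real m" using viol' A_le by linarith
  then have "A < ?a k" using m1 by (simp add: mult_less_cancel_right)
  then have Aa: "real_of_int A + 1 \<le> real_of_int (?a k)" by linarith

  define as where "as = map ?a [0..<k] @ [A]"
  have as1: "a \<ge> 1" if "a \<in> set as" for a using that a1 A1 by (auto simp: as_def)
  define y where "y = cf_real as golden"
  define x where "x = of_int \<lfloor>t\<rfloor> + y"
  have y_irr: "y \<notin> \<rat>" unfolding y_def by (rule cf_real_irrational[OF golden_irrational])
  have x_irr: "x \<notin> \<rat>"
  proof
    assume "x \<in> \<rat>"
    then have "x - of_int \<lfloor>t\<rfloor> \<in> \<rat>" by (intro Rats_diff) auto
    then show False using y_irr by (simp add: x_def)
  qed
  have qx: "quots x i = quots y i" for i by (simp add: x_def cf_quot_add_int)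
  have len: "length as = Suc k" by (simp add: as_def)
  have q1: "quots x i = ?a i" if "i < k" for i
    using quots_cf_real(1)[of as golden i] as1 golden_bounds that len by (simp add: qx y_def as_def nth_append)
  have q2: "quots x k = A"
    using quots_cf_real(1)[of as golden k] as1 golden_bounds len by (simp add: qx y_def as_def nth_append)
  have q3: "quots x i = 1" if "i > k" for i
    using quots_cf_real(2)[of as golden "i - Suc k"] as1 golden_bounds that len quots_golden[of "i - Suc k"]
    by (simp add: qx y_def)
  have den_x: "cf_denom x i = cf_denom t i" if "i \<le> k" for i
    using cf_q_cong[of k "quots x" ?a "Suc i"] q1 that cf_denom_eq[OF x_irr, of i] cf_denom_eq[OF t, of i] by simp
  have den_xk: "real (cf_denom x (Suc k)) = real_of_int A * real m + r"
  proof -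
    have "int (cf_denom x (Suc k)) = A * int m + cf_q ?a k"
      using cf_denom_eq[OF x_irr, of "Suc k"] cf_q_cong[of k "quots x" ?a "Suc k"] cf_q_cong[of k "quots x" ?a k] q1 q2
      by (simp add: mq)
    then have "real_of_int (int (cf_denom x (Suc k))) = real_of_int (A * int m + cf_q ?a k)" by simp
    then show ?thesis by (simp add: r_def)
  qed
  have "real (cf_denom x (Suc i)) \<le> 1 / \<psi> (cf_denom x i)" for i
  proof -
    consider "i < k" | "i = k" | "i > k" by linarith
    then show ?thesis
    proof cases
      case 1
      then show ?thesis using k_less[of i] den_x[of i] den_x[of "Suc i"] by simp
    next
      case 2
      then show ?thesis using den_xk A_le den_x[of k] by (simp add: \<Psi>_def m_def)
    next
      case 3
      then obtain j where j: "i = Suc j" by (cases i) auto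
      \<comment> \<open>Past the modified quotient all quotients are 1, so the denominator at most
        doubles.\<close>
      have "int (cf_denom x (Suc i)) = int (cf_denom x i) + int (cf_denom x j)"
        using cf_denom_Suc_Suc[OF x_irr, of j] q3[of "Suc j"] 3 by (simp add: j)
      then have "cf_denom x (Suc i) \<le> 2 * cf_denom x i" using cf_denom_mono_Suc[OF x_irr, of j] j by simp
      then have "real (cf_denom x (Suc i)) \<le> 2 * real (cf_denom x i)" by linarith
      moreover have "2 * real (cf_denom x i) \<le> 1 / \<psi> (cf_denom x i)"
        using \<psi>_le[of "cf_denom x i"] \<psi>_pos[of "cf_denom x i"] cf_denom_ge_1[OF x_irr, of i]
        by (simp add: field_simps)
      ultimately show ?thesis by linarith
    qed
  qed
  then have xC: "x \<in> C_set \<psi>" using x_irr by (simp add: C_set_def)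

  define \<theta> where "\<theta> = cf_rest t k"
  define \<sigma> where "\<sigma> = 1 / (real_of_int A + golden)"
  have \<theta>0: "\<theta> > 0" using cf_rest_irrational[OF t, of k] by (simp add: \<theta>_def)
  have \<theta>1: "1 / \<theta> \<ge> real_of_int (?a k)"
    using cf_rest_step[of t k] cf_rest_irrational[OF t, of "Suc k"] by (simp add: \<theta>_def del: cf_rest.simps)
  have \<sigma>0: "\<sigma> > 0" using A1 golden_bounds by (simp add: \<sigma>_def)
  have \<sigma>1: "1 / \<sigma> \<ge> real_of_int A" using golden_bounds by (simp add: \<sigma>_def)
  have "1 / \<sigma> \<le> 1 / \<theta>" using \<theta>1 Aa golden_bounds by (simp add: \<sigma>_def)
  then have \<theta>\<sigma>: "\<theta> \<le> \<sigma>" using \<theta>0 \<sigma>0 by (simp add: field_simps)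
  have ym: "y = cf_moebius ?a k \<sigma>"
    using cf_real_moebius[of k ?a \<sigma>] a1 \<sigma>0 by (simp add: y_def as_def cf_real_append \<sigma>_def)
  have tm: "frac t = cf_moebius ?a k \<theta>" using frac_eq_moebius[OF t] by (simp add: \<theta>_def)
  have pm: "cf_moebius ?a k 0 = cf_p ?a (Suc k) / real m" by (simp add: cf_moebius_def mr)
  \<comment> \<open>The left side is the distance from the image of the remainder s to the
    convergent, and 1 / s * m + r is the next denominator that a quotient 1 / s would
    produce.\<close>
  have key: "s / ((real m + s * r) * real m) \<le> 1 / (B * real m)" if "s > 0" "B > 0" "B \<le> 1 / s * real m + r" for s B
  proof -
    have "s / ((real m + s * r) * real m) = 1 / ((1 / s * real m + r) * real m)"
      using that by (simp add: field_simps)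
    also have "\<dots> \<le> 1 / (B * real m)" using that m1 by (intro divide_left_mono mult_right_mono mult_pos_pos) auto
    finally show ?thesis .
  qed
  have d1: "\<bar>frac t - cf_p ?a (Suc k) / real m\<bar> \<le> \<rho> m"
  proof -
    have "\<bar>frac t - cf_p ?a (Suc k) / real m\<bar> = \<theta> / ((real m + \<theta> * r) * real m)"
      using cf_moebius_minus[of k ?a \<theta> 0] a1 \<theta>0 m1 r0
      by (simp add: tm flip: pm) (simp add: mr r_def abs_mult)
    also have "\<dots> \<le> 1 / (\<Psi> * real m)"
    proof (rule key)
      have "real_of_int (?a k) * real m \<le> 1 / \<theta> * real m" using \<theta>1 by (intro mult_right_mono) auto
      then show "\<Psi> \<le> 1 / \<theta> * real m + r" using viol' by linarith
    qed (use \<theta>0 \<Psi> m1 in auto)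
    also have "\<dots> = \<rho> m" by (simp add: \<Psi>_def \<rho>_def)
    finally show ?thesis .
  qed
  have d2: "\<bar>frac t - y\<bar> \<le> 2 * \<rho> m"
  proof -
    have pos: "real m + \<theta> * r \<ge> real m" "real m + \<sigma> * r > 0" using \<theta>0 \<sigma>0 r0 m1 by (auto simp: add_pos_nonneg)
    have "\<bar>frac t - y\<bar> = \<bar>\<theta> - \<sigma>\<bar> / \<bar>(real m + \<theta> * r) * (real m + \<sigma> * r)\<bar>"
      using cf_moebius_minus[of k ?a \<theta> \<sigma>] a1 \<theta>0 \<sigma>0 by (simp add: tm ym mr r_def abs_mult)
    also have "\<dots> = (\<sigma> - \<theta>) / ((real m + \<theta> * r) * (real m + \<sigma> * r))"
      using \<theta>\<sigma> pos m1 by simp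
    also have "\<dots> \<le> \<sigma> / (real m * (real m + \<sigma> * r))"
      using \<theta>0 \<theta>\<sigma> pos m1 by (intro frac_le mult_right_mono mult_pos_pos) auto
    also have "\<dots> = \<sigma> / ((real m + \<sigma> * r) * real m)" by (simp add: mult.commute)
    also have "\<dots> \<le> 1 / (\<Psi> / 2 * real m)"
    proof (rule key)
      have "real_of_int A * real m \<le> 1 / \<sigma> * real m" using \<sigma>1 by (intro mult_right_mono) auto
      \<comment> \<open>Maximality of A gives A m + r > \<Psi> - m, and m \<le> \<Psi> / 2. This is
        the source of the factor 2 in the bound on |t - x|.\<close>
      then show "\<Psi> / 2 \<le> 1 / \<sigma> * real m + r" using A_gt \<Psi> by linarith
    qed (use \<sigma>0 \<Psi> m1 in auto)
    also have "\<dots> = 2 * \<rho> m" by (simp add: \<Psi>_def \<rho>_def)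
    finally show ?thesis .
  qed
  have "t - of_int (cf_p ?a (Suc k) + int m * \<lfloor>t\<rfloor>) / real m = frac t - cf_p ?a (Suc k) / real m"
    using m1 by (simp add: frac_def field_simps)
  moreover have "t - x = frac t - y" by (simp add: x_def frac_def)
  ultimately show ?thesis
    using that[of k x "cf_p ?a (Suc k) + int m * \<lfloor>t\<rfloor>"] d1 d2 k_le xC by (simp add: m_def)
qed

text \<open>The factors 5/4 and 9/4 leave room for approximating a rational \<open>t\<close> by irrationals.\<close>

lemma C_set_near:
  assumes "t \<notin> C_set \<psi>"
  obtains m n x where "m \<ge> 1" "x \<in> C_set \<psi>"
    "\<bar>t - of_int n / real m\<bar> \<le> 5 / 4 * \<rho> m" "\<bar>t - x\<bar> \<le> 9 / 4 * \<rho> m"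
proof (cases "t \<in> \<rat>")
  case False
  then obtain k where "real (cf_denom t (Suc k)) > 1 / \<psi> (cf_denom t k)"
    using assms by (auto simp: C_set_def not_le)
  then obtain i n x where *: "x \<in> C_set \<psi>"
    "\<bar>t - of_int n / cf_denom t i\<bar> \<le> \<rho> (cf_denom t i)" "\<bar>t - x\<bar> \<le> 2 * \<rho> (cf_denom t i)"
    using C_set_near_irrational[OF False] by metis
  moreover have "cf_denom t i \<ge> 1" by (rule cf_denom_ge_1[OF False])
  moreover have "\<rho> (cf_denom t i) > 0" using calculation \<rho>_pos by blast
  ultimately show ?thesis by (intro that[of "cf_denom t i" x n]) auto
next
  case True
  then obtain n and m :: int where t: "t = of_int n / of_int m" "m > 0" by (rule Rats_cases')
  define M where "M = nat m"
  have M: "t = of_int n / real M" "M \<ge> 1" using t by (auto simp: M_def)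
  obtain N :: nat where N: "4 / \<rho> M < real N" using reals_Archimedean2 by blast
  have \<rho>M: "\<rho> M > 0" using \<rho>_pos M by blast
  have "0 < 4 / \<rho> M" using \<rho>M by simp
  then have N0: "real N > 0" using N by linarith
  \<comment> \<open>The rational t = n/M is moved by an irrational step s < \<open>\<rho> M\<close>
    / 4. The moved point is so close to n/M that best approximation forces a violation at some m_k
    \<le> M. As \<rho> decreases, moving back costs at most a quarter of \<rho> at the denominator
    found.\<close>
  define s where "s = golden / real N"
  have s0: "s > 0" using golden_bounds N0 by (simp add: s_def)
  have "1 / real N < \<rho> M / 4" using N N0 \<rho>M by (simp add: field_simps)
  moreover have "s < 1 / real N" using golden_bounds N0 by (simp add: s_def divide_strict_right_mono)
  ultimately have s1: "s < \<rho> M / 4" by linarith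
  define t' where "t' = t + s"
  have irr: "t' \<notin> \<rat>"
  proof
    assume "t' \<in> \<rat>"
    then have "(t' - t) * of_nat N \<in> \<rat>" using True by (intro Rats_mult Rats_diff) auto
    then show False using golden_irrational N0 by (simp add: t'_def s_def)
  qed
  obtain k where k: "cf_denom t' k \<le> M" "M < cf_denom t' (Suc k)"
    using cf_denom_bracket[OF irr M(2)] by blast
  have "1 / (2 * real (cf_denom t' (Suc k))) \<le> \<bar>real M * t' - of_int n\<bar>"
    by (rule best_approximation[OF irr M(2) k(2)])
  also have "real M * t' - of_int n = real M * s" using M by (simp add: t'_def field_simps)
  also have "\<bar>real M * s\<bar> < real M * (\<rho> M / 2)" using s1 s0 M \<rho>M by simp
  also have "\<dots> = \<psi> M / 2" using M by (simp add: \<rho>_def)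
  also have "\<dots> \<le> \<psi> (cf_denom t' k) / 2" using \<psi>_mono[OF cf_denom_ge_1[OF irr] k(1)] by simp
  finally have "1 / (2 * real (cf_denom t' (Suc k))) < \<psi> (cf_denom t' k) / 2" .
  then have "real (cf_denom t' (Suc k)) > 1 / \<psi> (cf_denom t' k)"
    using \<psi>_pos[OF cf_denom_ge_1[OF irr, of k]] cf_denom_ge_1[OF irr, of "Suc k"] by (simp add: field_simps)
  then obtain i n' x where *: "i \<le> k" "x \<in> C_set \<psi>"
    "\<bar>t' - of_int n' / cf_denom t' i\<bar> \<le> \<rho> (cf_denom t' i)" "\<bar>t' - x\<bar> \<le> 2 * \<rho> (cf_denom t' i)"
    using C_set_near_irrational[OF irr] by metis
  have "cf_denom t' i \<le> cf_denom t' k"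
    using *(1) by (rule lift_Suc_mono_le[of "cf_denom t'", rotated]) (rule cf_denom_mono_Suc[OF irr])
  then have "\<rho> M \<le> \<rho> (cf_denom t' i)" using \<rho>_mono[OF cf_denom_ge_1[OF irr]] k by simp
  moreover have "\<bar>t - t'\<bar> = s" using s0 by (simp add: t'_def)
  ultimately have "\<bar>t - of_int n' / cf_denom t' i\<bar> \<le> 5 / 4 * \<rho> (cf_denom t' i)" "\<bar>t - x\<bar> \<le> 9 / 4 * \<rho> (cf_denom t' i)"
    using *(3,4) s1 by linarith+
  then show ?thesis using *(2) cf_denom_ge_1[OF irr, of i] by (intro that[of "cf_denom t' i" x n'])
qed

lemma C_set_nonempty: "C_set \<psi> \<noteq> {}"
  using C_set_near[of 0] by blast

end

text \<open>A finite net reduces the claim to finitely many null sequences. The centres of the net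
  need not belong to A, so each one that has an element of A nearby is replaced by it; this is why
  thirds of \<eta> are used.\<close>

lemma totally_bounded_c0_uniform:
  assumes "totally_bounded A" "A \<subseteq> c0" "\<eta> > 0"
  obtains k0 where "\<And>s k. s \<in> A \<Longrightarrow> k \<ge> k0 \<Longrightarrow> apply_bcontfun s k \<le> \<eta>"
proof -
  obtain F where F: "finite F" "A \<subseteq> (\<Union>x\<in>F. {y. dist x y < \<eta> / 3})"
    using assms(1,3) unfolding totally_bounded_metric by (meson divide_pos_pos zero_less_numeral)
  have "\<exists>k0. \<forall>s\<in>A. dist x s < \<eta> / 3 \<longrightarrow> (\<forall>k\<ge>k0. apply_bcontfun s k \<le> \<eta>)" for x
  proof (cases "\<exists>a\<in>A. dist x a < \<eta> / 3")
    case True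
    then obtain a where a: "a \<in> A" "dist x a < \<eta> / 3" by blast
    have "apply_bcontfun a \<longlonglongrightarrow> 0" using a assms(2) by (auto simp: c0_def)
    then obtain k0 where k0: "\<And>k. k \<ge> k0 \<Longrightarrow> \<bar>apply_bcontfun a k\<bar> < \<eta> / 3"
      using LIMSEQ_D[of "apply_bcontfun a" 0 "\<eta> / 3"] assms(3) by auto
    show ?thesis
    proof (intro exI ballI impI allI)
      fix s k assume s: "s \<in> A" "dist x s < \<eta> / 3" and k: "k \<ge> k0"
      have "dist (apply_bcontfun s k) (apply_bcontfun a k) \<le> dist s a" by (rule dist_bounded)
      also have "\<dots> \<le> dist x s + dist x a" by (metis dist_commute dist_triangle2 dist_triangle3)
      finally show "apply_bcontfun s k \<le> \<eta>" using s a k0[OF k] by (simp add: dist_real_def)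
    qed
  next
    case False
    then show ?thesis by blast
  qed
  then obtain K where K: "\<And>x s k. s \<in> A \<Longrightarrow> dist x s < \<eta> / 3 \<Longrightarrow> k \<ge> K x \<Longrightarrow> apply_bcontfun s k \<le> \<eta>"
    by metis
  show ?thesis
  proof (rule that[of "Max (insert 0 (K ` F))"])
    fix s k assume s: "s \<in> A" and k: "k \<ge> Max (insert 0 (K ` F))"
    obtain x where x: "x \<in> F" "dist x s < \<eta> / 3" using F s by blast
    have "K x \<le> Max (insert 0 (K ` F))" using F x by (intro Max_ge) auto
    then show "apply_bcontfun s k \<le> \<eta>" using K[OF s x(2), of k] k by linarith
  qed
qed

section \<open>Distance from the points of \<open>W_set\<close> to the rationals\<close>

context exp_approximation
begin

context
  fixes A :: "(nat \<Rightarrow>\<^sub>C real) set"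
  assumes tb: "totally_bounded A" and sub: "A \<subseteq> c0" and norm_le: "\<forall>s\<in>A. norm s \<le> \<alpha>"
begin

lemma A_le: "s \<in> A \<Longrightarrow> apply_bcontfun s k \<le> \<alpha>"
  using norm_bounded[of s k] norm_le by fastforce

lemma W_set_subset_C_set: "W_set A (8 * \<gamma>) \<subseteq> C_set \<psi>"
proof
  fix x assume "x \<in> W_set A (8 * \<gamma>)"
  then obtain s where x: "x \<notin> \<rat>" and s: "s \<in> A" and
    le: "\<And>k. real (cf_denom x (Suc k)) \<le> inverse (8 * \<gamma>) * exp (apply_bcontfun s k * real (cf_denom x k))"
    by (auto simp: W_set_def)
  have "real (cf_denom x (Suc k)) \<le> 1 / \<psi> (cf_denom x k)" for k
  proof -
    have "inverse (8 * \<gamma>) * exp (apply_bcontfun s k * real (cf_denom x k)) \<le> inverse \<gamma> * exp (\<alpha> * real (cf_denom x k))"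
      using A_le[OF s, of k] \<gamma> by (intro mult_mono) (auto intro!: mult_right_mono)
    also have "\<dots> = 1 / \<psi> (cf_denom x k)"
    proof -
      have "\<psi> (cf_denom x k) = \<gamma> * exp (- \<alpha> * real (cf_denom x k))" using \<psi>_eq cf_denom_ge_1[OF x, of k] by blast
      then show ?thesis by (simp add: exp_minus divide_inverse)
    qed
    finally show ?thesis using le[of k] by linarith
  qed
  then show "x \<in> C_set \<psi>" using x by (simp add: C_set_def)
qed

text \<open>Best approximation at the scale m_k \<le> m < m_{k+1}: inverting the bound on m_{k+1}
  turns 1/(8 \<gamma>) together with the factor 2 into 4 \<gamma>.\<close>

lemma W_set_approx:
  assumes y: "y \<in> W_set A (8 * \<gamma>)" and m: "m \<ge> 1"
  obtains s k where "s \<in> A" "cf_denom y k \<le> m"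
    "\<bar>real m * y - of_int n\<bar> \<ge> 4 * \<gamma> * exp (- (apply_bcontfun s k * real (cf_denom y k)))"
proof -
  obtain s where irr: "y \<notin> \<rat>" and s: "s \<in> A" and
    le: "\<And>k. real (cf_denom y (Suc k)) \<le> inverse (8 * \<gamma>) * exp (apply_bcontfun s k * real (cf_denom y k))"
    using y by (auto simp: W_set_def)
  obtain k where k: "cf_denom y k \<le> m" "m < cf_denom y (Suc k)" using cf_denom_bracket[OF irr m] .
  have "4 * \<gamma> * exp (- (apply_bcontfun s k * real (cf_denom y k))) =
      1 / (2 * (inverse (8 * \<gamma>) * exp (apply_bcontfun s k * real (cf_denom y k))))"
    using \<gamma> by (simp add: exp_minus field_simps)
  also have "\<dots> \<le> 1 / (2 * real (cf_denom y (Suc k)))"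
    using le[of k] k(2) \<gamma> by (intro divide_left_mono) auto
  also have "\<dots> \<le> \<bar>real m * y - of_int n\<bar>" by (rule best_approximation[OF irr m k(2)])
  finally show ?thesis using that s k by blast
qed

text \<open>Only s_k \<le> \<alpha> enters. The constant 4 has to exceed the sums 5/4 + 9/4 and 3/2
  + 9/4 of the radii that meet in \<open>flat_majorant\<close>.\<close>

lemma W_set_dist_ge:
  assumes "y \<in> W_set A (8 * \<gamma>)" "m \<ge> 1"
  shows "\<bar>y - of_int n / real m\<bar> \<ge> 4 * \<rho> m"
proof -
  obtain s k where sk: "s \<in> A" "cf_denom y k \<le> m"
    "\<bar>real m * y - of_int n\<bar> \<ge> 4 * \<gamma> * exp (- (apply_bcontfun s k * real (cf_denom y k)))"
    using W_set_approx[OF assms, where n = n] .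
  have "apply_bcontfun s k * real (cf_denom y k) \<le> \<alpha> * real m"
    using A_le[OF sk(1), of k] sk(2) \<alpha>_pos by (intro mult_mono) auto
  then have "\<gamma> * exp (- (\<alpha> * real m)) \<le> \<gamma> * exp (- (apply_bcontfun s k * real (cf_denom y k)))"
    using \<gamma> by simp
  moreover have "\<psi> m = \<gamma> * exp (- (\<alpha> * real m))" using \<psi>_eq assms by simp
  ultimately have "4 * \<psi> m \<le> \<bar>real m * y - of_int n\<bar>" using sk(3) by linarith
  also have "\<dots> = real m * \<bar>y - of_int n / real m\<bar>" using assms(2) by (simp add: abs_mult_pos' field_simps flip: abs_mult)
  finally show ?thesis using assms(2) by (simp add: \<rho>_def field_simps)
qed

text \<open>Iterate m_{k+1} \<le> exp(\<alpha> m_k) / (8 \<gamma>). The uniformity in y takes care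
  of the finitely many indices at which the terms of the sequences in A are not yet small.\<close>

lemma W_set_denom_bound:
  obtains M where "\<And>y. y \<in> W_set A (8 * \<gamma>) \<Longrightarrow> real (cf_denom y k) \<le> M"
proof -
  have "\<exists>M. \<forall>y\<in>W_set A (8 * \<gamma>). real (cf_denom y k) \<le> M"
  proof (induction k)
    case 0
    have "\<forall>y\<in>W_set A (8 * \<gamma>). real (cf_denom y 0) \<le> 1" by (auto simp: W_set_def)
    then show ?case by blast
  next
    case (Suc k)
    then obtain M where M: "\<forall>y\<in>W_set A (8 * \<gamma>). real (cf_denom y k) \<le> M" by blast
    show ?case
    proof (intro exI ballI)
      fix y assume y: "y \<in> W_set A (8 * \<gamma>)"
      then obtain s where s: "s \<in> A" and
        le: "real (cf_denom y (Suc k)) \<le> inverse (8 * \<gamma>) * exp (apply_bcontfun s k * real (cf_denom y k))"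
        by (auto simp: W_set_def)
      have "apply_bcontfun s k * real (cf_denom y k) \<le> \<alpha> * M"
        using A_le[OF s, of k] M y \<alpha>_pos by (intro mult_mono) auto
      then have "inverse (8 * \<gamma>) * exp (apply_bcontfun s k * real (cf_denom y k)) \<le> inverse (8 * \<gamma>) * exp (\<alpha> * M)"
        using \<gamma> by simp
      then show "real (cf_denom y (Suc k)) \<le> inverse (8 * \<gamma>) * exp (\<alpha> * M)" using le by linarith
    qed
  qed
  then show ?thesis using that by blast
qed

text \<open>From some index on every s in A satisfies s_k \<le> \<eta>', and before it m_k is
  bounded on \<open>W_set\<close>; in both cases s_k m_k is at most \<eta>' m plus a
  constant.\<close>

lemma W_set_dist_ge_exp:
  assumes "\<eta> > 0"
  obtains c where "c > 0"
    "\<And>y m n. y \<in> W_set A (8 * \<gamma>) \<Longrightarrow> m \<ge> 1 \<Longrightarrow> \<bar>y - of_int n / real m\<bar> \<ge> c * exp (- \<eta> * real m)"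
proof -
  \<comment> \<open>The other half of \<eta> pays for the factor 1/m between |m y - n| and |y -
    n/m|.\<close>
  define \<eta>' where "\<eta>' = \<eta> / 2"
  have \<eta>': "\<eta>' > 0" using assms by (simp add: \<eta>'_def)
  obtain k0 where k0: "\<And>s k. s \<in> A \<Longrightarrow> k \<ge> k0 \<Longrightarrow> apply_bcontfun s k \<le> \<eta>'"
    using totally_bounded_c0_uniform[OF tb sub \<eta>'] by blast
  obtain M where M: "\<And>y. y \<in> W_set A (8 * \<gamma>) \<Longrightarrow> real (cf_denom y k0) \<le> M" using W_set_denom_bound[of k0] by blast
  define M' where "M' = max 0 M"
  define c where "c = 4 * \<gamma> * exp (- (\<alpha> * M'))"
  have c: "c > 0" using \<gamma> by (simp add: c_def)
  have main: "\<bar>real m * y - of_int n\<bar> \<ge> c * exp (- \<eta>' * real m)" if y: "y \<in> W_set A (8 * \<gamma>)" and m: "m \<ge> 1" for y m n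
  proof -
    obtain s k where sk: "s \<in> A" "cf_denom y k \<le> m"
      "\<bar>real m * y - of_int n\<bar> \<ge> 4 * \<gamma> * exp (- (apply_bcontfun s k * real (cf_denom y k)))"
      using W_set_approx[OF y m, where n = n] .
    have irr: "y \<notin> \<rat>" using y by (simp add: W_set_def)
    have "apply_bcontfun s k * real (cf_denom y k) \<le> \<alpha> * M' + \<eta>' * real m"
    proof (cases "k \<ge> k0")
      case True
      have "apply_bcontfun s k * real (cf_denom y k) \<le> \<eta>' * real m"
        using k0[OF sk(1) True] sk(2) \<eta>' by (intro mult_mono) auto
      then show ?thesis using \<alpha>_pos by (simp add: M'_def add_increasing)
    next
      case False
      then have "cf_denom y k \<le> cf_denom y k0"
        by (intro lift_Suc_mono_le[of "cf_denom y", OF cf_denom_mono_Suc[OF irr]]) simp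
      then have "real (cf_denom y k) \<le> M'" using M[OF y] by (simp add: M'_def)
      then have "apply_bcontfun s k * real (cf_denom y k) \<le> \<alpha> * M'"
        using A_le[OF sk(1), of k] \<alpha>_pos by (intro mult_mono) auto
      then show ?thesis using \<eta>' by (simp add: add_increasing2)
    qed
    then have "exp (- (\<alpha> * M' + \<eta>' * real m)) \<le> exp (- (apply_bcontfun s k * real (cf_denom y k)))" by simp
    then have "4 * \<gamma> * exp (- (\<alpha> * M' + \<eta>' * real m)) \<le> \<bar>real m * y - of_int n\<bar>"
      using sk(3) \<gamma> by (smt (verit) mult_left_mono)
    moreover have "exp (- (\<alpha> * M' + \<eta>' * real m)) = exp (- (\<alpha> * M')) * exp (- \<eta>' * real m)"
      by (simp flip: exp_add)
    ultimately show ?thesis by (simp add: c_def mult.assoc)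
  qed
  show ?thesis
  proof (rule that[of "c * \<eta>'"])
    show "c * \<eta>' > 0" using c \<eta>' by simp
    fix y m n assume y: "y \<in> W_set A (8 * \<gamma>)" and m: "m \<ge> (1::nat)"
    have "\<eta>' * real m \<le> exp (\<eta>' * real m)" using exp_ge_add_one_self[of "\<eta>' * real m"] by linarith
    then have "c * (\<eta>' * real m) * exp (- \<eta> * real m) \<le> c * exp (\<eta>' * real m) * exp (- \<eta> * real m)"
      using c by (intro mult_right_mono mult_left_mono) auto
    also have "\<dots> = c * exp (- \<eta>' * real m)"
      by (simp add: \<eta>'_def field_simps flip: exp_add)
    also have "\<dots> \<le> \<bar>real m * y - of_int n\<bar>" by (rule main[OF y m])
    also have "\<dots> = real m * \<bar>y - of_int n / real m\<bar>" using m by (simp add: abs_mult_pos' field_simps flip: abs_mult)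
    finally have "real m * (c * \<eta>' * exp (- \<eta> * real m)) \<le> real m * \<bar>y - of_int n / real m\<bar>"
      by (simp add: algebra_simps)
    then show "\<bar>y - of_int n / real m\<bar> \<ge> c * \<eta>' * exp (- \<eta> * real m)" using m by simp
  qed
qed

end
end

section \<open>A flat majorant of the distance to $C_\psi$\<close>

lemma exp_eventually_dominates:
  fixes a b C D :: real
  assumes "b < a" "D > 0"
  obtains N :: nat where "\<And>m. m \<ge> N \<Longrightarrow> C * exp (- a * real m) \<le> D * exp (- b * real m)"
proof -
  obtain N :: nat where N: "C / (D * (a - b)) \<le> real N" using real_arch_simple by blast
  have ab: "D * (a - b) > 0" using assms by simp
  show ?thesis
  proof (rule that[of N])
    fix m :: nat assume m: "m \<ge> N"
    have "C \<le> real N * (D * (a - b))" using N ab by (simp add: pos_divide_le_eq)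
    also have "\<dots> \<le> real m * (D * (a - b))" using m ab by (intro mult_right_mono) auto
    also have "\<dots> = D * ((a - b) * real m)" by simp
    also have "\<dots> \<le> D * exp ((a - b) * real m)"
      using assms exp_ge_add_one_self[of "(a - b) * real m"] by (intro mult_left_mono) linarith+
    finally have "C * exp (- a * real m) \<le> D * exp ((a - b) * real m) * exp (- a * real m)"
      by (intro mult_right_mono) auto
    also have "\<dots> = D * exp (- b * real m)" by (simp add: algebra_simps flip: exp_add)
    finally show "C * exp (- a * real m) \<le> D * exp (- b * real m)" .
  qed
qed

lemma series_C1:
  fixes f f' :: "nat \<Rightarrow> real \<Rightarrow> real"
  assumes d: "\<And>i t. (f i has_real_derivative f' i t) (at t)"
    and c: "\<And>i. continuous_on UNIV (f' i)"
    and b: "\<And>i t. \<bar>f i t\<bar> \<le> A i" "\<And>i t. \<bar>f' i t\<bar> \<le> A i" and A: "summable A"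
  shows "((\<lambda>t. \<Sum>i. f i t) has_real_derivative (\<Sum>i. f' i t)) (at t)"
    and "continuous_on UNIV (\<lambda>t. \<Sum>i. f' i t)"
    and "summable (\<lambda>i. f i t)" and "summable (\<lambda>i. f' i t)"
proof -
  show s: "summable (\<lambda>i. f i t)" and "summable (\<lambda>i. f' i t)" for t
    using b A by (auto intro: summable_comparison_test')
  have u: "uniform_limit UNIV (\<lambda>n t. \<Sum>i<n. f' i t) (\<lambda>t. \<Sum>i. f' i t) sequentially"
    by (rule Weierstrass_m_test[OF _ A]) (use b in auto)
  show "((\<lambda>t. \<Sum>i. f i t) has_real_derivative (\<Sum>i. f' i t)) (at t)"
    by (rule has_field_derivative_series'(2)[of UNIV _ _ 0])
      (use d s u in \<open>auto simp: uniformly_convergent_on_def\<close>)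
  show "continuous_on UNIV (\<lambda>t. \<Sum>i. f' i t)"
    by (rule uniform_limit_theorem[OF _ u]) (auto intro!: always_eventually continuous_on_sum c)
qed

text \<open>Averaging over a window of half-width \<epsilon> makes a Lipschitz function C^1, keeps
  its slope at most 1 and moves values by at most \<epsilon>. Lowering \<delta> by 2 \<epsilon>
  beforehand keeps the average below \<delta> and makes it vanish wherever \<delta> \<le>
  \<epsilon>.\<close>

lemma lipschitz_C1_minorant:
  fixes \<delta> :: "real \<Rightarrow> real"
  assumes lip: "\<And>s t. \<bar>\<delta> s - \<delta> t\<bar> \<le> \<bar>s - t\<bar>" and nonneg: "\<And>t. \<delta> t \<ge> 0"
    and per: "\<And>t. \<delta> (t + 1) = \<delta> t" and \<epsilon>: "\<epsilon> > 0"
  obtains u u' where "\<And>t. (u has_real_derivative u' t) (at t)" "continuous_on UNIV u'"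
    "\<And>t. u (t + 1) = u t" "\<And>t. 0 \<le> u t" "\<And>t. u t \<le> \<delta> t" "\<And>t. \<delta> t - 3 * \<epsilon> \<le> u t"
    "\<And>t. u t > 0 \<Longrightarrow> \<delta> t > \<epsilon>" "\<And>t. \<bar>u' t\<bar> \<le> 1"
proof -
  define g where "g s = max 0 (\<delta> s - 2 * \<epsilon>)" for s
  have g_lip: "\<bar>g s - g t\<bar> \<le> \<bar>s - t\<bar>" for s t using lip[of s t] by (auto simp: g_def)
  have gc: "continuous_on S g" for S
  proof (rule continuous_on_subset[of UNIV], unfold continuous_on_iff, intro ballI allI impI)
    fix x e :: real assume "e > 0"
    then show "\<exists>d>0. \<forall>x'\<in>UNIV. dist x' x < d \<longrightarrow> dist (g x') (g x) < e"
      using g_lip by (intro exI[of _ e]) (auto simp: dist_real_def intro: le_less_trans)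
  qed simp
  have gi: "g integrable_on {a..b}" for a b using gc by (rule integrable_continuous_interval)
  define u where "u t = integral {t - \<epsilon>..t + \<epsilon>} g / (2 * \<epsilon>)" for t
  define u' where "u' t = (g (t + \<epsilon>) - g (t - \<epsilon>)) / (2 * \<epsilon>)" for t
  show ?thesis
  proof (rule that[of u u'])
    fix t :: real
    show "(u has_real_derivative u' t) (at t)"
    proof -
      \<comment> \<open>The integral over the moving window is a difference of two values of one
        primitive; the margin 1 keeps both ends inside {a..b} for x near t.\<close>
      define a b where "a = t - \<epsilon> - 1" and "b = t + \<epsilon> + 1"
      define G where "G x = integral {a..x} g" for x
      have G: "(G has_real_derivative g x) (at x)" if "x \<in> {a<..<b}" for x
      proof -
        have "(G has_real_derivative g x) (at x within {a..b})"
          unfolding G_def using that by (intro integral_has_real_derivative gc) auto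
        then show ?thesis using that by (simp add: at_within_Icc_at)
      qed
      have "((\<lambda>x. (G (x + \<epsilon>) - G (x - \<epsilon>)) / (2 * \<epsilon>)) has_real_derivative u' t) (at t)"
      proof -
        have "((\<lambda>x. x + \<epsilon>) has_real_derivative 1) (at t)" "((\<lambda>x. x - \<epsilon>) has_real_derivative 1) (at t)"
          by (auto intro!: derivative_eq_intros)
        then have "((\<lambda>x. G (x + \<epsilon>)) has_real_derivative g (t + \<epsilon>) * 1) (at t)"
          "((\<lambda>x. G (x - \<epsilon>)) has_real_derivative g (t - \<epsilon>) * 1) (at t)"
          using \<epsilon> by (auto intro!: DERIV_chain2[OF G] simp: a_def b_def simp del: mult_1_right)
        then show ?thesis unfolding u'_def by (intro DERIV_cdivide DERIV_diff) auto
      qed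
      moreover have "eventually (\<lambda>x. x \<in> {t - 1<..<t + 1}) (nhds t)"
        by (intro eventually_nhds_in_open) auto
      then have "eventually (\<lambda>x. (G (x + \<epsilon>) - G (x - \<epsilon>)) / (2 * \<epsilon>) = u x) (nhds t)"
      proof eventually_elim
        case (elim x)
        have "integral {a..x - \<epsilon>} g + integral {x - \<epsilon>..x + \<epsilon>} g = integral {a..x + \<epsilon>} g"
          using elim \<epsilon> by (intro Henstock_Kurzweil_Integration.integral_combine gi) (auto simp: a_def)
        then show ?case by (simp add: G_def u_def)
      qed
      ultimately show ?thesis by (simp add: DERIV_cong_ev)
    qed
    have g_le: "g s \<le> \<delta> t" "g s \<ge> \<delta> t - 3 * \<epsilon>" if "s \<in> {t - \<epsilon>..t + \<epsilon>}" for s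
      using lip[of s t] nonneg[of t] that \<epsilon> by (auto simp: g_def)
    have const: "((\<lambda>_. c) has_integral 2 * \<epsilon> * c) {t - \<epsilon>..t + \<epsilon>}" for c :: real
      using has_integral_const_real[of c "t - \<epsilon>" "t + \<epsilon>"] \<epsilon> by simp
    have "integral {t - \<epsilon>..t + \<epsilon>} g \<le> 2 * \<epsilon> * \<delta> t"
      by (rule has_integral_le[OF integrable_integral[OF gi] const]) (use g_le in auto)
    then show "u t \<le> \<delta> t" using \<epsilon> by (simp add: u_def field_simps)
    have "2 * \<epsilon> * (\<delta> t - 3 * \<epsilon>) \<le> integral {t - \<epsilon>..t + \<epsilon>} g"
      by (rule has_integral_le[OF const integrable_integral[OF gi]]) (use g_le in auto)
    then show "\<delta> t - 3 * \<epsilon> \<le> u t" using \<epsilon> by (simp add: u_def field_simps)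
    show "0 \<le> u t"
      unfolding u_def using \<epsilon> by (intro divide_nonneg_pos integral_nonneg gi) (auto simp: g_def)
    show "\<delta> t > \<epsilon>" if "u t > 0"
    proof (rule ccontr)
      assume "\<not> \<delta> t > \<epsilon>"
      then have "g s = 0" if "s \<in> {t - \<epsilon>..t + \<epsilon>}" for s using lip[of s t] that by (auto simp: g_def)
      then have "integral {t - \<epsilon>..t + \<epsilon>} g = integral {t - \<epsilon>..t + \<epsilon>} (\<lambda>_. 0)"
        by (intro Henstock_Kurzweil_Integration.integral_cong) auto
      then show False using \<open>u t > 0\<close> by (simp add: u_def)
    qed
    show "\<bar>u' t\<bar> \<le> 1" using g_lip[of "t + \<epsilon>" "t - \<epsilon>"] \<epsilon> by (simp add: u'_def abs_divide)
    have "(g \<circ> (\<lambda>x. x + 1)) = g" by (auto simp: g_def per)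
    then have "integral {t + 1 - \<epsilon>..t + 1 + \<epsilon>} g = integral {t - \<epsilon>..t + \<epsilon>} g"
      using integral_shift_Icc_real[of "t - \<epsilon>" "t + \<epsilon>" g 1] by (simp add: algebra_simps o_def)
    then show "u (t + 1) = u t" by (simp add: u_def)
  next
    show "continuous_on UNIV u'"
      unfolding u'_def by (intro continuous_intros continuous_on_compose2[OF gc[of UNIV]]) (use \<epsilon> in auto)
  qed
qed

lemma sin_ge_half:
  fixes x :: real
  assumes "0 \<le> x" "x \<le> 1"
  shows "x / 2 \<le> sin x"
proof -
  have "(\<lambda>y. sin y - y / 2) 0 \<le> (\<lambda>y. sin y - y / 2) x"
  proof (rule DERIV_nonneg_imp_nondecreasing[OF assms(1)])
    fix y :: real assume y: "0 \<le> y" "y \<le> x"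
    have "cos (pi / 3) \<le> cos y" using y assms pi_gt3 by (intro cos_monotone_0_pi_le) auto
    then show "\<exists>D. ((\<lambda>y. sin y - y / 2) has_real_derivative D) (at y) \<and> 0 \<le> D"
      by (intro exI[of _ "cos y - 1 / 2"]) (auto intro!: derivative_eq_intros simp: cos_60)
  qed
  then show ?thesis by simp
qed

text \<open>Squaring the positive part is a cut-off that stays C^1 through 0; both the bumps and the
  height of the outer contour are made this way.\<close>

lemma has_real_derivative_pos_part_sq:
  fixes x :: real
  shows "((\<lambda>x. (max 0 x)\<^sup>2) has_real_derivative 2 * max 0 x) (at x)"
proof -
  consider "x > 0" | "x < 0" | "x = 0" by linarith
  then show ?thesis
  proof cases
    case 1
    have "eventually (\<lambda>y. y \<in> {0<..}) (nhds x)" using 1 by (intro eventually_nhds_in_open) auto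
    then have "eventually (\<lambda>y. (max 0 y)\<^sup>2 = y\<^sup>2) (nhds x)" by eventually_elim auto
    moreover have "((\<lambda>y. y\<^sup>2) has_real_derivative 2 * x) (at x)" by (auto intro!: derivative_eq_intros)
    ultimately show ?thesis using 1 by (subst DERIV_cong_ev[OF refl _ refl]) auto
  next
    case 2
    have "eventually (\<lambda>y. y \<in> {..<0}) (nhds x)" using 2 by (intro eventually_nhds_in_open) auto
    then have "eventually (\<lambda>y. (max 0 y)\<^sup>2 = 0) (nhds x)" by eventually_elim auto
    then show ?thesis using 2 by (subst DERIV_cong_ev[OF refl _ refl, where g = "\<lambda>_. 0"]) auto
  next
    case 3
    have "((\<lambda>h. ((max 0 (x + h))\<^sup>2 - (max 0 x)\<^sup>2) / h) \<longlongrightarrow> 0) (at 0)"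
    proof (rule tendsto_rabs_zero_cancel, rule tendsto_sandwich[of "\<lambda>_. 0" _ _ "\<lambda>h. \<bar>h\<bar>"])
      show "eventually (\<lambda>h. \<bar>((max 0 (x + h))\<^sup>2 - (max 0 x)\<^sup>2) / h\<bar> \<le> \<bar>h\<bar>) (at 0)"
        using 3 by (intro always_eventually allI) (auto simp: max_def power2_eq_square abs_divide abs_mult)
      show "((\<lambda>h. \<bar>h\<bar>) \<longlongrightarrow> (0::real)) (at 0)" by (intro tendsto_eq_intros) auto
    qed auto
    then show ?thesis using 3 by (simp add: DERIV_def)
  qed
qed

text \<open>The square of sin(\<pi> m t) depends only on the distance of m t to the nearest integer
  and increases with it. One expression therefore serves all numerators n and is periodic. The
  squared positive part makes it C^1 with a derivative that vanishes wherever G does. The steepness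
  is paid for in B, through the difference of the two squared sines.\<close>

lemma rational_bump:
  fixes r R :: real and m :: nat
  assumes m: "m \<ge> 1" and r: "0 < r" "r < R" "R \<le> 1 / 2"
  defines "B \<equiv> 4 * pi * real m / ((sin (pi * R))\<^sup>2 - (sin (pi * r))\<^sup>2)\<^sup>2"
  obtains G G' where "\<And>t. (G has_real_derivative G' t) (at t)" "continuous_on UNIV G'"
    "\<And>t. G (t + 1) = G t" "\<And>t. 0 \<le> G t"
    "\<And>t n. \<bar>real m * t - of_int n\<bar> \<le> r \<Longrightarrow> 1 \<le> G t"
    "\<And>t. G t > 0 \<Longrightarrow> \<exists>n. \<bar>real m * t - of_int n\<bar> < R" "\<And>t. G t = 0 \<Longrightarrow> G' t = 0"
    "\<And>t. G t \<le> B" "\<And>t. \<bar>G' t\<bar> \<le> B"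
proof -
  define S s where "S = (sin (pi * R))\<^sup>2" and "s = (sin (pi * r))\<^sup>2"
  have half: "0 \<le> pi * a" "- (pi / 2) \<le> pi * a" "pi * a \<le> pi / 2" "pi * a \<le> pi" if "0 \<le> a" "a \<le> 1 / 2" for a
  proof -
    have "pi * a \<le> pi * (1 / 2)" using that by (intro mult_left_mono) auto
    moreover have "0 \<le> pi * a" using that by simp
    ultimately show "0 \<le> pi * a" "- (pi / 2) \<le> pi * a" "pi * a \<le> pi / 2" "pi * a \<le> pi"
      using pi_gt_zero by linarith+
  qed
  have mono: "(sin (pi * a))\<^sup>2 \<le> (sin (pi * b))\<^sup>2" if "0 \<le> a" "a \<le> b" "b \<le> 1 / 2" for a b :: real
    using that half[of a] half[of b] by (intro power_mono sin_monotone_2pi_le sin_ge_zero) auto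
  have "sin (pi * r) < sin (pi * R)"
    using r half[of r] half[of R] by (intro sin_monotone_2pi) auto
  then have sS: "s < S"
    unfolding s_def S_def using r half[of r] by (intro power_strict_mono sin_ge_zero) auto
  have S1: "S \<le> 1" by (simp add: S_def abs_square_le_1)
  have s0: "s \<ge> 0" by (simp add: s_def)
  have D: "0 < (S - s)\<^sup>2" using sS by simp
  define v where "v t = S - (sin (pi * real m * t))\<^sup>2" for t
  define G where "G t = (max 0 (v t))\<^sup>2 / (S - s)\<^sup>2" for t
  define G' where "G' t = 2 * max 0 (v t) * (- (2 * sin (pi * real m * t) * (cos (pi * real m * t) * (pi * real m)))) / (S - s)\<^sup>2" for t
  have sin_shift: "(sin (pi * real m * t))\<^sup>2 = (sin (pi * (real m * t - of_int n)))\<^sup>2" for t and n :: int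
  proof -
    have "pi * (real m * t - of_int n) = pi * real m * t - pi * of_int n" by (simp add: algebra_simps)
    then show ?thesis by (simp only: sin_diff) (simp add: sin_npi_int cos_npi_int)
  qed
  have sin_abs: "(sin (pi * \<bar>x\<bar>))\<^sup>2 = (sin (pi * x))\<^sup>2" for x by (cases "x \<ge> 0") auto
  have v_le: "max 0 (v t) \<le> 1" for t
    using S1 zero_le_power2[of "sin (pi * real m * t)"] unfolding v_def by linarith
  have B_eq: "B = 4 * pi * real m / (S - s)\<^sup>2" by (simp add: B_def S_def s_def)
  show ?thesis
  proof (rule that[of G G'])
    fix t :: real
    have vd: "(v has_real_derivative - (2 * sin (pi * real m * t) * (cos (pi * real m * t) * (pi * real m)))) (at t)"
      unfolding v_def by (auto intro!: derivative_eq_intros)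
    show "(G has_real_derivative G' t) (at t)"
      unfolding G_def G'_def
      by (intro DERIV_cdivide DERIV_chain2[OF has_real_derivative_pos_part_sq vd])
    show "G (t + 1) = G t"
      using sin_shift[of "t + 1" "int m"] sin_shift[of t 0] by (simp add: G_def v_def algebra_simps)
    show "0 \<le> G t" by (simp add: G_def)
    show "1 \<le> G t" if "\<bar>real m * t - of_int n\<bar> \<le> r" for n
    proof -
      have "(sin (pi * real m * t))\<^sup>2 = (sin (pi * \<bar>real m * t - of_int n\<bar>))\<^sup>2"
        unfolding sin_shift[of t n] sin_abs ..
      also have "\<dots> \<le> s" unfolding s_def using that r by (intro mono) auto
      finally have "S - s \<le> max 0 (v t)" by (simp add: v_def)
      then have "(S - s)\<^sup>2 \<le> (max 0 (v t))\<^sup>2" using sS by (intro power_mono) auto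
      then show ?thesis using D by (simp add: G_def)
    qed
    show "\<exists>n. \<bar>real m * t - of_int n\<bar> < R" if "G t > 0"
    proof (rule ccontr)
      assume "\<not> (\<exists>n. \<bar>real m * t - of_int n\<bar> < R)"
      then have ge: "R \<le> \<bar>real m * t - of_int (round (real m * t))\<bar>" by (auto simp: not_less)
      have le: "\<bar>real m * t - of_int (round (real m * t))\<bar> \<le> 1 / 2"
        using of_int_round_abs_le[of "real m * t"] by (simp add: abs_minus_commute)
      have "S \<le> (sin (pi * \<bar>real m * t - of_int (round (real m * t))\<bar>))\<^sup>2"
        unfolding S_def using ge le r by (intro mono) auto
      also have "\<dots> = (sin (pi * real m * t))\<^sup>2"
        unfolding sin_shift[of t "round (real m * t)"] sin_abs ..
      finally show False using that by (simp add: G_def v_def)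
    qed
    show "G' t = 0" if "G t = 0" using that D by (auto simp: G_def G'_def)
    have "(max 0 (v t))\<^sup>2 \<le> 1\<^sup>2" using v_le[of t] by (intro power_mono) auto
    also have "\<dots> \<le> 4 * pi * real m"
    proof -
      have "1 * 1 \<le> (4 * pi) * real m" using m pi_gt3 by (intro mult_mono) auto
      then show ?thesis by simp
    qed
    finally show "G t \<le> B" unfolding G_def B_eq using D by (intro divide_right_mono) auto
    have "\<bar>2 * max 0 (v t) * (- (2 * sin (pi * real m * t) * (cos (pi * real m * t) * (pi * real m))))\<bar> =
      2 * max 0 (v t) * (2 * \<bar>sin (pi * real m * t)\<bar> * (\<bar>cos (pi * real m * t)\<bar> * (pi * real m)))"
      by (simp add: abs_mult)
    also have "\<dots> \<le> 2 * 1 * (2 * 1 * (1 * (pi * real m)))"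
      using v_le[of t] by (intro mult_mono) auto
    finally show "\<bar>G' t\<bar> \<le> B" unfolding G'_def B_eq abs_divide using D by (auto intro!: divide_right_mono)
  next
    show "continuous_on UNIV G'" unfolding G'_def v_def using D by (intro continuous_intros) auto
  qed
qed

text \<open>The i-th term belongs to the denominator i + 1; hence the sum starts effectively at the
  index m - 1 and the power of q at m.\<close>

lemma geometric_tail_bound:
  fixes f :: "nat \<Rightarrow> real"
  assumes b: "\<And>i. \<bar>f i\<bar> \<le> \<theta> * q ^ Suc i" and q: "0 \<le> q" "q < 1" and z: "\<And>i. Suc i < m \<Longrightarrow> f i = 0" and m: "m \<ge> 1"
  shows "\<bar>\<Sum>i. f i\<bar> \<le> \<theta> * q ^ m * (1 / (1 - q))"
proof -
  have s: "summable (\<lambda>i. \<theta> * q ^ Suc i)" using q by (auto intro!: summable_mult summable_geometric)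
  have fs: "summable f" using b by (intro summable_comparison_test'[OF s]) auto
  have "(\<Sum>i. f i) = (\<Sum>i. f (i + (m - 1))) + (\<Sum>i<m - 1. f i)"
    by (rule suminf_split_initial_segment[OF fs])
  also have "(\<Sum>i<m - 1. f i) = 0" using z by (intro sum.neutral) auto
  finally have e: "(\<Sum>i. f i) = (\<Sum>i. f (i + (m - 1)))" by simp
  have g: "(\<lambda>i. \<theta> * q ^ m * q ^ i) sums (\<theta> * q ^ m * (1 / (1 - q)))"
    by (rule sums_mult[OF geometric_sums]) (use q in simp)
  have le: "\<bar>f (i + (m - 1))\<bar> \<le> \<theta> * q ^ m * q ^ i" for i
    using b[of "i + (m - 1)"] m by (simp add: power_add algebra_simps flip: power_Suc)
  have "norm (\<Sum>i. f (i + (m - 1))) \<le> (\<Sum>i. \<theta> * q ^ m * q ^ i)"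
    using le by (intro norm_suminf_le[OF _ sums_summable[OF g]]) auto
  then show ?thesis using e g by (simp add: sums_iff)
qed

lemma C_set_add_1: "x + 1 \<in> C_set \<psi> \<longleftrightarrow> x \<in> C_set \<psi>"
proof -
  have "cf_quot (x + 1) = cf_quot x" using cf_quot_add_int[of 1 x] by (intro ext) (simp add: add.commute)
  then have "cf_denom (x + 1) k = cf_denom x k" for k by (simp add: cf_denom_def convergent_cf_def)
  moreover have "x + 1 \<in> \<rat> \<longleftrightarrow> x \<in> \<rat>" using Rats_add[of x 1] Rats_diff[of "x + 1" 1] by auto
  ultimately show ?thesis by (simp add: C_set_def)
qed

section \<open>Assembly of the majorant\<close>

context exp_approximation
begin

context
  fixes A :: "(nat \<Rightarrow>\<^sub>C real) set"
  assumes tb: "totally_bounded A" and sub: "A \<subseteq> c0" and norm_le: "\<forall>s\<in>A. norm s \<le> \<alpha>"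
begin

text \<open>Three demands compete: u must reach \<kappa> times the distance to some point of
  \<open>C_set \<psi>\<close>, where positive it must stay below \<kappa> |t - y| for y in
  \<open>W_set\<close>, and it must be flat. The constants are chosen in the order
  \<open>ms\<close>, \<theta>, \<open>R\<close>, \<open>a\<close>, \<open>m0\<close>, \<epsilon>,
  each from earlier ones. To avoid a circle, \<open>ms\<close> is chosen with \<Theta> in place of
  \<theta> * \<Theta>, which \<theta> \<le> 1 permits.\<close>

lemma flat_majorant:
  fixes \<kappa> :: real
  assumes \<kappa>: "0 < \<kappa>" "\<kappa> < 1"
  obtains u u' where "\<And>t. (u has_real_derivative u' t) (at t)" "continuous_on UNIV u'"
    "\<And>t. u (t + 1) = u t" "\<And>t. 0 \<le> u t"
    "\<And>t. \<exists>x\<in>C_set \<psi>. \<kappa> * \<bar>t - x\<bar> \<le> u t"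
    "\<And>N. \<exists>M. \<forall>y\<in>W_set A (8 * \<gamma>). \<forall>t. u t > 0 \<longrightarrow>
       0 < \<kappa> * \<bar>t - y\<bar> - u t \<and> u t + \<bar>u' t\<bar> \<le> M * (\<kappa> * \<bar>t - y\<bar> - u t) ^ N"
proof -
  define W where "W = W_set A (8 * \<gamma>)"
  note W_dist = W_set_dist_ge[OF tb sub norm_le, folded W_def]
  \<comment> \<open>All rates become multiples of \<beta>. The ladder is 1/2 for the distance to
    \<open>W\<close>, 1 for the width of the bumps, 8 for the terms of the series, 12 = 8 + 4 for
    the lower bound of their coefficients and 32 for the gaps; the space between the rungs absorbs
    constants.\<close>
  define \<beta> where "\<beta> = \<alpha> / 32"
  have \<beta>: "\<beta> > 0" using \<alpha>_pos by (simp add: \<beta>_def)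
  define E where "E j m = exp (- (j * \<beta>) * real m)" for j and m :: nat
  have E_pos: "E j m > 0" for j m by (simp add: E_def)
  have E_mono: "E j m \<le> E i m" if "i \<le> j" for i j m
    using that \<beta> by (simp add: E_def mult_right_mono)
  have E_le1: "E j m \<le> 1" if "j \<ge> 0" for j m using that \<beta> by (simp add: E_def)
  have E_add: "E i m * E j m = E (i + j) m" for i j m by (simp add: E_def algebra_simps flip: exp_add)
  have dom: "\<exists>N::nat. \<forall>m\<ge>N. C * E a m \<le> D * E b m" if "b < a" "D > 0" for a b C D
  proof -
    have "b * \<beta> < a * \<beta>" using that \<beta> by simp
    then show ?thesis unfolding E_def using exp_eventually_dominates[of "b * \<beta>" "a * \<beta>" D C] that by metis
  qed
  have \<psi>E: "\<psi> m = \<gamma> * E 32 m" if "m \<ge> 1" for m using \<psi>_eq that by (simp add: E_def \<beta>_def)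
  have \<psi>_le_E: "\<psi> m \<le> E 32 m" if "m \<ge> 1" for m
    using \<psi>E[OF that] \<gamma> E_pos[of 32 m] by (simp add: mult_le_cancel_right1)
  have \<rho>_le_E: "\<rho> m \<le> E 32 m" if m: "m \<ge> 1" for m
  proof -
    have "\<rho> m \<le> \<psi> m / 1" unfolding \<rho>_def using m \<psi>_pos[OF m] by (intro divide_left_mono) auto
    then show ?thesis using \<psi>_le_E[OF m] by simp
  qed
  define \<delta> where "\<delta> t = infdist t (C_set \<psi>)" for t :: real
  have \<delta>0: "\<delta> t \<ge> 0" for t by (simp add: \<delta>_def infdist_nonneg)
  have \<delta>_le: "\<delta> t \<le> \<bar>t - x\<bar>" if "x \<in> C_set \<psi>" for t x using infdist_le[OF that, of t] by (simp add: \<delta>_def dist_real_def)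
  have \<delta>_less: "\<exists>x\<in>C_set \<psi>. \<bar>t - x\<bar> < e" if "\<delta> t < e" for t e
  proof (rule ccontr)
    assume "\<not> (\<exists>x\<in>C_set \<psi>. \<bar>t - x\<bar> < e)"
    then have "e \<le> \<delta> t" unfolding \<delta>_def infdist_notempty[OF C_set_nonempty]
      using C_set_nonempty by (intro cINF_greatest) (auto simp: dist_real_def not_less)
    then show False using that by simp
  qed
  have \<delta>_per: "\<delta> (t + 1) = \<delta> t" for t
  proof -
    have "\<exists>a\<in>C_set \<psi>. x = a + 1" if "x \<in> C_set \<psi>" for x
      using that C_set_add_1[of "x - 1" \<psi>] by (intro bexI[of _ "x - 1"]) auto
    then have C: "C_set \<psi> = (\<lambda>a. a + 1) ` C_set \<psi>" using C_set_add_1[of _ \<psi>] by blast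
    have "\<delta> (t + 1) = (INF a\<in>(\<lambda>a. a + 1) ` C_set \<psi>. dist (t + 1) a)"
      unfolding \<delta>_def infdist_notempty[OF C_set_nonempty] by (subst C) (rule refl)
    also have "\<dots> = \<delta> t" by (simp add: image_image dist_real_def \<delta>_def infdist_notempty[OF C_set_nonempty])
    finally show ?thesis .
  qed
  have \<delta>_lip: "\<bar>\<delta> s - \<delta> t\<bar> \<le> \<bar>s - t\<bar>" for s t
    using infdist_triangle_abs[of s "C_set \<psi>" t] by (simp add: \<delta>_def dist_real_def)

  obtain c0 where c0: "c0 > 0" "\<And>y m n. y \<in> W \<Longrightarrow> m \<ge> 1 \<Longrightarrow> \<bar>y - of_int n / real m\<bar> \<ge> c0 * E (1 / 2) m"
    using W_set_dist_ge_exp[OF tb sub norm_le, of "1 / 2 * \<beta>"] \<beta> unfolding W_def E_def by auto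
  define q where "q = exp (- (8 * \<beta>))"
  have q: "0 \<le> q" "q < 1" using \<beta> by (auto simp: q_def)
  have Eq: "E 8 m = q ^ m" for m by (simp add: E_def q_def mult.commute flip: exp_of_nat_mult)
  define \<Theta> where "\<Theta> = 1 / (1 - q)"
  have \<Theta>: "\<Theta> > 0" using q by (simp add: \<Theta>_def)
  \<comment> \<open>The three summands stand for \<kappa> times the radius of a bump, \<kappa> times
    the distance to \<open>C_set \<psi>\<close>, and the tail of the series. Together they stay
    below half of \<kappa> times the distance from n/m to \<open>W\<close>.\<close>
  obtain N1 where N1: "\<And>m. m \<ge> N1 \<Longrightarrow> (\<kappa> * (3 / 2) + 9 / 4 * \<kappa> + \<Theta>) * E 1 m \<le> \<kappa> * c0 / 2 * E (1 / 2) m"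
    using dom[of "1 / 2" 1 "\<kappa> * c0 / 2" "\<kappa> * (3 / 2) + 9 / 4 * \<kappa> + \<Theta>"] \<kappa> c0(1) by auto
  define ms where "ms = max 1 N1"
  have ms: "ms \<ge> 1" "ms \<ge> N1" by (auto simp: ms_def)
  \<comment> \<open>Keeps the whole series below \<open>\<kappa> * \<rho> ms / 8\<close>, half of
    the margin found in \<open>small\<close>.\<close>
  define \<theta> where "\<theta> = min 1 (\<kappa> * \<rho> ms / (8 * \<Theta>))"
  have \<theta>: "\<theta> > 0" "\<theta> \<le> 1" using \<kappa> \<Theta> \<rho>_pos[OF ms(1)] by (auto simp: \<theta>_def)
  have "\<theta> \<le> \<kappa> * \<rho> ms / (8 * \<Theta>)" by (simp add: \<theta>_def)
  then have \<theta>\<Theta>: "\<theta> * \<Theta> \<le> \<kappa> * \<rho> ms / 8" using \<Theta> by (simp add: field_simps)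
  \<comment> \<open>Below \<open>ms\<close> the support has to stay within 3/2
    \<open>\<rho> m\<close> of n/m. From \<open>ms\<close> on it is widened to rate 1: with a width
    comparable to the gap, the coefficient that brings the derivative down to rate 8 would be far
    smaller than \<open>\<rho> m\<close>.\<close>
  define R where "R m = (if m < ms then 3 / 2 * \<psi> m else max (3 / 2 * \<psi> m) (E 1 m / 8))" for m
  have R1: "5 / 4 * \<psi> m < R m" "R m \<le> 1 / 2" if "m \<ge> 1" for m
    using \<psi>_pos[OF that] \<psi>_less[OF that] E_le1[of 1 m] by (auto simp: R_def)
  have R2: "R m \<le> 3 / 2 * E 1 m" if "m \<ge> 1" for m
    using \<psi>_le_E[OF that] E_mono[of 1 32 m] E_pos[of 1 m] by (auto simp: R_def)
  define B where "B m = 4 * pi * real m / ((sin (pi * R m))\<^sup>2 - (sin (pi * (5 / 4 * \<psi> m)))\<^sup>2)\<^sup>2" for m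
  define P where "P m G G' \<longleftrightarrow> (\<forall>t. (G has_real_derivative G' t) (at t)) \<and> continuous_on UNIV G' \<and>
    (\<forall>t. G (t + 1) = G t) \<and> (\<forall>t. 0 \<le> G t) \<and> (\<forall>t n. \<bar>real m * t - of_int n\<bar> \<le> 5 / 4 * \<psi> m \<longrightarrow> 1 \<le> G t) \<and>
    (\<forall>t. G t > 0 \<longrightarrow> (\<exists>n. \<bar>real m * t - of_int n\<bar> < R m)) \<and> (\<forall>t. G t = 0 \<longrightarrow> G' t = 0) \<and>
    (\<forall>t. G t \<le> B m) \<and> (\<forall>t. \<bar>G' t\<bar> \<le> B m)" for m :: nat and G G' :: "real \<Rightarrow> real"
  have "\<exists>G G'. P m G G'" if m: "m \<ge> 1" for m
  proof -
    have "0 < 5 / 4 * \<psi> m" using \<psi>_pos[OF m] by simp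
    then show ?thesis
      unfolding P_def B_def by (rule rational_bump[OF m _ R1[OF m]]) blast
  qed
  then obtain G G' where P: "\<And>m. m \<ge> 1 \<Longrightarrow> P m (G m) (G' m)" by metis
  note G = P[unfolded P_def, THEN conjunct1, rule_format]
    P[unfolded P_def, THEN conjunct2, THEN conjunct1]
    P[unfolded P_def, THEN conjunct2, THEN conjunct2, THEN conjunct1, rule_format]
    P[unfolded P_def, THEN conjunct2, THEN conjunct2, THEN conjunct2, THEN conjunct1, rule_format]
  have G_core: "1 \<le> G m t" if "m \<ge> 1" "\<bar>t - of_int n / real m\<bar> \<le> 5 / 4 * \<rho> m" for m t n
  proof -
    have "\<bar>real m * t - of_int n\<bar> = real m * \<bar>t - of_int n / real m\<bar>" using that(1) by (simp add: field_simps flip: abs_mult)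
    also have "\<dots> \<le> real m * (5 / 4 * \<rho> m)" using that by (intro mult_left_mono) auto
    also have "\<dots> = 5 / 4 * \<psi> m" using that(1) by (simp add: \<rho>_def)
    finally show ?thesis using P[OF that(1)] unfolding P_def by blast
  qed
  have G_supp: "\<exists>n. \<bar>t - of_int n / real m\<bar> < R m / real m" if m: "m \<ge> 1" and "G m t > 0" for m t
  proof -
    obtain n where n: "\<bar>real m * t - of_int n\<bar> < R m" using P[OF m] \<open>G m t > 0\<close> unfolding P_def by blast
    have "\<bar>real m * t - of_int n\<bar> = real m * \<bar>t - of_int n / real m\<bar>" using m by (simp add: field_simps flip: abs_mult)
    then show ?thesis using n m by (intro exI[of _ n]) (simp add: field_simps)
  qed
  have G_zero: "G' m t = 0" if "m \<ge> 1" "G m t = 0" for m t using P[OF that(1)] that(2) unfolding P_def by blast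
  have G_le: "G m t \<le> B m" "\<bar>G' m t\<bar> \<le> B m" if "m \<ge> 1" for m t using P[OF that] unfolding P_def by blast+
  have B_pos: "B m > 0" if m: "m \<ge> 1" for m
    using G_core[OF m, of 0 0] \<rho>_pos[OF m] G_le(1)[OF m, of 0] by simp
  \<comment> \<open>Normalized by \<open>B m\<close> so that the m-th term and its derivative are
    both at most \<open>\<theta> * E 8 m\<close>.\<close>
  define a where "a m = \<theta> * E 8 m / B m" for m
  have a_pos: "a m > 0" if "m \<ge> 1" for m using B_pos[OF that] \<theta> E_pos by (simp add: a_def)
  have aG: "\<bar>a m * G m t\<bar> \<le> \<theta> * q ^ m" "\<bar>a m * G' m t\<bar> \<le> \<theta> * q ^ m" if m: "m \<ge> 1" for m t
  proof -
    have "\<bar>a m * x\<bar> \<le> \<theta> * q ^ m" if "\<bar>x\<bar> \<le> B m" for x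
    proof -
      have "\<bar>a m * x\<bar> = a m * \<bar>x\<bar>" using a_pos[OF m] by (simp add: abs_mult)
      also have "\<dots> \<le> a m * B m" using a_pos[OF m] that by (intro mult_left_mono) auto
      also have "\<dots> = \<theta> * q ^ m" using B_pos[OF m] by (simp add: a_def Eq)
      finally show ?thesis .
    qed
    then show "\<bar>a m * G m t\<bar> \<le> \<theta> * q ^ m" "\<bar>a m * G' m t\<bar> \<le> \<theta> * q ^ m"
      using G_le[OF m, of t] G(4)[OF m, of t] by auto
  qed

  obtain N2 where N2: "\<And>m. m \<ge> N2 \<Longrightarrow> 3 / 2 * E 32 m \<le> 1 / 8 * E 1 m" using dom[of 1 32 "1 / 8" "3 / 2"] by auto
  obtain N3 where N3: "\<And>m. m \<ge> N3 \<Longrightarrow> 25 * E 64 m \<le> 1 / 64 * E 2 m" using dom[of 2 64 "1 / 64" 25] by auto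
  obtain N4 where N4: "\<And>m. m \<ge> N4 \<Longrightarrow> 9 / 4 * \<kappa> * E 32 m \<le> \<theta> / (16384 * pi) * E 12 m"
    using dom[of 12 32 "\<theta> / (16384 * pi)" "9 / 4 * \<kappa>"] \<theta> by auto
  define m0 where "m0 = max (max ms N2) (max N3 N4)"
  \<comment> \<open>The squared difference in the denominator of \<open>B m\<close> is at least a
    multiple of \<open>E 4 m\<close>, hence \<open>a m * real m\<close> at least a multiple of
    \<open>E 12 m\<close>, which dominates \<psi>. So for large m a single bump already exceeds
    \<kappa> times the distance to \<open>C_set \<psi>\<close>.\<close>
  have a_ge: "9 / 4 * \<kappa> * \<rho> m \<le> a m" if m: "m \<ge> m0" for m
  proof -
    have mm: "m \<ge> 1" "m \<ge> ms" "m \<ge> N2" "m \<ge> N3" "m \<ge> N4" using m ms by (auto simp: m0_def)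
    have "3 / 2 * \<psi> m \<le> E 1 m / 8" using N2[OF mm(3)] \<psi>_le_E[OF mm(1)] by simp
    then have R: "R m = E 1 m / 8" using mm by (simp add: R_def)
    have "pi * E 1 m \<le> 4 * 1" using E_le1[of 1 m] E_pos[of 1 m] pi_less_4 by (intro mult_mono) auto
    then have x01: "0 \<le> pi * R m" "pi * R m \<le> 1" using E_pos[of 1 m] by (auto simp: R)
    have "sin (pi * (5 / 4 * \<psi> m)) \<le> pi * (5 / 4 * \<psi> m)" using \<psi>_pos[OF mm(1)] by (intro sin_x_le_x) auto
    also have "\<dots> \<le> 4 * (5 / 4 * E 32 m)"
      using \<psi>_pos[OF mm(1)] \<psi>_le_E[OF mm(1)] pi_less_4 by (intro mult_mono) auto
    finally have "sin (pi * (5 / 4 * \<psi> m)) \<le> 5 * E 32 m" by simp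
    moreover have "0 \<le> sin (pi * (5 / 4 * \<psi> m))"
      using \<psi>_pos[OF mm(1)] \<psi>_less[OF mm(1)] by (intro sin_ge_zero) auto
    ultimately have "(sin (pi * (5 / 4 * \<psi> m)))\<^sup>2 \<le> (5 * E 32 m)\<^sup>2" by (intro power_mono) auto
    then have s: "(sin (pi * (5 / 4 * \<psi> m)))\<^sup>2 \<le> 25 * E 64 m" using E_add[of 32 m 32] by (simp add: power2_eq_square)
    define X where "X = (sin (pi * R m))\<^sup>2 - (sin (pi * (5 / 4 * \<psi> m)))\<^sup>2"
    have S: "E 2 m / 32 \<le> (sin (pi * R m))\<^sup>2"
    proof -
      have "pi * R m / 2 \<ge> 3 / 16 * E 1 m" using pi_gt3 E_pos[of 1 m] by (simp add: R)
      then have "3 / 16 * E 1 m \<le> sin (pi * R m)" using sin_ge_half[OF x01] by linarith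
      then have "(3 / 16 * E 1 m)\<^sup>2 \<le> (sin (pi * R m))\<^sup>2" using E_pos[of 1 m] by (intro power_mono) auto
      then have "9 / 256 * E 2 m \<le> (sin (pi * R m))\<^sup>2" using E_add[of 1 m 1] by (simp add: power2_eq_square)
      then show ?thesis using E_pos[of 2 m] by linarith
    qed
    have X: "E 2 m / 64 \<le> X" using S s N3[OF mm(4)] by (simp add: X_def)
    have "(E 2 m / 64)\<^sup>2 \<le> X\<^sup>2" using X E_pos[of 2 m] by (intro power_mono) auto
    then have X2: "E 4 m / 4096 \<le> X\<^sup>2" using E_add[of 2 m 2] by (simp add: power2_eq_square)
    have "9 / 4 * \<kappa> * \<psi> m \<le> 9 / 4 * \<kappa> * E 32 m" using \<psi>_le_E[OF mm(1)] \<kappa> by (intro mult_left_mono) auto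
    also have "\<dots> \<le> \<theta> / (16384 * pi) * E 12 m" by (rule N4[OF mm(5)])
    also have "\<dots> = \<theta> * E 8 m * (E 4 m / 4096) / (4 * pi)" using E_add[of 8 m 4] by (simp add: field_simps)
    also have "\<dots> \<le> \<theta> * E 8 m * X\<^sup>2 / (4 * pi)" using X2 \<theta> E_pos[of 8 m] by (intro divide_right_mono mult_left_mono) auto
    also have "\<dots> = a m * real m" unfolding a_def B_def X_def[symmetric] using mm(1) by simp
    finally show ?thesis using mm(1) by (simp add: \<rho>_def field_simps)
  qed
  \<comment> \<open>For the finitely many m \<le> \<open>m0\<close> the bump may be too low on its
    own. There \<open>u1\<close> misses \<delta> by at most 3 \<epsilon> and a bump of height at
    least 4 \<kappa> \<epsilon> repairs this; the spare \<epsilon> provides an actual point of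
    \<open>C_set \<psi>\<close> in place of the infimum.\<close>
  define \<epsilon> where "\<epsilon> = Min (insert 1 (a ` {1..m0})) / (4 * \<kappa>)"
  have \<epsilon>: "\<epsilon> > 0" using a_pos \<kappa> by (auto simp: \<epsilon>_def intro!: divide_pos_pos)
  have a_ge': "4 * \<kappa> * \<epsilon> \<le> a m" if "1 \<le> m" "m \<le> m0" for m
  proof -
    have "Min (insert 1 (a ` {1..m0})) \<le> a m" using that by (intro Min_le) auto
    then show ?thesis using \<kappa> by (simp add: \<epsilon>_def)
  qed
  obtain u1 u1' where u1: "\<And>t. (u1 has_real_derivative u1' t) (at t)" "continuous_on UNIV u1'"
    "\<And>t. u1 (t + 1) = u1 t" "\<And>t. 0 \<le> u1 t" "\<And>t. u1 t \<le> \<delta> t" "\<And>t. \<delta> t - 3 * \<epsilon> \<le> u1 t"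
    "\<And>t. u1 t > 0 \<Longrightarrow> \<delta> t > \<epsilon>" "\<And>t. \<bar>u1' t\<bar> \<le> 1"
    by (rule lipschitz_C1_minorant[OF \<delta>_lip \<delta>0 \<delta>_per \<epsilon>]) blast
  define f where "f i t = a (Suc i) * G (Suc i) t" for i t
  define f' where "f' i t = a (Suc i) * G' (Suc i) t" for i t
  have fb: "\<bar>f i t\<bar> \<le> \<theta> * q ^ Suc i" "\<bar>f' i t\<bar> \<le> \<theta> * q ^ Suc i" for i t
    using aG[of "Suc i" t] by (simp_all add: f_def f'_def)
  have f0: "f i t \<ge> 0" for i t using a_pos[of "Suc i"] G(4)[of "Suc i" t] by (simp add: f_def)
  have As: "summable (\<lambda>i. \<theta> * q ^ Suc i)" using q by (auto intro!: summable_mult summable_geometric)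
  have fd: "(f i has_real_derivative f' i t) (at t)" for i t
    unfolding f_def f'_def by (intro DERIV_cmult G(1)) auto
  have fc: "continuous_on UNIV (f' i)" for i
    unfolding f'_def by (intro continuous_intros G(2)) auto
  note ser = series_C1[of f f' "\<lambda>i. \<theta> * q ^ Suc i", OF fd fc fb As]
  define u where "u t = \<kappa> * u1 t + (\<Sum>i. f i t)" for t
  define u' where "u' t = \<kappa> * u1' t + (\<Sum>i. f' i t)" for t
  have tail: "(\<Sum>i. f i t) \<le> \<theta> * E 8 m * \<Theta>" "\<bar>\<Sum>i. f' i t\<bar> \<le> \<theta> * E 8 m * \<Theta>"
    if "m \<ge> 1" "\<And>j. 1 \<le> j \<Longrightarrow> j < m \<Longrightarrow> G j t = 0" for m t
  proof -
    have z: "f i t = 0" "f' i t = 0" if "Suc i < m" for i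
      using \<open>\<And>j. 1 \<le> j \<Longrightarrow> j < m \<Longrightarrow> G j t = 0\<close>[of "Suc i"] G_zero[of "Suc i" t] that by (auto simp: f_def f'_def)
    show "(\<Sum>i. f i t) \<le> \<theta> * E 8 m * \<Theta>" "\<bar>\<Sum>i. f' i t\<bar> \<le> \<theta> * E 8 m * \<Theta>"
      using geometric_tail_bound[of "\<lambda>i. f i t" \<theta> q m, OF fb(1) q z(1) that(1)]
        geometric_tail_bound[of "\<lambda>i. f' i t" \<theta> q m, OF fb(2) q z(2) that(1)]
      by (simp_all add: Eq \<Theta>_def)
  qed
  have sum_ge: "f i t \<le> (\<Sum>i. f i t)" for i t
    using sum_le_suminf[OF ser(3)[of t], of "{i}"] f0 by simp
  have \<delta>_C: "\<delta> t = 0" if "t \<in> C_set \<psi>" for t using that by (simp add: \<delta>_def)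
  have near: "\<exists>m n x. m \<ge> 1 \<and> x \<in> C_set \<psi> \<and> \<bar>t - of_int n / real m\<bar> \<le> 5 / 4 * \<rho> m \<and> \<bar>t - x\<bar> \<le> 9 / 4 * \<rho> m \<and> 1 \<le> G m t"
    if "t \<notin> C_set \<psi>" for t
    using C_set_near[OF that] G_core by metis
  have u0: "0 \<le> u t" for t
    unfolding u_def using \<kappa> u1(4)[of t] f0 by (intro add_nonneg_nonneg suminf_nonneg ser(3)) auto
  have u_le: "u t \<le> \<kappa> * \<delta> t + (\<Sum>i. f i t)" for t
    unfolding u_def using u1(5)[of t] \<kappa> by simp
  have U1: "\<exists>x\<in>C_set \<psi>. \<kappa> * \<bar>t - x\<bar> \<le> u t" for t
  proof (cases "t \<in> C_set \<psi>")
    case True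
    then show ?thesis using u0[of t] by (intro bexI[of _ t]) auto
  next
    case False
    then obtain m n x where m: "m \<ge> 1" and x: "x \<in> C_set \<psi>" "\<bar>t - x\<bar> \<le> 9 / 4 * \<rho> m" "1 \<le> G m t"
      using near by blast
    have "a m * 1 \<le> a m * G m t" using a_pos[OF m] x(3) by (intro mult_left_mono) auto
    also have "\<dots> \<le> (\<Sum>i. f i t)" using sum_ge[of "m - 1" t] m by (simp add: f_def)
    finally have am: "a m \<le> (\<Sum>i. f i t)" by simp
    show ?thesis
    proof (cases "m \<le> m0")
      case True
      have "\<kappa> * (\<delta> t - 3 * \<epsilon>) \<le> \<kappa> * u1 t" using u1(6)[of t] \<kappa> by (intro mult_left_mono) auto
      then have "\<kappa> * (\<delta> t + \<epsilon>) \<le> u t" using am a_ge'[OF m True] unfolding u_def by (simp add: algebra_simps)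
      moreover obtain x where "x \<in> C_set \<psi>" "\<bar>t - x\<bar> < \<delta> t + \<epsilon>" using \<delta>_less[of t "\<delta> t + \<epsilon>"] \<epsilon> by auto
      moreover from this have "\<kappa> * \<bar>t - x\<bar> \<le> \<kappa> * (\<delta> t + \<epsilon>)" using \<kappa> by (intro mult_left_mono) auto
      ultimately show ?thesis by (intro bexI[of _ x]) linarith+
    next
      case False
      have "\<kappa> * \<bar>t - x\<bar> \<le> \<kappa> * (9 / 4 * \<rho> m)" using x(2) \<kappa> by (intro mult_left_mono) auto
      also have "\<dots> \<le> a m" using a_ge[of m] False by simp
      also have "\<dots> \<le> u t" unfolding u_def using am u1(4)[of t] \<kappa> by (simp add: add_increasing)
      finally show ?thesis using x(1) by blast
    qed
  qed

  define C1 where "C1 = 9 / 4 * \<kappa> + 9 / 4 * \<kappa> / \<epsilon> + 2 * (\<theta> * \<Theta>)"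
  define h where "h = \<kappa> * \<rho> ms / 8"
  define C2 where "C2 = \<kappa> * (9 / 4 * \<rho> 1) + \<kappa> + 2 * (\<theta> * \<Theta>)"
  have h: "h > 0" using \<kappa> \<rho>_pos[OF ms(1)] by (simp add: h_def)
  have \<theta>\<Theta>0: "\<theta> * \<Theta> > 0" using \<theta> \<Theta> by simp
  have C1: "C1 > 0" using \<kappa> \<epsilon> \<theta>\<Theta>0 by (simp add: C1_def add_pos_pos)
  have C2: "C2 \<ge> 0" using \<kappa> \<rho>_pos[of 1] \<theta>\<Theta>0 by (simp add: C2_def)
  have bound: "u t + \<bar>u' t\<bar> \<le> C2" for t
  proof -
    have "\<delta> t \<le> 9 / 4 * \<rho> 1"
    proof (cases "t \<in> C_set \<psi>")
      case True then show ?thesis using \<delta>_C \<rho>_pos[of 1] by simp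
    next
      case False
      then obtain m n x where "m \<ge> 1" "x \<in> C_set \<psi>" "\<bar>t - x\<bar> \<le> 9 / 4 * \<rho> m" using near by blast
      then show ?thesis using \<delta>_le[of x t] \<rho>_mono[of 1 m] by linarith
    qed
    then have "\<kappa> * \<delta> t \<le> \<kappa> * (9 / 4 * \<rho> 1)" using \<kappa> by (intro mult_left_mono) auto
    moreover have "\<bar>\<kappa> * u1' t\<bar> \<le> \<kappa> * 1" using u1(8)[of t] \<kappa> by (simp add: abs_mult)
    moreover have "\<theta> * E 8 1 * \<Theta> \<le> \<theta> * 1 * \<Theta>" using \<theta> \<Theta> E_le1[of 8 1] by (intro mult_right_mono mult_left_mono) auto
    ultimately show ?thesis using tail[of 1 t] u_le[of t] unfolding u'_def C2_def by simp
  qed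
  \<comment> \<open>If the gap of t has a denominator m' \<le> \<open>ms\<close>, then 4 - 5/4
    exceeds 9/4 at the scale \<open>\<rho> m'\<close>. Otherwise the distance to
    \<open>C_set \<psi>\<close> is at most 9/4 \<open>\<rho> ms\<close>, below the 5/2
    \<open>\<rho> ms\<close> that m itself provides.\<close>
  have small: "h \<le> \<kappa> * \<bar>t - y\<bar> - u t" if y: "y \<in> W" and m: "m \<ge> 1" "m < ms" "G m t > 0" for t y m
  proof -
    obtain n where n: "\<bar>t - of_int n / real m\<bar> < R m / real m" using G_supp[OF m(1,3)] by blast
    have Rm: "R m / real m = 3 / 2 * \<rho> m" using m(2) by (simp add: R_def \<rho>_def)
    have mm: "\<rho> ms \<le> \<rho> m" using \<rho>_mono[of m ms] m by simp
    have far: "\<bar>t - y\<bar> \<ge> 5 / 2 * \<rho> ms" using W_dist[OF y m(1), of n] n Rm mm by linarith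
    have pms: "\<rho> ms > 0" by (rule \<rho>_pos[OF ms(1)])
    have "\<rho> ms / 4 \<le> \<bar>t - y\<bar> - \<delta> t"
    proof (cases "t \<in> C_set \<psi>")
      case True then show ?thesis using \<delta>_C far pms by simp
    next
      case False
      then obtain m' n' x where m': "m' \<ge> 1" and x: "x \<in> C_set \<psi>" "\<bar>t - of_int n' / real m'\<bar> \<le> 5 / 4 * \<rho> m'" "\<bar>t - x\<bar> \<le> 9 / 4 * \<rho> m'"
        using near by blast
      have d: "\<delta> t \<le> 9 / 4 * \<rho> m'" using \<delta>_le[OF x(1), of t] x(3) by linarith
      show ?thesis
      proof (cases "m' \<le> ms")
        case True
        then have "\<rho> ms \<le> \<rho> m'" using \<rho>_mono[OF m'] by simp
        then show ?thesis using W_dist[OF y m', of n'] x(2) d pms by linarith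
      next
        case False
        then have "\<rho> m' \<le> \<rho> ms" using \<rho>_mono[OF ms(1), of m'] by simp
        then show ?thesis using far d by linarith
      qed
    qed
    then have "\<kappa> * (\<rho> ms / 4) \<le> \<kappa> * (\<bar>t - y\<bar> - \<delta> t)" using \<kappa> by (intro mult_left_mono) auto
    moreover have "(\<Sum>i. f i t) \<le> \<theta> * \<Theta>"
    proof -
      have "\<theta> * E 8 1 * \<Theta> \<le> \<theta> * 1 * \<Theta>" using \<theta> \<Theta> E_le1[of 8 1] by (intro mult_right_mono mult_left_mono) auto
      then show ?thesis using tail(1)[of 1 t] by simp
    qed
    ultimately show ?thesis using u_le[of t] \<theta>\<Theta> unfolding h_def by (simp add: algebra_simps)
  qed
  \<comment> \<open>Since m is the least index whose bump is active at t, the gap of t has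
    denominator at least m, and the terms before m vanish with their derivatives. Thus m controls
    both the distance, through \<open>\<rho> m\<close>, and the series, through
    \<open>E 8 m\<close>.\<close>
  have large: "u t + \<bar>u' t\<bar> \<le> C1 * E 8 m \<and> (\<exists>n. \<kappa> / 2 * \<bar>y - of_int n / real m\<bar> \<le> \<kappa> * \<bar>t - y\<bar> - u t)"
    if y: "y \<in> W" and m: "m \<ge> ms" "G m t > 0" and least: "\<And>j. 1 \<le> j \<Longrightarrow> j < m \<Longrightarrow> G j t = 0" for t y m
  proof -
    have m1: "m \<ge> 1" using m(1) ms(1) by simp
    obtain n where n: "\<bar>t - of_int n / real m\<bar> < R m / real m" using G_supp[OF m1 m(2)] by blast
    have d: "\<delta> t \<le> 9 / 4 * \<rho> m"
    proof (cases "t \<in> C_set \<psi>")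
      case True then show ?thesis using \<delta>_C \<rho>_pos[OF m1] by simp
    next
      case False
      then obtain m' n' x where m': "m' \<ge> 1" and x: "x \<in> C_set \<psi>" "\<bar>t - x\<bar> \<le> 9 / 4 * \<rho> m'" "1 \<le> G m' t"
        using near by blast
      have "m \<le> m'" using least[OF m'] x(3) by (cases "m' < m") auto
      then show ?thesis using \<rho>_mono[OF m1] \<delta>_le[OF x(1), of t] x(2) by force
    qed
    have T: "\<theta> * E 8 m * \<Theta> \<le> \<Theta> * E 1 m"
    proof -
      have "\<theta> * E 8 m * \<Theta> \<le> 1 * E 1 m * \<Theta>" using \<theta> \<Theta> E_mono[of 1 8 m] E_pos[of 8 m] by (intro mult_right_mono mult_mono) auto
      then show ?thesis by (simp add: mult.commute)
    qed
    have \<kappa>d: "\<kappa> * \<delta> t \<le> \<kappa> * (9 / 4 * \<rho> m)" using d \<kappa> by (intro mult_left_mono) auto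
    have \<rho>1: "\<kappa> * (9 / 4 * \<rho> m) \<le> \<kappa> * (9 / 4 * E 1 m)"
      using \<rho>_le_E[OF m1] E_mono[of 1 32 m] \<kappa> by (intro mult_left_mono) auto
    have R3: "\<kappa> * (R m / real m) \<le> \<kappa> * (3 / 2 * E 1 m)"
    proof -
      have "R m / real m \<le> R m / 1" using R1(1)[OF m1] \<psi>_pos[OF m1] m1 by (intro divide_left_mono) auto
      then have "R m / real m \<le> 3 / 2 * E 1 m" using R2[OF m1] by linarith
      then show ?thesis using \<kappa> by (intro mult_left_mono) auto
    qed
    have "\<kappa> * (R m / real m) + u t \<le> \<kappa> * c0 / 2 * E (1 / 2) m"
      using R3 u_le[of t] \<kappa>d \<rho>1 tail(1)[OF m1 least] T N1[of m] m(1) ms(2) by (simp add: algebra_simps)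
    also have "\<dots> \<le> \<kappa> / 2 * \<bar>y - of_int n / real m\<bar>"
    proof -
      have "\<kappa> / 2 * (c0 * E (1 / 2) m) \<le> \<kappa> / 2 * \<bar>y - of_int n / real m\<bar>"
        using c0(2)[OF y m1, of n] \<kappa> by (intro mult_left_mono) auto
      then show ?thesis by simp
    qed
    finally have 1: "\<kappa> * (R m / real m) + u t \<le> \<kappa> / 2 * \<bar>y - of_int n / real m\<bar>" .
    have "\<bar>y - of_int n / real m\<bar> \<le> \<bar>t - y\<bar> + R m / real m" using n by linarith
    then have "\<kappa> * \<bar>y - of_int n / real m\<bar> \<le> \<kappa> * (\<bar>t - y\<bar> + R m / real m)" using \<kappa> by (intro mult_left_mono) auto
    then have "\<kappa> * \<bar>y - of_int n / real m\<bar> \<le> \<kappa> * \<bar>t - y\<bar> + \<kappa> * (R m / real m)"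
      unfolding distrib_left .
    moreover have "\<kappa> / 2 * \<bar>y - of_int n / real m\<bar> = (\<kappa> * \<bar>y - of_int n / real m\<bar>) / 2" by simp
    ultimately have 2: "\<kappa> / 2 * \<bar>y - of_int n / real m\<bar> \<le> \<kappa> * \<bar>t - y\<bar> - u t" using 1 by linarith
    \<comment> \<open>Where \<open>u1\<close> is positive, \<epsilon> < \<delta> \<le> 9/4
      \<open>\<rho> m\<close>, so the constant bound on \<open>u1'\<close> is already a multiple of
      \<open>\<rho> m\<close>. Where \<open>u1\<close> is 0 it has a minimum.\<close>
    have "\<bar>\<kappa> * u1' t\<bar> \<le> 9 / 4 * \<kappa> / \<epsilon> * \<rho> m"
    proof (cases "u1 t > 0")
      case True
      then have "\<epsilon> < 9 / 4 * \<rho> m" using u1(7)[of t] d by linarith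
      then have "1 \<le> 9 / 4 * \<rho> m / \<epsilon>" using \<epsilon> by (simp add: field_simps)
      then have "\<bar>u1' t\<bar> \<le> 9 / 4 * \<rho> m / \<epsilon>" using u1(8)[of t] by linarith
      then have "\<kappa> * \<bar>u1' t\<bar> \<le> \<kappa> * (9 / 4 * \<rho> m / \<epsilon>)" using \<kappa> by (intro mult_left_mono) auto
      then show ?thesis using \<kappa> by (simp add: abs_mult algebra_simps)
    next
      case False
      then have z: "u1 t = 0" using u1(4)[of t] by simp
      have "u1' t = 0" using DERIV_local_min[OF u1(1)[of t], of 1] u1(4) z by simp
      then show ?thesis using \<kappa> \<epsilon> \<rho>_pos[OF m1] by simp
    qed
    then have "u t + \<bar>u' t\<bar> \<le> \<kappa> * (9 / 4 * \<rho> m) + 9 / 4 * \<kappa> / \<epsilon> * \<rho> m + 2 * (\<theta> * E 8 m * \<Theta>)"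
      using u_le[of t] \<kappa>d tail[OF m1 least] unfolding u'_def by linarith
    also have "\<dots> = (9 / 4 * \<kappa> + 9 / 4 * \<kappa> / \<epsilon>) * \<rho> m + 2 * (\<theta> * \<Theta>) * E 8 m" by (simp add: algebra_simps)
    also have "\<dots> \<le> (9 / 4 * \<kappa> + 9 / 4 * \<kappa> / \<epsilon>) * E 8 m + 2 * (\<theta> * \<Theta>) * E 8 m"
      using \<rho>_le_E[OF m1] E_mono[of 8 32 m] \<kappa> \<epsilon> by (intro add_right_mono mult_left_mono) auto
    also have "\<dots> = C1 * E 8 m" by (simp add: C1_def algebra_simps)
    finally show ?thesis using 2 by blast
  qed
  have U2: "\<exists>M. \<forall>y\<in>W. \<forall>t. u t > 0 \<longrightarrow> 0 < \<kappa> * \<bar>t - y\<bar> - u t \<and> u t + \<bar>u' t\<bar> \<le> M * (\<kappa> * \<bar>t - y\<bar> - u t) ^ N" for N :: nat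
  proof -
    \<comment> \<open>The N-th power of \<open>E \<eta> m\<close> then has rate 8 N / (N + 1) < 8
      and dominates \<open>E 8 m\<close>; \<open>Suc N\<close> also covers N = 0.\<close>
    define \<eta> where "\<eta> = 8 / real (Suc N)"
    have \<eta>: "\<eta> > 0" by (simp add: \<eta>_def)
    obtain c where c: "c > 0" "\<And>y m n. y \<in> W \<Longrightarrow> m \<ge> 1 \<Longrightarrow> \<bar>y - of_int n / real m\<bar> \<ge> c * E \<eta> m"
      using W_set_dist_ge_exp[OF tb sub norm_le, of "\<eta> * \<beta>"] \<beta> \<eta> unfolding W_def E_def by auto
    define c' where "c' = (\<kappa> / 2 * c) ^ N"
    have c': "c' > 0" using \<kappa> c by (simp add: c'_def)
    define M where "M = C1 / c' + C2 / h ^ N"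
    have M: "M \<ge> C1 / c'" "M \<ge> C2 / h ^ N" "M \<ge> 0" using C1 C2 c' h by (auto simp: M_def)
    show ?thesis
    proof (intro exI[of _ M] ballI allI impI)
      fix y t assume y: "y \<in> W" and ut: "u t > 0"
      \<comment> \<open>If no bump is active at t, then t lies in \<open>C_set \<psi>\<close>, and u
        vanishes there.\<close>
      have ex: "\<exists>m. m \<ge> 1 \<and> G m t > 0"
      proof (rule ccontr)
        assume *: "\<not> (\<exists>m. m \<ge> 1 \<and> G m t > 0)"
        then have "G m t = 0" if "m \<ge> 1" for m using G(4)[OF that, of t] that by fastforce
        then have "(\<Sum>i. f i t) = 0" by (simp add: f_def)
        moreover have "t \<in> C_set \<psi>" using near[of t] * by fastforce
        ultimately show False using ut u_le[of t] \<delta>_C by simp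
      qed
      define m where "m = (LEAST m. m \<ge> 1 \<and> G m t > 0)"
      have m: "m \<ge> 1" "G m t > 0" using LeastI_ex[OF ex] by (auto simp: m_def)
      have least: "G j t = 0" if "1 \<le> j" "j < m" for j
        using not_less_Least[of j "\<lambda>m. m \<ge> 1 \<and> G m t > 0"] that G(4)[OF that(1), of t] by (auto simp: m_def)
      let ?k = "\<kappa> * \<bar>t - y\<bar> - u t"
      show "0 < ?k \<and> u t + \<bar>u' t\<bar> \<le> M * ?k ^ N"
      proof (cases "m < ms")
        case True
        have k: "h \<le> ?k" by (rule small[OF y m(1) True m(2)])
        have "u t + \<bar>u' t\<bar> \<le> C2 / h ^ N * h ^ N" using bound[of t] h by simp
        also have "\<dots> \<le> M * ?k ^ N" using M(2,3) k h C2 by (intro mult_mono power_mono) auto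
        finally show ?thesis using k h by linarith
      next
        case False
        then obtain n where n: "\<kappa> / 2 * \<bar>y - of_int n / real m\<bar> \<le> ?k" and le: "u t + \<bar>u' t\<bar> \<le> C1 * E 8 m"
          using large[OF y _ m(2) least] by auto
        have "\<kappa> / 2 * (c * E \<eta> m) \<le> \<kappa> / 2 * \<bar>y - of_int n / real m\<bar>" using c(2)[OF y m(1)] \<kappa> by (intro mult_left_mono) auto
        then have k: "\<kappa> / 2 * c * E \<eta> m \<le> ?k" using n by simp
        have kp: "\<kappa> / 2 * c * E \<eta> m > 0" using \<kappa> c(1) E_pos[of \<eta> m] by simp
        have "E 8 m \<le> E (\<eta> * real N) m"
          by (rule E_mono) (simp add: \<eta>_def field_simps)
        also have "E (\<eta> * real N) m = E \<eta> m ^ N" by (simp add: E_def algebra_simps flip: exp_of_nat_mult)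
        finally have "u t + \<bar>u' t\<bar> \<le> C1 * E \<eta> m ^ N" using le C1 by (meson mult_left_mono less_imp_le order_trans)
        also have "\<dots> = C1 / c' * (\<kappa> / 2 * c * E \<eta> m) ^ N"
          unfolding power_mult_distrib[of "\<kappa> / 2 * c" "E \<eta> m"] c'_def[symmetric] using c' by simp
        also have "\<dots> \<le> M * ?k ^ N" using M(1,3) k kp C1 c' by (intro mult_mono power_mono) auto
        finally show ?thesis using k kp by linarith
      qed
    qed
  qed
  show ?thesis
  proof (rule that[of u u'])
    show "(u has_real_derivative u' t) (at t)" for t
      unfolding u_def u'_def by (intro DERIV_add DERIV_cmult u1 ser)
    show "continuous_on UNIV u'" unfolding u'_def by (intro continuous_intros u1 ser)
    show "u (t + 1) = u t" for t unfolding u_def f_def using u1(3)[of t] G(3) by simp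
  qed (use u0 U1 U2 in \<open>auto simp: W_def\<close>)
qed

end
end

section \<open>Calculus in complex Banach spaces\<close>

lemma bounded_bilinear_scaleC: "bounded_bilinear (scaleC :: complex \<Rightarrow> 'b \<Rightarrow> 'b::complex_banach)"
proof
  fix a a' :: complex and x x' :: 'b and r :: real
  show "scaleC (a + a') x = scaleC a x + scaleC a' x" by (rule scaleC_add_left)
  show "scaleC a (x + x') = scaleC a x + scaleC a x'" by (rule scaleC_add_right)
  show "scaleC (r *\<^sub>R a) x = r *\<^sub>R scaleC a x"
    by (simp add: scaleR_conv_of_real scaleC_scaleC flip: scaleC_of_real)
  show "scaleC a (r *\<^sub>R x) = r *\<^sub>R scaleC a x"
    by (simp add: scaleC_scaleC mult.commute flip: scaleC_of_real)
  show "\<exists>K. \<forall>a (x::'b). norm (scaleC a x) \<le> norm a * norm x * K"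
    by (intro exI[of _ 1]) (simp add: norm_scaleC)
qed

interpretation scaleC: bounded_bilinear "scaleC :: complex \<Rightarrow> 'b \<Rightarrow> 'b::complex_banach"
  by (rule bounded_bilinear_scaleC)

declare scaleC.zero_left [simp] scaleC.zero_right [simp]

lemma scaleC_one [simp]: "scaleC 1 x = (x :: 'b::complex_banach)"
  using scaleC_of_real[of 1 x] by simp

lemmas continuous_on_scaleC [continuous_intros] = scaleC.continuous_on
lemmas has_vector_derivative_scaleC = scaleC.has_vector_derivative

lemma has_integral_scaleC_left:
  "(k has_integral I) S \<Longrightarrow> ((\<lambda>t. scaleC (k t) x) has_integral scaleC I (x::'b::complex_banach)) S"
  using has_integral_linear[OF _ scaleC.bounded_linear_left, of k I S x] by (simp add: o_def)

lemma has_integral_scaleC_right: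
  "(k has_integral I) S \<Longrightarrow> ((\<lambda>t. scaleC a (k t)) has_integral scaleC a (I::'b::complex_banach)) S"
  using has_integral_linear[OF _ scaleC.bounded_linear_right, of k I S a] by (simp add: o_def)

section \<open>Taylor remainders of the Cauchy kernel\<close>

text \<open>The cofactor of \<Delta>^(m+1) in the Taylor remainder of order m of 1/(\<zeta> -
  z)^(n+1). It is a polynomial in a and b, and flatness absorbs any fixed power of these singular
  factors.\<close>

primrec kernel_rem :: "nat \<Rightarrow> nat \<Rightarrow> complex \<Rightarrow> complex \<Rightarrow> complex" where
  "kernel_rem 0 m a b = a ^ Suc m * b"
| "kernel_rem (Suc n) m a b = b * (kernel_rem n m a b + of_nat (Suc n + m choose m) * a ^ (n + m + 2))"

text \<open>With \<open>a = 1 / (\<zeta> - z\<^sub>1)\<close> and \<open>b = 1 / (\<zeta> - z\<^sub>2)\<close> the hypothesis holds for \<open>\<Delta> = z\<^sub>2 - z\<^sub>1\<close>.\<close>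

lemma kernel_taylor_choose:
  fixes a b \<Delta> :: complex
  assumes "b - a = \<Delta> * a * b"
  shows "b ^ Suc n = (\<Sum>h\<le>m. of_nat (n + h choose h) * \<Delta> ^ h * a ^ (n + h + 1)) + \<Delta> ^ Suc m * kernel_rem n m a b"
proof (induction n)
  case 0
  show ?case
  proof (induction m)
    case 0
    then show ?case using assms by (simp add: algebra_simps)
  next
    case (Suc m)
    have "b = a + \<Delta> * a * b" using assms by (simp add: algebra_simps)
    then have "\<Delta> ^ Suc m * a ^ Suc m * b = \<Delta> ^ Suc m * a ^ Suc m * (a + \<Delta> * a * b)" by (rule arg_cong)
    also have "\<dots> = \<Delta> ^ Suc m * a ^ (Suc m + 1) + \<Delta> ^ Suc (Suc m) * (a ^ Suc (Suc m) * b)"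
      by (simp add: algebra_simps)
    finally have "\<Delta> ^ Suc m * (a ^ Suc m * b) =
      \<Delta> ^ Suc m * a ^ (Suc m + 1) + \<Delta> ^ Suc (Suc m) * (a ^ Suc (Suc m) * b)" by (simp only: mult.assoc)
    then show ?case using Suc unfolding sum.atMost_Suc kernel_rem.simps(1)
      by (simp only: add_0 binomial_n_n of_nat_1 mult_1 add.assoc)
  qed
next
  case (Suc n)
  \<comment> \<open>Pascal's rule: multiplying the expansion for n by b gives the one for n + 1 up
    to a single boundary term, which moves into \<open>kernel_rem\<close>.\<close>
  have step: "(\<Sum>h\<le>m. of_nat (Suc n + h choose h) * \<Delta> ^ h * a ^ (Suc n + h + 1)) =
    b * (\<Sum>h\<le>m. of_nat (n + h choose h) * \<Delta> ^ h * a ^ (n + h + 1)) -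
    of_nat (Suc n + m choose m) * \<Delta> ^ Suc m * a ^ (n + m + 2) * b" for m
  proof (induction m)
    case 0
    have "a ^ n * a * a = a ^ n * a * (b - \<Delta> * a * b)" using assms by (metis add_diff_cancel_left' diff_diff_eq2)
    then show ?case by (simp add: algebra_simps)
  next
    case (Suc m)
    define c where "c = (of_nat (Suc n + Suc m choose Suc m) :: complex)"
    have c: "c = of_nat (Suc n + m choose m) + of_nat (n + Suc m choose Suc m)"
      unfolding c_def by (simp flip: of_nat_add)
    have ab: "a = b - \<Delta> * a * b" using assms by (simp add: algebra_simps)
    have "c * \<Delta> ^ Suc m * a ^ (Suc n + Suc m + 1) = c * \<Delta> ^ Suc m * a ^ (n + m + 2) * a" by simp
    also have "\<dots> = c * \<Delta> ^ Suc m * a ^ (n + m + 2) * (b - \<Delta> * a * b)" using ab by simp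
    also have "\<dots> = b * (of_nat (n + Suc m choose Suc m) * \<Delta> ^ Suc m * a ^ (n + Suc m + 1))
       + of_nat (Suc n + m choose m) * \<Delta> ^ Suc m * a ^ (n + m + 2) * b
       - c * \<Delta> ^ Suc (Suc m) * a ^ (n + Suc m + 2) * b"
      unfolding right_diff_distrib by (subst (1) c) (simp add: algebra_simps)
    finally show ?case using Suc unfolding sum.atMost_Suc c_def[symmetric] distrib_left by simp
  qed
  have "b ^ Suc (Suc n) = b * (\<Sum>h\<le>m. of_nat (n + h choose h) * \<Delta> ^ h * a ^ (n + h + 1)) + b * (\<Delta> ^ Suc m * kernel_rem n m a b)"
    using Suc by (simp add: distrib_left)
  then show ?case unfolding step by (simp add: algebra_simps)
qed

text \<open>The factorials give the expansion the shape of \<open>taylor_remainder\<close> for the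
  derivatives n! / (\<zeta> - z)^(n+1).\<close>

lemma kernel_taylor:
  fixes a b \<Delta> :: complex
  assumes "b - a = \<Delta> * a * b"
  shows "fact n * b ^ Suc n - (\<Sum>h=0..m. \<Delta> ^ h / fact h * (fact (n + h) * a ^ Suc (n + h))) =
    \<Delta> ^ Suc m * (fact n * kernel_rem n m a b)"
proof -
  have "\<Delta> ^ h / fact h * (fact (n + h) * a ^ Suc (n + h)) =
      fact n * (of_nat (n + h choose h) * \<Delta> ^ h * a ^ (n + h + 1))" for h
  proof -
    have "(fact (n + h) :: complex) = of_nat (n + h choose h) * (fact h * fact n)"
      using binomial_fact[of h "n + h", where 'a = complex] by (simp add: field_simps)
    then show ?thesis by simp
  qed
  then have "(\<Sum>h=0..m. \<Delta> ^ h / fact h * (fact (n + h) * a ^ Suc (n + h))) =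
     fact n * (\<Sum>h\<le>m. of_nat (n + h choose h) * \<Delta> ^ h * a ^ (n + h + 1))"
    by (simp add: sum_distrib_left atLeast0AtMost)
  then show ?thesis using kernel_taylor_choose[OF assms, of n m] by (simp add: algebra_simps)
qed

text \<open>The Lipschitz half serves to compare the kernel on the two inner curves. As a property
  of functions it only has to be closed under sums and products, and no representation of
  polynomials is involved.\<close>

definition poly_growth :: "(complex \<Rightarrow> complex \<Rightarrow> complex) \<Rightarrow> bool" where
  "poly_growth p \<longleftrightarrow> (\<exists>C k. 0 \<le> C \<and> (\<forall>T\<ge>1. \<forall>a b a' b'.
     cmod a \<le> T \<longrightarrow> cmod b \<le> T \<longrightarrow> cmod a' \<le> T \<longrightarrow> cmod b' \<le> T \<longrightarrow>
     cmod (p a b) \<le> C * T ^ k \<and> cmod (p a b - p a' b') \<le> C * T ^ k * (cmod (a - a') + cmod (b - b'))))"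

lemma poly_growth_const [intro]: "poly_growth (\<lambda>a b. c)"
  unfolding poly_growth_def by (intro exI[of _ "cmod c"] exI[of _ 0]) auto

lemma poly_growth_fst [intro]: "poly_growth (\<lambda>a b. a)"
  unfolding poly_growth_def by (intro exI[of _ 1] exI[of _ 1]) (auto intro!: mult_mono[of 1 _ "cmod _", simplified] order_trans[OF norm_ge_zero])

lemma poly_growth_snd [intro]: "poly_growth (\<lambda>a b. b)"
  unfolding poly_growth_def by (intro exI[of _ 1] exI[of _ 1]) (auto intro!: mult_mono[of 1 _ "cmod _", simplified] order_trans[OF norm_ge_zero])

text \<open>T \<ge> 1 allows raising the exponent, so that two functions can share one.\<close>

lemma poly_growthE:
  assumes "poly_growth p"
  obtains C k where "0 \<le> C" "\<And>T a b a' b' l. k \<le> l \<Longrightarrow> T \<ge> 1 \<Longrightarrow> cmod a \<le> T \<Longrightarrow> cmod b \<le> T \<Longrightarrow> cmod a' \<le> T \<Longrightarrow> cmod b' \<le> T \<Longrightarrow>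
     cmod (p a b) \<le> C * T ^ l \<and> cmod (p a b - p a' b') \<le> C * T ^ l * (cmod (a - a') + cmod (b - b'))"
proof -
  obtain C k where C: "0 \<le> C" and b: "\<And>T a b a' b'. T \<ge> 1 \<Longrightarrow> cmod a \<le> T \<Longrightarrow> cmod b \<le> T \<Longrightarrow> cmod a' \<le> T \<Longrightarrow> cmod b' \<le> T \<Longrightarrow>
     cmod (p a b) \<le> C * T ^ k \<and> cmod (p a b - p a' b') \<le> C * T ^ k * (cmod (a - a') + cmod (b - b'))"
    using assms unfolding poly_growth_def by blast
  show ?thesis
  proof (rule that[OF C, of k])
    fix T a b' a' and b :: complex and l assume l: "k \<le> l" and T: "T \<ge> 1" and n: "cmod a \<le> T" "cmod b \<le> T" "cmod a' \<le> T" "cmod b' \<le> T"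
    have "C * T ^ k \<le> C * T ^ l" using C T l by (intro mult_left_mono power_increasing) auto
    then show "cmod (p a b) \<le> C * T ^ l \<and> cmod (p a b - p a' b') \<le> C * T ^ l * (cmod (a - a') + cmod (b - b'))"
      using b[OF T n] by (meson add_nonneg_nonneg mult_right_mono norm_ge_zero order_trans)
  qed
qed

lemma poly_growth_add [intro]:
  assumes "poly_growth p" "poly_growth q"
  shows "poly_growth (\<lambda>a b. p a b + q a b)"
proof -
  obtain C k where C: "0 \<le> C" and p: "\<And>T a b a' b' l. k \<le> l \<Longrightarrow> T \<ge> 1 \<Longrightarrow> cmod a \<le> T \<Longrightarrow> cmod b \<le> T \<Longrightarrow> cmod a' \<le> T \<Longrightarrow> cmod b' \<le> T \<Longrightarrow>
     cmod (p a b) \<le> C * T ^ l \<and> cmod (p a b - p a' b') \<le> C * T ^ l * (cmod (a - a') + cmod (b - b'))"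
    using poly_growthE[OF assms(1)] by metis
  obtain D j where D: "0 \<le> D" and q: "\<And>T a b a' b' l. j \<le> l \<Longrightarrow> T \<ge> 1 \<Longrightarrow> cmod a \<le> T \<Longrightarrow> cmod b \<le> T \<Longrightarrow> cmod a' \<le> T \<Longrightarrow> cmod b' \<le> T \<Longrightarrow>
     cmod (q a b) \<le> D * T ^ l \<and> cmod (q a b - q a' b') \<le> D * T ^ l * (cmod (a - a') + cmod (b - b'))"
    using poly_growthE[OF assms(2)] by metis
  show ?thesis unfolding poly_growth_def
  proof (intro exI[of _ "C + D"] exI[of _ "k + j"] conjI allI impI)
    fix T a b a' b' assume T: "T \<ge> 1" and n: "cmod a \<le> T" "cmod b \<le> T" "cmod a' \<le> T" "cmod b' \<le> T"
    note P = p[OF le_add1 T n, of j] and Q = q[OF le_add2 T n, of k]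
    show "cmod (p a b + q a b) \<le> (C + D) * T ^ (k + j)"
      using P Q norm_triangle_ineq[of "p a b" "q a b"] by (simp add: distrib_right)
    have e: "p a b + q a b - (p a' b' + q a' b') = (p a b - p a' b') + (q a b - q a' b')" by simp
    show "cmod (p a b + q a b - (p a' b' + q a' b')) \<le> (C + D) * T ^ (k + j) * (cmod (a - a') + cmod (b - b'))"
      unfolding e distrib_right[of C D] distrib_right[of "C * T ^ (k + j)"]
      using conjunct2[OF P] conjunct2[OF Q] norm_triangle_ineq[of "p a b - p a' b'" "q a b - q a' b'"] by linarith
  qed (use C D in auto)
qed

lemma poly_growth_mult [intro]:
  assumes "poly_growth p" "poly_growth q"
  shows "poly_growth (\<lambda>a b. p a b * q a b)"
proof -
  obtain C k where C: "0 \<le> C" and p: "\<And>T a b a' b' l. k \<le> l \<Longrightarrow> T \<ge> 1 \<Longrightarrow> cmod a \<le> T \<Longrightarrow> cmod b \<le> T \<Longrightarrow> cmod a' \<le> T \<Longrightarrow> cmod b' \<le> T \<Longrightarrow>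
     cmod (p a b) \<le> C * T ^ l \<and> cmod (p a b - p a' b') \<le> C * T ^ l * (cmod (a - a') + cmod (b - b'))"
    using poly_growthE[OF assms(1)] by metis
  obtain D j where D: "0 \<le> D" and q: "\<And>T a b a' b' l. j \<le> l \<Longrightarrow> T \<ge> 1 \<Longrightarrow> cmod a \<le> T \<Longrightarrow> cmod b \<le> T \<Longrightarrow> cmod a' \<le> T \<Longrightarrow> cmod b' \<le> T \<Longrightarrow>
     cmod (q a b) \<le> D * T ^ l \<and> cmod (q a b - q a' b') \<le> D * T ^ l * (cmod (a - a') + cmod (b - b'))"
    using poly_growthE[OF assms(2)] by metis
  show ?thesis unfolding poly_growth_def
  proof (intro exI[of _ "2 * (C * D)"] exI[of _ "k + j"] conjI allI impI)
    fix T a b a' b' assume T: "T \<ge> 1" and n: "cmod a \<le> T" "cmod b \<le> T" "cmod a' \<le> T" "cmod b' \<le> T"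
    note P = p[OF order_refl T n] and Q = q[OF order_refl T n] and P' = p[OF order_refl T n(3,4,1,2)]
    define s where "s = cmod (a - a') + cmod (b - b')"
    have s: "s \<ge> 0" by (simp add: s_def)
    have CD: "0 \<le> C * T ^ k" "0 \<le> D * T ^ j" using C D T by auto
    have "cmod (p a b) * cmod (q a b) \<le> (C * T ^ k) * (D * T ^ j)" using P Q CD by (intro mult_mono) auto
    also have "\<dots> = (C * D) * T ^ (k + j)" by (simp add: power_add)
    also have "\<dots> \<le> 2 * (C * D) * T ^ (k + j)" using C D T by (intro mult_right_mono) auto
    finally show "cmod (p a b * q a b) \<le> 2 * (C * D) * T ^ (k + j)" by (simp add: norm_mult)
    have "p a b * q a b - p a' b' * q a' b' = (p a b - p a' b') * q a b + p a' b' * (q a b - q a' b')"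
      by (simp add: algebra_simps)
    then have "cmod (p a b * q a b - p a' b' * q a' b') \<le> cmod (p a b - p a' b') * cmod (q a b) + cmod (p a' b') * cmod (q a b - q a' b')"
      by (metis norm_mult norm_triangle_ineq)
    also have "\<dots> \<le> (C * T ^ k * s) * (D * T ^ j) + (C * T ^ k) * (D * T ^ j * s)"
      using P Q P' CD s unfolding s_def[symmetric] by (intro add_mono mult_mono) auto
    also have "\<dots> = 2 * (C * D) * T ^ (k + j) * s" by (simp add: power_add algebra_simps)
    finally show "cmod (p a b * q a b - p a' b' * q a' b') \<le> 2 * (C * D) * T ^ (k + j) * (cmod (a - a') + cmod (b - b'))"
      by (simp add: s_def)
  qed (use C D in auto)
qed

lemma poly_growth_power [intro]: "poly_growth p \<Longrightarrow> poly_growth (\<lambda>a b. p a b ^ n)"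
  by (induction n) auto

lemma poly_growth_kernel_rem: "poly_growth (kernel_rem n m)"
proof (induction n)
  case 0
  have "poly_growth (\<lambda>a b. a ^ Suc m * b)" by (intro poly_growth_mult poly_growth_power poly_growth_fst poly_growth_snd)
  moreover have "(\<lambda>a b. a ^ Suc m * b) = kernel_rem 0 m" by (intro ext) simp
  ultimately show ?case by simp
next
  case (Suc n)
  have "poly_growth (\<lambda>a b. b * (kernel_rem n m a b + of_nat (Suc n + m choose m) * a ^ (n + m + 2)))"
    by (intro poly_growth_mult poly_growth_add poly_growth_power poly_growth_fst poly_growth_snd poly_growth_const Suc)
  moreover have "(\<lambda>a b. b * (kernel_rem n m a b + of_nat (Suc n + m choose m) * a ^ (n + m + 2))) = kernel_rem (Suc n) m"
    by (intro ext) simp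
  ultimately show ?case by simp
qed

section \<open>The Cauchy formula over a flat contour\<close>

text \<open>For integrands that make sense only over the columns meeting the strip |y| \<le> d: they
  vanish where u = d and are continued by 0.\<close>

lemma continuous_on_paste_zero:
  fixes F :: "'a::topological_space \<Rightarrow> 'b::real_normed_vector" and w :: "'a \<Rightarrow> real"
  assumes w: "continuous_on S w" and S: "closed S"
    and F: "continuous_on {x\<in>S. w x \<le> d} F" and z: "\<And>x. x \<in> S \<Longrightarrow> w x = d \<Longrightarrow> F x = 0"
  shows "continuous_on S (\<lambda>x. if w x \<le> d then F x else 0)"
proof -
  have c: "closed {x\<in>S. w x \<le> d}" "closed {x\<in>S. d \<le> w x}"
    using continuous_on_closed_Collect_le[OF w continuous_on_const S, of d]
      continuous_on_closed_Collect_le[OF continuous_on_const w S, of d] by auto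
  have "continuous_on ({x\<in>S. w x \<le> d} \<union> {x\<in>S. d \<le> w x}) (\<lambda>x. if w x \<le> d then F x else 0)"
    by (rule continuous_on_If[OF c F continuous_on_const]) (use z in \<open>auto simp: antisym\<close>)
  moreover have "{x\<in>S. w x \<le> d} \<union> {x\<in>S. d \<le> w x} = S" by auto
  ultimately show ?thesis by simp
qed

text \<open>The point q for x = t + i y. Its modulus exp(-2 \<pi> y) decreases with y, so the curve
  at height -v is the outermost one in the q-plane.\<close>

definition pt :: "real \<Rightarrow> real \<Rightarrow> complex" where
  "pt t y = exp (2 * pi * \<i> * Complex t y)"

lemma norm_pt: "cmod (pt t y) = exp (- 2 * pi * y)"
  by (simp add: pt_def norm_exp_eq_Re)

lemma pt_nonzero [simp]: "pt t y \<noteq> 0"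
  by (simp add: pt_def)

lemma pt_add_1: "pt (t + 1) y = pt t y"
proof -
  have "2 * pi * \<i> * Complex (t + 1) y = 2 * pi * \<i> * Complex t y + 2 * pi * \<i>"
    by (simp add: complex_eq_iff algebra_simps)
  then show ?thesis by (simp add: pt_def exp_add)
qed

lemma pt_has_vector_derivative:
  assumes "(x has_real_derivative x') (at t within S)" "(y has_real_derivative y') (at t within S)"
  shows "((\<lambda>t. pt (x t) (y t)) has_vector_derivative 2 * pi * \<i> * pt (x t) (y t) * Complex x' y') (at t within S)"
proof -
  have "((\<lambda>t. Complex (x t) (y t)) has_vector_derivative Complex x' y') (at t within S)"
    unfolding Complex_eq using assms
    by (auto intro!: derivative_eq_intros simp: has_real_derivative_iff_has_vector_derivative)
  then have "((\<lambda>t. 2 * pi * \<i> * Complex (x t) (y t)) has_vector_derivative 2 * pi * \<i> * Complex x' y') (at t within S)"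
    by (rule has_vector_derivative_mult_right)
  then have "((exp \<circ> (\<lambda>t. 2 * pi * \<i> * Complex (x t) (y t))) has_vector_derivative
    2 * pi * \<i> * Complex x' y' * exp (2 * pi * \<i> * Complex (x t) (y t))) (at t within S)"
    by (rule field_vector_diff_chain_within) (auto intro!: derivative_eq_intros)
  then show ?thesis by (simp add: pt_def o_def mult_ac)
qed

lemma continuous_on_pt [continuous_intros]:
  assumes "continuous_on S x" "continuous_on S y"
  shows "continuous_on S (\<lambda>a. pt (x a) (y a))"
  unfolding pt_def Complex_eq using assms by (intro continuous_intros)

text \<open>For the columns where u = d: there p vanishes together with its derivative, and a factor
  in front of it only has to be bounded.\<close>

lemma has_vector_derivative_zero_if_le:
  fixes \<Phi> :: "real \<Rightarrow> 'a::real_normed_vector" and p :: "real \<Rightarrow> real"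
  assumes p: "(p has_real_derivative 0) (at t)" "p t = 0" and \<Phi>: "\<Phi> t = 0"
    and le: "eventually (\<lambda>s. norm (\<Phi> s) \<le> C * \<bar>p s\<bar>) (at t)"
  shows "(\<Phi> has_vector_derivative 0) (at t)"
proof -
  have "((\<lambda>s. C * \<bar>(p s - p t) / (s - t)\<bar>) \<longlongrightarrow> C * \<bar>0\<bar>) (at t)"
    using p(1) unfolding has_field_derivative_iff by (intro tendsto_intros)
  then have lim: "((\<lambda>s. C * \<bar>(p s - p t) / (s - t)\<bar>) \<longlongrightarrow> 0) (at t)" by (simp only: abs_zero mult_zero_right)
  have ev: "eventually (\<lambda>s. norm (norm (\<Phi> s) / norm (s - t)) \<le> C * \<bar>(p s - p t) / (s - t)\<bar>) (at t)"
    using le by eventually_elim (simp add: p \<Phi> abs_divide divide_right_mono)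
  have "((\<lambda>s. norm (\<Phi> s) / norm (s - t)) \<longlongrightarrow> 0) (at t)"
    by (rule Lim_null_comparison[OF ev lim])
  then have "(\<Phi> has_derivative (\<lambda>_. 0)) (at t)"
    unfolding has_derivative_iff_norm by (simp add: \<Phi>)
  then show ?thesis by (simp add: has_vector_derivative_def)
qed

text \<open>Separates the analysis from the number theory. The assumption \<open>flat\<close> speaks
  of the whole removed column |y| \<le> u t and not only of its two ends, so it also shows that Z
  does not meet the column where u t > 0.\<close>

locale flat_contour =
  fixes K Z :: "complex set" and d :: real and u u' :: "real \<Rightarrow> real"
    and f f1 :: "complex \<Rightarrow> 'b::complex_banach"
  assumes d: "0 < d"
    and u_deriv: "\<And>t. (u has_real_derivative u' t) (at t)"
    and u'_cont: "continuous_on UNIV u'"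
    and u_per: "\<And>t. u (t + 1) = u t"
    and u_nonneg: "\<And>t. 0 \<le> u t"
    and K_mem: "\<And>t y. u t \<le> \<bar>y\<bar> \<Longrightarrow> \<bar>y\<bar> \<le> d \<Longrightarrow> pt t y \<in> K"
    and Z_sub: "Z \<subseteq> K"
    and Z_strip: "\<And>z. z \<in> Z \<Longrightarrow> \<exists>t y. z = pt t y \<and> \<bar>y\<bar> \<le> d / 2"
    and flat: "\<And>N. \<exists>M. \<forall>z\<in>Z. \<forall>t y. \<bar>y\<bar> \<le> u t \<longrightarrow> u t + \<bar>u' t\<bar> \<le> M * cmod (pt t y - z) ^ N"
    and f_cont: "continuous_on K f" and f1_cont: "continuous_on K f1"
    and C1: "\<And>z \<epsilon>. z \<in> K \<Longrightarrow> \<epsilon> > 0 \<Longrightarrow> \<exists>\<delta>>0. \<forall>z1\<in>K. \<forall>z2\<in>K. cmod (z1 - z) < \<delta> \<longrightarrow> cmod (z2 - z) < \<delta> \<longrightarrow>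
          norm (f z2 - f z1 - scaleC (z2 - z1) (f1 z1)) \<le> \<epsilon> * cmod (z1 - z2)"
begin

lemma u'_per: "u' (t + 1) = u' t"
proof -
  have "((\<lambda>s. u (s + 1)) has_real_derivative u' (t + 1)) (at t)"
    using u_deriv[of "t + 1"] by (simp add: DERIV_shift)
  then show ?thesis using u_deriv[of t] u_per by (simp add: DERIV_unique)
qed

lemma u_cont [continuous_intros]: "continuous_on S x \<Longrightarrow> continuous_on S (\<lambda>a. u (x a))"
  by (rule continuous_on_compose2[of UNIV u]) (auto intro: DERIV_continuous_on u_deriv)

lemma u'_cont2 [continuous_intros]: "continuous_on S x \<Longrightarrow> continuous_on S (\<lambda>a. u' (x a))"
  by (rule continuous_on_compose2[OF u'_cont]) auto

lemma u'_zero: "u t = 0 \<Longrightarrow> u' t = 0"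
  using DERIV_local_min[OF u_deriv[of t], of 1] u_nonneg by simp

text \<open>The height \<open>v\<close> of the outer contour: it merges with \<open>u\<close> over the columns that the strip
  of height \<open>d\<close> does not meet, and otherwise lies between \<open>3 * d / 4\<close> and \<open>d\<close>.\<close>

definition "p t = (max 0 (d - u t))\<^sup>2 / d"
definition "p' t = 2 * max 0 (d - u t) * (- u' t) / d"
definition "v t = u t + p t"
definition "v' t = u' t + p' t"

lemma p_deriv: "(p has_real_derivative p' t) (at t)"
proof -
  have "((\<lambda>t. d - u t) has_real_derivative - u' t) (at t)" by (auto intro!: derivative_eq_intros u_deriv)
  then show ?thesis unfolding p_def p'_def
    by (intro DERIV_cdivide DERIV_chain2[OF has_real_derivative_pos_part_sq])
qed

lemma v_deriv: "(v has_real_derivative v' t) (at t)"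
  unfolding v_def v'_def by (intro DERIV_add u_deriv p_deriv)

lemma p_cont [continuous_intros]: "continuous_on S x \<Longrightarrow> continuous_on S (\<lambda>a. p (x a))"
  unfolding p_def by (intro continuous_intros) (use d in auto)

lemma p'_cont [continuous_intros]: "continuous_on S x \<Longrightarrow> continuous_on S (\<lambda>a. p' (x a))"
  unfolding p'_def by (intro continuous_intros) (use d in auto)

lemma v_cont [continuous_intros]: "continuous_on S x \<Longrightarrow> continuous_on S (\<lambda>a. v (x a))"
  unfolding v_def by (intro continuous_intros)

lemma v'_cont [continuous_intros]: "continuous_on S x \<Longrightarrow> continuous_on S (\<lambda>a. v' (x a))"
  unfolding v'_def by (intro continuous_intros)

lemma p_per: "p (t + 1) = p t" "p' (t + 1) = p' t"
  by (simp_all add: p_def p'_def u_per u'_per)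

lemma p_nonneg: "0 \<le> p t"
  using d by (simp add: p_def)

lemma p_pos_iff: "0 < p t \<longleftrightarrow> u t < d"
  using d by (auto simp: p_def zero_less_divide_iff max_def)

lemma p_zero: "d \<le> u t \<Longrightarrow> p t = 0 \<and> p' t = 0"
  by (simp add: p_def p'_def)

lemma v_le: "u t \<le> d \<Longrightarrow> v t \<le> d"
proof -
  assume "u t \<le> d"
  then have "(d - u t)\<^sup>2 \<le> (d - u t) * d" unfolding power2_eq_square
    using u_nonneg[of t] by (intro mult_left_mono) auto
  then have "(d - u t)\<^sup>2 / d \<le> d - u t" using d by (simp add: pos_divide_le_eq)
  then show ?thesis using \<open>u t \<le> d\<close> by (simp add: v_def p_def)
qed

lemma v_ge: "3 / 4 * d \<le> v t"
proof (cases "u t \<le> d")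
  case True
  \<comment> \<open>Completing the square. The minimum 3/4 d leaves a distance d / 4 to the strip
    |y| \<le> d / 2 that contains Z.\<close>
  have "u t + (d - u t)\<^sup>2 / d = 3 / 4 * d + (u t - d / 2)\<^sup>2 / d"
    using d by (simp add: field_simps power2_eq_square)
  moreover have "0 \<le> (u t - d / 2)\<^sup>2 / d" using d by simp
  ultimately show ?thesis using True by (simp add: v_def p_def)
next
  case False
  then show ?thesis using d p_nonneg[of t] by (simp add: v_def)
qed

lemma seg_mem: 
  assumes "u t \<le> d" "0 \<le> l" "l \<le> 1" "\<bar>s\<bar> = 1"
  shows "pt t (s * (u t + l * p t)) \<in> K"
proof -
  have lp: "0 \<le> l * p t" "l * p t \<le> p t" using assms p_nonneg[of t] by (auto simp: mult_left_le_one_le)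
  have "\<bar>s * (u t + l * p t)\<bar> = u t + l * p t" using lp u_nonneg[of t] assms by (simp add: abs_mult)
  then show ?thesis using v_le[OF assms(1)] lp by (intro K_mem) (auto simp: v_def)
qed

text \<open>The case z1 = z of the C^1 condition. As z need not be interior to K, this is a
  derivative within K, and the chain rule applies to curves that stay in K.\<close>

lemma f_deriv: "z \<in> K \<Longrightarrow> (f has_derivative (\<lambda>w. scaleC w (f1 z))) (at z within K)"
proof -
  assume z: "z \<in> K"
  show ?thesis unfolding has_derivative_within_alt
  proof (intro conjI allI impI)
    show "bounded_linear (\<lambda>w. scaleC w (f1 z))" by (rule scaleC.bounded_linear_left)
    fix e :: real assume "e > 0"
    then obtain \<delta> where "\<delta> > 0" and \<delta>: "\<And>z1 z2. z1 \<in> K \<Longrightarrow> z2 \<in> K \<Longrightarrow> cmod (z1 - z) < \<delta> \<Longrightarrow> cmod (z2 - z) < \<delta> \<Longrightarrow>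
          norm (f z2 - f z1 - scaleC (z2 - z1) (f1 z1)) \<le> e * cmod (z1 - z2)"
      using C1[OF z] by meson
    then show "\<exists>d>0. \<forall>y\<in>K. norm (y - z) < d \<longrightarrow> norm (f y - f z - scaleC (y - z) (f1 z)) \<le> e * norm (y - z)"
    proof (intro exI[of _ \<delta>] conjI ballI impI)
      fix y assume "y \<in> K" "norm (y - z) < \<delta>"
      then show "norm (f y - f z - scaleC (y - z) (f1 z)) \<le> e * norm (y - z)"
        using \<delta>[OF z, of y] \<open>\<delta> > 0\<close> by (simp add: norm_minus_commute[of z y])
    qed (rule \<open>\<delta> > 0\<close>)
  qed
qed

lemma f_chain:
  assumes g: "(g has_vector_derivative g') (at t within S)" and S: "g ` S \<subseteq> K" "t \<in> S"
  shows "((\<lambda>t. f (g t)) has_vector_derivative scaleC g' (f1 (g t))) (at t within S)"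
proof -
  have gt: "g t \<in> K" using S by blast
  have fd: "(f has_derivative (\<lambda>w. scaleC w (f1 (g t)))) (at (g t) within g ` S)"
    by (rule has_derivative_subset[OF f_deriv[OF gt] S(1)])
  have "((\<lambda>x. f (g x)) has_derivative (\<lambda>x. scaleC (x *\<^sub>R g') (f1 (g t)))) (at t within S)"
    using has_derivative_in_compose[OF g[unfolded has_vector_derivative_def] fd] .
  then show ?thesis by (simp only: has_vector_derivative_def scaleC.scaleR_left)
qed

text \<open>The difference quotient with its singularity filled in. Deforming this instead of f(w) /
  (w - z) lets the curves pass through z.\<close>

definition quot :: "complex \<Rightarrow> complex \<Rightarrow> 'b" where
  "quot z w = (if w = z then f1 z else scaleC (1 / (w - z)) (f w - f z))"

definition quot' :: "complex \<Rightarrow> complex \<Rightarrow> 'b" where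
  "quot' z w = scaleC (1 / (w - z)) (f1 w) - scaleC (1 / (w - z)\<^sup>2) (f w - f z)"

text \<open>At z this is the C^1 condition with z1 = z, divided by |x - z|.\<close>

lemma quot_cont: assumes z: "z \<in> K" shows "continuous_on K (quot z)"
proof -
  have "continuous (at w within K) (quot z)" if w: "w \<in> K" for w
  proof (cases "w = z")
    case True
    show ?thesis unfolding True continuous_within_eps_delta
    proof (intro allI impI)
      fix e :: real assume e: "e > 0"
      then obtain \<delta> where \<delta>0: "\<delta> > 0" and \<delta>: "\<And>z1 z2. z1 \<in> K \<Longrightarrow> z2 \<in> K \<Longrightarrow> cmod (z1 - z) < \<delta> \<Longrightarrow> cmod (z2 - z) < \<delta> \<Longrightarrow>
          norm (f z2 - f z1 - scaleC (z2 - z1) (f1 z1)) \<le> e / 2 * cmod (z1 - z2)"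
        using C1[OF z, of "e / 2"] by (meson half_gt_zero)
      have "dist (quot z x) (quot z z) < e" if x: "x \<in> K" "dist x z < \<delta>" for x
      proof (cases "x = z")
        case False
        have "norm (f x - f z - scaleC (x - z) (f1 z)) \<le> e / 2 * cmod (x - z)"
          using \<delta>[OF z x(1)] x \<delta>0 by (simp add: dist_norm norm_minus_commute[of z x])
        moreover have "quot z x - quot z z = scaleC (1 / (x - z)) (f x - f z - scaleC (x - z) (f1 z))"
          using False by (simp add: quot_def scaleC.diff_right scaleC_scaleC)
        ultimately have "norm (quot z x - quot z z) \<le> e / 2"
          using False by (simp add: norm_scaleC norm_divide pos_divide_le_eq)
        then show ?thesis using e by (simp add: dist_norm)
      qed (use e in simp)
      then show "\<exists>d>0. \<forall>x\<in>K. dist x z < d \<longrightarrow> dist (quot z x) (quot z z) < e" using \<delta>0 by blast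
    qed
  next
    case False
    have fc: "continuous (at w within K) f" using f_cont w by (simp add: continuous_on_eq_continuous_within)
    have "continuous (at w within K) (\<lambda>w. scaleC (1 / (w - z)) (f w - f z))"
      using fc False by (intro scaleC.continuous continuous_intros) auto
    then show ?thesis
    proof (rule continuous_transform_within[of _ _ _ "dist w z"])
      show "scaleC (1 / (x - z)) (f x - f z) = quot z x" if "x \<in> K" "dist x w < dist w z" for x
        using that by (auto simp: quot_def dist_commute)
    qed (use False w in auto)
  qed
  then show ?thesis by (simp add: continuous_on_eq_continuous_within)
qed

lemma quot'_cont: "continuous_on (K - {z}) (quot' z)"
  unfolding quot'_def
  by (intro continuous_intros continuous_on_subset[OF f_cont] continuous_on_subset[OF f1_cont]) auto

lemma quot_chain:
  assumes g: "(g has_vector_derivative g') (at t within S)" and S: "g ` S \<subseteq> K - {z}" "t \<in> S"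
  shows "((\<lambda>t. quot z (g t)) has_vector_derivative scaleC g' (quot' z (g t))) (at t within S)"
proof -
  have nz: "g t \<noteq> z" "\<And>s. s \<in> S \<Longrightarrow> g s \<noteq> z" using S by auto
  have "((\<lambda>w. 1 / (w - z)) has_field_derivative - 1 / (g t - z)\<^sup>2) (at (g t) within g ` S)"
    using nz by (auto intro!: derivative_eq_intros simp: power2_eq_square)
  from field_vector_diff_chain_within[OF g this]
  have 1: "((\<lambda>t. 1 / (g t - z)) has_vector_derivative g' * (- 1 / (g t - z)\<^sup>2)) (at t within S)"
    by (simp add: o_def)
  have "((\<lambda>t. f (g t)) has_vector_derivative scaleC g' (f1 (g t))) (at t within S)"
    using S by (intro f_chain[OF g]) auto
  then have 2: "((\<lambda>t. f (g t) - f z) has_vector_derivative scaleC g' (f1 (g t))) (at t within S)"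
    by (auto intro!: derivative_eq_intros)
  have eq: "scaleC (1 / (g t - z)) (scaleC g' (f1 (g t))) + scaleC (g' * (- 1 / (g t - z)\<^sup>2)) (f (g t) - f z) =
    scaleC g' (quot' z (g t))"
    by (simp add: quot'_def scaleC.diff_right scaleC_scaleC scaleC.minus_left mult.commute)
  have "((\<lambda>t. scaleC (1 / (g t - z)) (f (g t) - f z)) has_vector_derivative scaleC g' (quot' z (g t))) (at t within S)"
    using has_vector_derivative_scaleC[OF 1 2] unfolding eq .
  then show ?thesis
    by (rule has_vector_derivative_transform[rotated 2]) (use S nz in \<open>auto simp: quot_def\<close>)
qed

end

section \<open>Deformation of the inner curves to the outer ones\<close>

lemma pt_eqD:
  assumes "pt t y = z"
  shows "y = - ln (cmod z) / (2 * pi)"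
proof -
  have "cmod z = exp (- 2 * pi * y)" using assms norm_pt[of t y] by simp
  then show ?thesis by simp
qed

text \<open>Preimages of z differ by integers in t. This limits the columns, and through them the
  stages of the homotopy, at which a curve can meet z.\<close>

lemma finite_pt_fibre: "finite {t\<in>{0..1}. \<exists>y. pt t y = z}"
proof (cases "\<exists>t0 y0. pt t0 y0 = z")
  case True
  then obtain t0 y0 where z: "pt t0 y0 = z" by blast
  have "{t\<in>{0..1}. \<exists>y. pt t y = z} \<subseteq> (\<lambda>n::int. t0 + of_int n) ` {\<lceil>- t0\<rceil>..\<lfloor>1 - t0\<rfloor>}"
  proof
    fix t assume "t \<in> {t\<in>{0..1}. \<exists>y. pt t y = z}"
    then obtain y where t: "0 \<le> t" "t \<le> 1" and y: "pt t y = z" by auto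
    have "exp (2 * pi * \<i> * Complex t y) = exp (2 * pi * \<i> * Complex t0 y0)" using y z by (simp add: pt_def)
    then obtain n :: int where "2 * pi * \<i> * Complex t y = 2 * pi * \<i> * Complex t0 y0 + of_int (2 * n) * pi * \<i>"
      unfolding exp_eq by auto
    then have "Im (2 * pi * \<i> * Complex t y) = Im (2 * pi * \<i> * Complex t0 y0 + of_int (2 * n) * pi * \<i>)" by (rule arg_cong)
    then have "pi * t = pi * (t0 + of_int n)" by (simp add: algebra_simps)
    then have e: "t = t0 + of_int n" by simp
    then show "t \<in> (\<lambda>n::int. t0 + of_int n) ` {\<lceil>- t0\<rceil>..\<lfloor>1 - t0\<rfloor>}"
      using t by (auto simp: ceiling_le_iff le_floor_iff)
  qed
  then show ?thesis by (rule finite_subset) auto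
qed auto

context flat_contour
begin

lemma Z_norm:
  assumes "z \<in> Z" shows "exp (- pi * d) \<le> cmod z" "cmod z \<le> exp (pi * d)"
proof -
  obtain t y where z: "z = pt t y" "\<bar>y\<bar> \<le> d / 2" using Z_strip[OF assms] by blast
  have "pi * \<bar>2 * y\<bar> \<le> pi * d" using z(2) by (intro mult_left_mono) auto
  then have "\<bar>2 * pi * y\<bar> \<le> pi * d" by (simp add: abs_mult)
  then show "exp (- pi * d) \<le> cmod z" "cmod z \<le> exp (pi * d)"
    unfolding z(1) norm_pt by (auto simp: abs_le_iff)
qed

lemma Z_neq_far:
  assumes "z \<in> Z" "\<bar>y\<bar> \<ge> 3 / 4 * d"
  shows "pt t y \<noteq> z"
proof
  assume e: "pt t y = z"
  obtain t' y' where z: "z = pt t' y'" "\<bar>y'\<bar> \<le> d / 2" using Z_strip[OF assms(1)] by blast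
  have "y = y'" using pt_eqD[OF e] pt_eqD[OF z(1)[symmetric]] by simp
  then show False using z assms(2) d by simp
qed

text \<open>The curve at stage l has height u + l p. The l-derivative of the pulled-back form is the
  t-derivative of a periodic function, so the integral is locally constant except at finitely many l
  whose curve meets z; there it is continuous because \<open>quot\<close> is. As the height is
  affine in l, the mixed partial \<open>Qtl\<close> exists although u is only C^1.\<close>

lemma contour_homotopy:
  assumes z: "z \<in> Z" and s: "s = 1 \<or> s = -1"
  shows "((\<lambda>t. if u t \<le> d then
      scaleC (2 * pi * \<i> * pt t (s * v t) * Complex 1 (s * v' t)) (quot z (pt t (s * v t))) -
      scaleC (2 * pi * \<i> * pt t (s * u t) * Complex 1 (s * u' t)) (quot z (pt t (s * u t))) else 0)
    has_integral 0) {0..1}"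
proof -
  have zK: "z \<in> K" using z Z_sub by blast
  have s1: "\<bar>s\<bar> = 1" using s by auto
  have ss: "s * s = 1" using s by auto
  define Q where "Q l t = pt t (s * (u t + l * p t))" for l t
  define Qt where "Qt l t = 2 * pi * \<i> * Q l t * Complex 1 (s * (u' t + l * p' t))" for l t
  define Ql where "Ql l t = 2 * pi * \<i> * Q l t * Complex 0 (s * p t)" for l t
  define Qtl where "Qtl l t = 2 * pi * \<i> * Q l t * Complex 0 (s * p' t) + 2 * pi * \<i> * Ql l t * Complex 1 (s * (u' t + l * p' t))" for l t
  define V where "V l t = scaleC (Qt l t) (quot z (Q l t))" for l t
  \<comment> \<open>Subtracting \<open>V 0\<close> makes the integrand vanish where u t = d, so that
    it continues by 0.\<close>
  define G where "G l t = (if u t \<le> d then V l t - V 0 t else 0)" for l t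
  define D where "D l t = scaleC (Qt l t) (scaleC (Ql l t) (quot' z (Q l t))) + scaleC (Qtl l t) (quot z (Q l t))" for l t
  define DG where "DG l t = (if u t \<le> d then D l t else 0)" for l t
  have QK: "Q l t \<in> K" if "u t \<le> d" "0 \<le> l" "l \<le> 1" for l t
    unfolding Q_def using seg_mem[OF that s1] .
  have Qc: "continuous_on S (\<lambda>x. Q (g x) (h x))" if "continuous_on S g" "continuous_on S h" for S :: "'x::topological_space set" and g h
    unfolding Q_def using that by (intro continuous_intros)
  have Qtc: "continuous_on S (\<lambda>x. Qt (g x) (h x))" if "continuous_on S g" "continuous_on S h" for S :: "'x::topological_space set" and g h
    unfolding Qt_def Complex_eq using that by (intro continuous_intros Qc)
  have Qlc: "continuous_on S (\<lambda>x. Ql (g x) (h x))" if "continuous_on S g" "continuous_on S h" for S :: "'x::topological_space set" and g h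
    unfolding Ql_def Complex_eq using that by (intro continuous_intros Qc)
  have Qtlc: "continuous_on S (\<lambda>x. Qtl (g x) (h x))" if "continuous_on S g" "continuous_on S h" for S :: "'x::topological_space set" and g h
    unfolding Qtl_def Complex_eq using that by (intro continuous_intros Qc Qlc)
  have quotc: "continuous_on S (\<lambda>x. quot z (Q (g x) (h x)))"
    if "continuous_on S g" "continuous_on S h" "\<And>x. x \<in> S \<Longrightarrow> u (h x) \<le> d \<and> 0 \<le> g x \<and> g x \<le> 1" for S :: "'x::topological_space set" and g h
    by (rule continuous_on_compose2[OF quot_cont[OF zK] Qc]) (use that QK in auto)
  have zero: "V l t = V 0 t" "Ql l t = 0" "Qtl l t = 0" if "u t = d" for l t
    using p_zero[of t] that by (simp_all add: V_def Qt_def Q_def Ql_def Qtl_def complex_eq_iff)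
  have Gc: "continuous_on ({0..1} \<times> {0..1}) (\<lambda>(l, t). G l t)"
  proof -
    have "continuous_on ({0..1} \<times> {0..1}) (\<lambda>x. if u (snd x) \<le> d then V (fst x) (snd x) - V 0 (snd x) else 0)"
    proof (rule continuous_on_paste_zero)
      show "continuous_on {x \<in> {0..1} \<times> {0..1}. u (snd x) \<le> d} (\<lambda>x. V (fst x) (snd x) - V 0 (snd x))"
        unfolding V_def by (intro continuous_intros Qtc quotc) auto
      show "continuous_on ({0..1} \<times> {0..1}) (\<lambda>x. u (snd x))" by (intro continuous_intros)
      show "closed ({0..1} \<times> {0..1} :: (real \<times> real) set)" by (intro closed_Times closed_atLeastAtMost)
      show "V (fst x) (snd x) - V 0 (snd x) = 0" if "u (snd x) = d" for x using zero(1)[OF that] by simp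
    qed
    then show ?thesis by (simp add: G_def case_prod_unfold)
  qed
  define I where "I l = integral {0..1} (G l)" for l
  have Ic: "continuous_on {0..1} I"
    unfolding I_def using integral_continuous_on_param[of "{0..1}" "0::real" 1 G] Gc by simp
  \<comment> \<open>If stage l meets z in column t, its height is that of z, which determines l from
    t.\<close>
  define ex where "ex = (\<lambda>t. (s * (- ln (cmod z) / (2 * pi)) - u t) / p t) ` {t\<in>{0..1}. \<exists>y. pt t y = z}"
  have fin: "finite (ex \<union> {0, 1})" unfolding ex_def using finite_pt_fibre by simp
  have Qnz: "Q l t \<noteq> z" if "l \<notin> ex" "t \<in> {0..1}" "u t \<le> d" "0 \<le> l" "l \<le> 1" for l t
  proof
    assume e: "Q l t = z"
    have y: "s * (u t + l * p t) = - ln (cmod z) / (2 * pi)" using pt_eqD e unfolding Q_def by blast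
    have "p t \<noteq> 0"
    proof
      assume "p t = 0"
      then have "u t = d" using p_pos_iff[of t] that(3) by simp
      then have "3 / 4 * d \<le> \<bar>s * (u t + l * p t)\<bar>" using \<open>p t = 0\<close> s1 d by (simp add: abs_mult)
      then show False using Z_neq_far[OF z] e unfolding Q_def by blast
    qed
    moreover have "s * (- ln (cmod z) / (2 * pi)) - u t = l * p t"
      unfolding y[symmetric] using ss by (simp flip: mult.assoc)
    ultimately have "l = (s * (- ln (cmod z) / (2 * pi)) - u t) / p t" by simp
    moreover have "t \<in> {t\<in>{0..1}. \<exists>y. pt t y = z}" using e that(2) unfolding Q_def by blast
    ultimately show False using that(1) unfolding ex_def by blast
  qed
  have Q_dl: "((\<lambda>l. Q l t) has_vector_derivative Ql l t) (at l within S)" for l t S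
  proof -
    have "((\<lambda>l. s * (u t + l * p t)) has_real_derivative s * p t) (at l within S)"
      by (auto intro!: derivative_eq_intros)
    then show ?thesis unfolding Q_def Ql_def by (intro pt_has_vector_derivative) auto
  qed
  have Qt_dl: "((\<lambda>l. Qt l t) has_vector_derivative Qtl l t) (at l within S)" for l t S
  proof -
    have 1: "((\<lambda>l. 2 * pi * \<i> * Q l t) has_vector_derivative 2 * pi * \<i> * Ql l t) (at l within S)"
      by (rule has_vector_derivative_mult_right[OF Q_dl])
    have 2: "((\<lambda>l. Complex 1 (s * (u' t + l * p' t))) has_vector_derivative Complex 0 (s * p' t)) (at l within S)"
      unfolding Complex_eq by (auto intro!: derivative_eq_intros)
    show ?thesis unfolding Qt_def Qtl_def by (rule has_vector_derivative_mult[OF 1 2])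
  qed
  have Q_dt: "((\<lambda>t. Q l t) has_vector_derivative Qt l t) (at t within S)" for l t S
  proof -
    have "((\<lambda>t. s * (u t + l * p t)) has_real_derivative s * (u' t + l * p' t)) (at t within S)"
      by (intro DERIV_cmult DERIV_add has_field_derivative_at_within[OF u_deriv] has_field_derivative_at_within[OF p_deriv])
    then show ?thesis unfolding Q_def Qt_def by (intro pt_has_vector_derivative DERIV_ident)
  qed
  have Ql_dt: "((\<lambda>t. Ql l t) has_vector_derivative Qtl l t) (at t within S)" for l t S
  proof -
    have 1: "((\<lambda>t. 2 * pi * \<i> * Q l t) has_vector_derivative 2 * pi * \<i> * Qt l t) (at t within S)"
      by (rule has_vector_derivative_mult_right[OF Q_dt])
    have 2: "((\<lambda>t. Complex 0 (s * p t)) has_vector_derivative Complex 0 (s * p' t)) (at t within S)"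
      unfolding Complex_eq
      by (auto intro!: derivative_eq_intros has_field_derivative_at_within[OF p_deriv])
    have e: "2 * pi * \<i> * Q l t * Complex 0 (s * p' t) + 2 * pi * \<i> * Qt l t * Complex 0 (s * p t) = Qtl l t"
      unfolding Qtl_def Qt_def Ql_def by (simp only: mult_ac)
    show ?thesis using has_vector_derivative_mult[OF 1 2] unfolding Ql_def[symmetric] e .
  qed
  have DG0: "integral {0..1} (DG l) = 0" if l: "l \<in> {0<..<1} - ex" for l
  proof -
    \<comment> \<open>The form contracted with the l-direction. By symmetry of the mixed partials
      its t-derivative is the l-derivative of \<open>V\<close>.\<close>
    define \<Phi> where "\<Phi> t = (if u t \<le> d then scaleC (Ql l t) (quot z (Q l t)) else 0)" for t
    have "continuous_on {0..1} \<Phi>" unfolding \<Phi>_def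
    proof (rule continuous_on_paste_zero)
      show "continuous_on {x \<in> {0..1}. u x \<le> d} (\<lambda>t. scaleC (Ql l t) (quot z (Q l t)))"
        using l by (intro continuous_intros Qlc quotc) auto
      show "continuous_on {0..1} u" using u_cont[OF continuous_on_id] by simp
    qed (use zero in auto)
    moreover have "(\<Phi> has_vector_derivative DG l t) (at t)" if t: "t \<in> {0<..<1}" for t
    proof -
      consider "u t < d" | "u t > d" | "u t = d" by linarith
      then show ?thesis
      proof cases
        case 1
        define S where "S = {0<..<1} \<inter> {t. u t < d}"
        have S: "open S" unfolding S_def
          by (intro open_Int open_Collect_less continuous_intros open_greaterThanLessThan)
        have tS: "t \<in> S" using t 1 by (simp add: S_def)
        have "((\<lambda>t. quot z (Q l t)) has_vector_derivative scaleC (Qt l t) (quot' z (Q l t))) (at t within S)"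
        proof (rule quot_chain[OF Q_dt _ tS])
          show "(\<lambda>t. Q l t) ` S \<subseteq> K - {z}"
          proof
            fix w assume "w \<in> (\<lambda>t. Q l t) ` S"
            then obtain x where x: "w = Q l x" "x \<in> {0<..<1}" "u x < d" by (auto simp: S_def)
            then show "w \<in> K - {z}" using QK[of x l] Qnz[of l x] l by auto
          qed
        qed
        then have "((\<lambda>t. scaleC (Ql l t) (quot z (Q l t))) has_vector_derivative
            scaleC (Ql l t) (scaleC (Qt l t) (quot' z (Q l t))) + scaleC (Qtl l t) (quot z (Q l t))) (at t within S)"
          by (rule has_vector_derivative_scaleC[OF Ql_dt])
        then have "((\<lambda>t. scaleC (Ql l t) (quot z (Q l t))) has_vector_derivative DG l t) (at t)"
          using 1 at_within_open[OF tS S] by (simp add: DG_def D_def scaleC_scaleC mult.commute)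
        then show ?thesis
          by (rule has_vector_derivative_transform_within_open[OF _ S tS]) (auto simp: \<Phi>_def S_def)
      next
        case 2
        have S: "open {t. d < u t}" by (intro open_Collect_less continuous_intros)
        have "((\<lambda>_. 0) has_vector_derivative DG l t) (at t)" using 2 by (simp add: DG_def)
        then show ?thesis
          by (rule has_vector_derivative_transform_within_open[OF _ S]) (use 2 in \<open>auto simp: \<Phi>_def\<close>)
      next
        case 3
        \<comment> \<open>Where u t = d the two branches of \<Phi> meet; there \<Phi> is p times a
          factor that compactness bounds, so its derivative is 0.\<close>
        have "compact {x \<in> {0..1}. u x \<le> d}"
        proof -
          have "closed ({0..1} \<inter> {x. u x \<le> d})" by (intro closed_Int closed_Collect_le continuous_intros closed_atLeastAtMost)
          moreover have "{x \<in> {0..1}. u x \<le> d} = {0..1} \<inter> {x. u x \<le> d}" by auto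
          ultimately show ?thesis by (metis bounded_closed_interval bounded_Int compact_eq_bounded_closed)
        qed
        moreover have "continuous_on {x \<in> {0..1}. u x \<le> d} (\<lambda>t. scaleC (2 * pi * \<i> * Q l t) (quot z (Q l t)))"
          using l by (intro continuous_intros Qc quotc) auto
        ultimately have "bounded ((\<lambda>t. scaleC (2 * pi * \<i> * Q l t) (quot z (Q l t))) ` {x \<in> {0..1}. u x \<le> d})"
          by (intro compact_imp_bounded compact_continuous_image)
        then obtain B where B: "\<And>t. t \<in> {0..1} \<Longrightarrow> u t \<le> d \<Longrightarrow> norm (scaleC (2 * pi * \<i> * Q l t) (quot z (Q l t))) \<le> B"
          unfolding bounded_iff by blast
        have B0: "B \<ge> 0" by (rule order_trans[OF norm_ge_zero B[of t]]) (use t 3 in auto)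
        have le: "norm (\<Phi> x) \<le> B * \<bar>p x\<bar>" if "x \<in> {0<..<1}" for x
        proof (cases "u x \<le> d")
          case True
          have "\<Phi> x = scaleC (Complex 0 (s * p x)) (scaleC (2 * pi * \<i> * Q l x) (quot z (Q l x)))"
            using True by (simp add: \<Phi>_def Ql_def scaleC_scaleC mult_ac)
          moreover have "cmod (Complex 0 (s * p x)) = \<bar>p x\<bar>" using s1 by (simp add: cmod_def abs_mult)
          ultimately have "norm (\<Phi> x) = \<bar>p x\<bar> * norm (scaleC (2 * pi * \<i> * Q l x) (quot z (Q l x)))"
            by (simp only: norm_scaleC)
          also have "\<dots> \<le> \<bar>p x\<bar> * B" using B[of x] that True by (intro mult_left_mono) auto
          finally show ?thesis by (simp add: mult.commute)
        qed (use B0 in \<open>simp add: \<Phi>_def\<close>)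
        have "eventually (\<lambda>x. x \<in> {0<..<1}) (at t)" using t by (intro eventually_at_in_open') auto
        then have ev: "eventually (\<lambda>x. norm (\<Phi> x) \<le> B * \<bar>p x\<bar>) (at t)" by (rule eventually_mono) (rule le)
        have pz: "(p has_real_derivative 0) (at t)" "p t = 0" using p_deriv[of t] p_zero[of t] 3 by auto
        have "\<Phi> t = 0" "DG l t = 0" using zero 3 by (auto simp: \<Phi>_def DG_def D_def)
        then show ?thesis using has_vector_derivative_zero_if_le[OF pz _ ev] by simp
      qed
    qed
    ultimately have "(DG l has_integral \<Phi> 1 - \<Phi> 0) {0..1}"
      by (intro fundamental_theorem_of_calculus_interior) auto
    moreover have "\<Phi> 1 = \<Phi> 0"
      using u_per[of 0] p_per[of 0] pt_add_1[of 0] by (simp add: \<Phi>_def Ql_def Q_def)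
    ultimately show ?thesis by (simp add: integral_unique)
  qed
  have Ider: "(I has_derivative (\<lambda>_. 0)) (at l within {0..1})" if l: "l \<in> {0..1} - (ex \<union> {0, 1})" for l
  proof -
    have "open ({0<..<1} - ex)" using fin by (intro open_Diff finite_imp_closed) auto
    moreover have l': "l \<in> {0<..<1} - ex" using l by auto
    ultimately obtain e where e: "e > 0" "cball l e \<subseteq> {0<..<1} - ex" unfolding open_contains_cball by blast
    have U: "x \<in> {0<..<1} - ex" if "x \<in> cball l e" for x using e that by blast
    have der: "((\<lambda>l. G l t) has_vector_derivative DG l t) (at l within cball l0 e)"
      if lm: "l \<in> cball l0 e" and tm: "t \<in> cbox 0 1" and sub: "cball l0 e \<subseteq> {0<..<1} - ex" for l l0 t
    proof (cases "u t \<le> d")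
      case True
      have "(\<lambda>l. Q l t) ` cball l0 e \<subseteq> K - {z}"
      proof
        fix w assume "w \<in> (\<lambda>l. Q l t) ` cball l0 e"
        then obtain l1 where l1: "w = Q l1 t" "l1 \<in> {0<..<1} - ex" using sub by blast
        then show "w \<in> K - {z}" using QK[OF True, of l1] Qnz[of l1 t] tm True by auto
      qed
      then have "((\<lambda>l. quot z (Q l t)) has_vector_derivative scaleC (Ql l t) (quot' z (Q l t))) (at l within cball l0 e)"
        by (rule quot_chain[OF Q_dl _ lm])
      then have "((\<lambda>l. V l t) has_vector_derivative D l t) (at l within cball l0 e)"
        unfolding V_def D_def by (rule has_vector_derivative_scaleC[OF Qt_dl])
      then have "((\<lambda>l. V l t - V 0 t) has_vector_derivative D l t) (at l within cball l0 e)"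
        by (auto intro!: derivative_eq_intros)
      then show ?thesis using True by (simp add: G_def DG_def)
    qed (simp add: G_def DG_def)
    have DGc: "continuous_on (cball l e \<times> {0..1}) (\<lambda>(l, t). DG l t)"
    proof -
      have "continuous_on (cball l e \<times> {0..1}) (\<lambda>x. if u (snd x) \<le> d then D (fst x) (snd x) else 0)"
      proof (rule continuous_on_paste_zero)
        have sub: "0 \<le> fst x" "fst x \<le> 1" "fst x \<notin> ex" if "x \<in> cball l e \<times> {0..1}" for x :: "real \<times> real"
          using U[of "fst x"] that by auto
        have "continuous_on {x \<in> cball l e \<times> {0..1}. u (snd x) \<le> d} (\<lambda>x. quot' z (Q (fst x) (snd x)))"
        proof (rule continuous_on_compose2[OF quot'_cont Qc])
          show "(\<lambda>x. Q (fst x) (snd x)) ` {x \<in> cball l e \<times> {0..1}. u (snd x) \<le> d} \<subseteq> K - {z}"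
          proof
            fix w assume "w \<in> (\<lambda>x. Q (fst x) (snd x)) ` {x \<in> cball l e \<times> {0..1}. u (snd x) \<le> d}"
            then obtain x where x: "w = Q (fst x) (snd x)" "x \<in> cball l e \<times> {0..1}" "u (snd x) \<le> d" by blast
            then have "snd x \<in> {0..1}" by auto
            then show "w \<in> K - {z}" using QK[OF x(3) sub(1,2)] Qnz[OF sub(3) _ x(3) sub(1,2)] x by blast
          qed
        qed (intro continuous_on_fst continuous_on_snd continuous_on_id)+
        then show "continuous_on {x \<in> cball l e \<times> {0..1}. u (snd x) \<le> d} (\<lambda>x. D (fst x) (snd x))"
          unfolding D_def using sub by (intro continuous_intros Qtc Qlc Qtlc quotc) auto
        show "continuous_on (cball l e \<times> {0..1}) (\<lambda>x. u (snd x))" by (intro continuous_intros)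
        show "closed (cball l e \<times> {0..1::real})" by (intro closed_Times closed_cball closed_atLeastAtMost)
        show "D (fst x) (snd x) = 0" if "u (snd x) = d" for x using zero(2,3)[OF that] by (simp add: D_def)
      qed
      then show ?thesis by (simp add: DG_def case_prod_unfold)
    qed
    have "((\<lambda>l. integral (cbox 0 1) (G l)) has_vector_derivative integral (cbox 0 1) (DG l)) (at l within cball l e)"
    proof (rule leibniz_rule_vector_derivative)
      show "((\<lambda>l. G l t) has_vector_derivative DG x t) (at x within cball l e)" if "x \<in> cball l e" "t \<in> cbox 0 1" for x t
        using der[OF that e(2)] .
      show "G x integrable_on cbox 0 1" if "x \<in> cball l e" for x
      proof -
        have "continuous_on {0..1} (\<lambda>t. case (x, t) of (l, t) \<Rightarrow> G l t)"
          by (rule continuous_on_compose2[OF Gc continuous_on_Pair[OF continuous_on_const continuous_on_id]]) (use U[OF that] in auto)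
        then show ?thesis by (simp add: integrable_continuous_interval)
      qed
    qed (use DGc e in auto)
    moreover have "(\<lambda>l. integral (cbox 0 1) (G l)) = I" by (intro ext) (simp add: I_def)
    ultimately have "(I has_vector_derivative 0) (at l within cball l e)" using DG0[OF l'] by simp
    then have "(I has_vector_derivative 0) (at l within ball l e)"
      by (rule has_vector_derivative_within_subset) auto
    then have "(I has_vector_derivative 0) (at l)" using e by (simp add: at_within_open[of l "ball l e"])
    then show ?thesis using has_derivative_at_withinI by (fastforce simp: has_vector_derivative_def)
  qed
  have "G 0 = (\<lambda>t. 0)" by (intro ext) (simp add: G_def)
  then have "I 0 = 0" by (simp add: I_def)
  then have "I 1 = 0"
    by (rule has_derivative_zero_unique_strong_interval[OF fin Ic _ Ider]) auto
  moreover have "G 1 integrable_on {0..1}"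
  proof -
    have "continuous_on {0..1} (\<lambda>t. case (1, t) of (l, t) \<Rightarrow> G l t)"
      by (rule continuous_on_compose2[OF Gc continuous_on_Pair[OF continuous_on_const continuous_on_id]]) auto
    then show ?thesis by (simp add: integrable_continuous_interval)
  qed
  ultimately have "(G 1 has_integral 0) {0..1}" unfolding I_def by (metis integrable_integral)
  then show ?thesis
    by (rule has_integral_eq[rotated]) (simp add: G_def V_def Qt_def Q_def v_def v'_def)
qed

end

section \<open>The integral of the Cauchy kernel over the contour\<close>

lemma Ln_has_vector_derivative:
  assumes "(g has_vector_derivative g') (at t)" "g t \<notin> \<real>\<^sub>\<le>\<^sub>0"
  shows "((\<lambda>t. Ln (g t)) has_vector_derivative g' / g t) (at t)"
  using field_vector_diff_chain_at[OF assms(1) has_field_derivative_Ln[OF assms(2)]]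
  by (simp add: o_def divide_inverse)

lemma exp_diff_exp_minus_le:
  fixes x :: real
  assumes "0 \<le> x"
  shows "exp x - exp (- x) \<le> 2 * x * exp x"
proof -
  have "exp x * (1 - exp (- 2 * x)) \<le> exp x * (2 * x)"
    using exp_ge_add_one_self[of "- 2 * x"] by (intro mult_left_mono) auto
  then show ?thesis by (simp add: algebra_simps flip: exp_add)
qed

lemma pt_split: "pt t y = of_real (exp (- 2 * pi * y)) * pt t 0"
proof -
  have "2 * pi * \<i> * Complex t y = of_real (- 2 * pi * y) + 2 * pi * \<i> * Complex t 0"
    by (simp add: complex_eq_iff)
  then show ?thesis by (simp only: pt_def exp_add exp_of_real)
qed

lemma norm_pt_minus:
  assumes "0 \<le> y"
  shows "cmod (pt t y - pt t (- y)) \<le> 4 * pi * exp (2 * pi * y) * y"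
proof -
  have "pt t y - pt t (- y) = of_real (exp (- (2 * pi * y)) - exp (2 * pi * y)) * pt t 0"
    using pt_split[of t y] pt_split[of t "- y"] by (simp add: algebra_simps)
  then have "cmod (pt t y - pt t (- y)) = \<bar>exp (- (2 * pi * y)) - exp (2 * pi * y)\<bar>"
    by (simp only: norm_mult norm_of_real norm_pt) simp
  also have "\<dots> = exp (2 * pi * y) - exp (- (2 * pi * y))" using assms by simp
  also have "\<dots> \<le> 2 * (2 * pi * y) * exp (2 * pi * y)" using assms by (intro exp_diff_exp_minus_le) auto
  finally show ?thesis by (simp add: mult_ac)
qed

context flat_contour
begin

definition dpt :: "real \<Rightarrow> real \<Rightarrow> real \<Rightarrow> complex" where
  "dpt t y y' = 2 * pi * \<i> * pt t y * Complex 1 y'"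

lemma pt_curve:
  "(y has_real_derivative y') (at t within S) \<Longrightarrow> ((\<lambda>t. pt t (y t)) has_vector_derivative dpt t (y t) y') (at t within S)"
  unfolding dpt_def by (rule pt_has_vector_derivative[OF DERIV_ident])

text \<open>The form dw / (w - z) on all four curves, oriented so that its integral is 2 \<pi> i.
  Where u t = 0 the two inner curves touch to first order and cancel; since z may be the point of
  contact, their contribution is set to 0.\<close>

definition kernel :: "complex \<Rightarrow> real \<Rightarrow> complex" where
  "kernel z t = dpt t (- v t) (- v' t) / (pt t (- v t) - z) - dpt t (v t) (v' t) / (pt t (v t) - z) +
     (if u t = 0 then 0 else dpt t (u t) (u' t) / (pt t (u t) - z) - dpt t (- u t) (- u' t) / (pt t (- u t) - z))"

text \<open>At a coincidence, flatness of order 1 would force u t \<le> 0.\<close>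

lemma seg_avoid:
  assumes "z \<in> Z" "u t \<noteq> 0" "\<bar>y\<bar> \<le> u t"
  shows "pt t y \<noteq> z"
proof
  assume e: "pt t y = z"
  obtain M where "u t + \<bar>u' t\<bar> \<le> M * cmod (pt t y - z) ^ 1" using flat[of 1] assms by blast
  then have "u t + \<bar>u' t\<bar> \<le> 0" using e by simp
  then show False using assms(2) u_nonneg[of t] by simp
qed

lemma u_bound:
  obtains U where "U \<ge> 0" "\<And>t. t \<in> {0..1} \<Longrightarrow> u t \<le> U \<and> \<bar>u' t\<bar> \<le> U"
proof -
  have "continuous_on {0..1} (\<lambda>t. u t + \<bar>u' t\<bar>)" by (intro continuous_intros)
  then have "bounded ((\<lambda>t. u t + \<bar>u' t\<bar>) ` {0..1})"
    by (intro compact_imp_bounded compact_continuous_image) auto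
  then obtain B where B: "\<And>t. t \<in> {0..1} \<Longrightarrow> norm (u t + \<bar>u' t\<bar>) \<le> B" unfolding bounded_iff by blast
  show ?thesis
  proof (rule that[of B])
    show "B \<ge> 0" using B[of 0] norm_ge_zero[of "u 0 + \<bar>u' 0\<bar>"] by simp
    show "u t \<le> B \<and> \<bar>u' t\<bar> \<le> B" if "t \<in> {0..1}" for t using B[OF that] u_nonneg[of t] by auto
  qed
qed

lemma pt_pm_close:
  obtains C where "C \<ge> 0" "\<And>t. t \<in> {0..1} \<Longrightarrow> cmod (pt t (u t) - pt t (- u t)) \<le> C * u t"
proof -
  obtain U where U: "U \<ge> 0" "\<And>t. t \<in> {0..1} \<Longrightarrow> u t \<le> U \<and> \<bar>u' t\<bar> \<le> U" using u_bound by blast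
  show ?thesis
  proof (rule that[of "4 * pi * exp (2 * pi * U)"])
    fix t :: real assume t: "t \<in> {0..1}"
    have "cmod (pt t (u t) - pt t (- u t)) \<le> 4 * pi * exp (2 * pi * u t) * u t" by (rule norm_pt_minus[OF u_nonneg])
    also have "\<dots> \<le> 4 * pi * exp (2 * pi * U) * u t"
      using U(2)[OF t] u_nonneg[of t] by (intro mult_right_mono mult_left_mono) auto
    finally show "cmod (pt t (u t) - pt t (- u t)) \<le> 4 * pi * exp (2 * pi * U) * u t" .
  qed simp
qed

text \<open>A nonpositive ratio would put z on the segment between the two points. They differ only
  in modulus, so this segment consists of points \<open>pt t y\<close> with |y| \<le> u t, which
  \<open>seg_avoid\<close> excludes if u t \<noteq> 0; if u t = 0 the ratio is 1.\<close>

lemma ratio_not_nonpos: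
  assumes z: "z \<in> Z" and nz: "pt t (- u t) \<noteq> z" "pt t (u t) \<noteq> z"
  shows "(pt t (u t) - z) / (pt t (- u t) - z) \<notin> \<real>\<^sub>\<le>\<^sub>0"
proof (cases "u t = 0")
  case True
  then show ?thesis using nz by (simp add: complex_nonpos_Reals_iff)
next
  case False
  show ?thesis
  proof
    assume "(pt t (u t) - z) / (pt t (- u t) - z) \<in> \<real>\<^sub>\<le>\<^sub>0"
    then obtain r where r: "(pt t (u t) - z) / (pt t (- u t) - z) = of_real r" "r \<le> 0"
      by (rule nonpos_Reals_cases)
    define \<rho> where "\<rho> = - r"
    have \<rho>: "\<rho> \<ge> 0" using r by (simp add: \<rho>_def)
    have "pt t (u t) - z = - of_real \<rho> * (pt t (- u t) - z)" using r(1) nz by (simp add: \<rho>_def field_simps)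
    then have e: "z * of_real (1 + \<rho>) = pt t (u t) + of_real \<rho> * pt t (- u t)" by (simp add: algebra_simps)
    define a b where "a = exp (- (2 * pi * u t))" and "b = exp (2 * pi * u t)"
    have ab: "0 < a" "a \<le> b" using u_nonneg[of t] by (auto simp: a_def b_def)
    \<comment> \<open>The modulus of z, as the convex combination of the moduli of the end points
      with weights 1 and \<rho>.\<close>
    define c where "c = (a + \<rho> * b) / (1 + \<rho>)"
    have "a * (1 + \<rho>) \<le> a + \<rho> * b" "a + \<rho> * b \<le> b * (1 + \<rho>)"
      using ab \<rho> by (simp_all add: algebra_simps mult_left_mono)
    then have c: "a \<le> c" "c \<le> b" using \<rho> by (simp_all add: c_def pos_le_divide_eq pos_divide_le_eq)
    have c0: "c > 0" using c ab by linarith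
    define y where "y = - ln c / (2 * pi)"
    have "pt t (u t) = of_real a * pt t 0" "pt t (- u t) = of_real b * pt t 0"
      using pt_split[of t "u t"] pt_split[of t "- u t"] by (simp_all add: a_def b_def)
    then have "z * of_real (1 + \<rho>) = of_real (a + \<rho> * b) * pt t 0" using e by (simp add: algebra_simps)
    moreover have "a + \<rho> * b = c * (1 + \<rho>)" using \<rho> by (simp add: c_def)
    ultimately have "z * of_real (1 + \<rho>) = (of_real c * pt t 0) * of_real (1 + \<rho>)" by (simp add: algebra_simps)
    moreover have "of_real (1 + \<rho>) \<noteq> (0::complex)" using \<rho> by (simp only: of_real_eq_0_iff)
    ultimately have zc: "z = of_real c * pt t 0" by (metis mult_right_cancel)
    have "exp (- 2 * pi * y) = c" using c0 by (simp add: y_def)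
    then have "pt t y = z" using pt_split[of t y] zc by simp
    moreover have "\<bar>y\<bar> \<le> u t"
    proof -
      have "ln a \<le> ln c" "ln c \<le> ln b" using c c0 ab by simp_all
      then have "\<bar>ln c\<bar> \<le> 2 * pi * u t" by (simp add: a_def b_def abs_le_iff)
      then show ?thesis by (simp add: y_def abs_divide pos_divide_le_eq mult_ac)
    qed
    ultimately show False using seg_avoid[OF z False] by blast
  qed
qed

lemma v_strip:
  assumes "z \<in> Z"
  shows "cmod z < cmod (pt t (- v t))" "cmod (pt t (v t)) < cmod z"
proof -
  have "pi * d < 2 * pi * (3 / 4 * d)" using d by simp
  also have "\<dots> \<le> 2 * pi * v t" using v_ge[of t] by (intro mult_left_mono) auto
  finally have "exp (pi * d) < exp (- 2 * pi * (- v t))" "exp (- 2 * pi * v t) < exp (- pi * d)" by simp_all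
  then show "cmod z < cmod (pt t (- v t))" "cmod (pt t (v t)) < cmod z"
    using Z_norm[OF assms] unfolding norm_pt by linarith+
qed

lemma v_per: "v 1 = v 0"
  using u_per[of 0] p_per(1)[of 0] by (simp add: v_def)

lemma pt_per: "pt 1 y = pt 0 y"
  using pt_add_1[of 0 y] by simp

lemma Re_one_minus_pos: "cmod w < 1 \<Longrightarrow> 1 - w \<notin> \<real>\<^sub>\<le>\<^sub>0"
  using complex_Re_le_cmod[of w] by (auto simp: complex_nonpos_Reals_iff)

text \<open>On this curve |w| < |z|, so 1 - w/z has positive real part and its principal logarithm
  is a periodic primitive.\<close>

lemma kernel_upper: 
  assumes z: "z \<in> Z"
  shows "((\<lambda>t. dpt t (v t) (v' t) / (pt t (v t) - z)) has_integral 0) {0..1}"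
proof -
  have z0: "z \<noteq> 0" using v_strip(2)[OF z, of 0] by auto
  define L where "L t = Ln (1 - pt t (v t) / z)" for t
  have "(L has_vector_derivative dpt t (v t) (v' t) / (pt t (v t) - z)) (at t)" for t
  proof -
    have 1: "((\<lambda>t. 1 - pt t (v t) / z) has_vector_derivative - dpt t (v t) (v' t) / z) (at t)"
      using pt_curve[OF v_deriv[of t]] by (auto intro!: derivative_eq_intros)
    have "cmod (pt t (v t) / z) < 1" using v_strip(2)[OF z, of t] z0 by (simp add: norm_divide)
    from Ln_has_vector_derivative[OF 1 Re_one_minus_pos[OF this]]
    have "(L has_vector_derivative (- dpt t (v t) (v' t) / z) / (1 - pt t (v t) / z)) (at t)" by (simp add: L_def[abs_def])
    moreover have "(- dpt t (v t) (v' t) / z) / (1 - pt t (v t) / z) = dpt t (v t) (v' t) / (pt t (v t) - z)"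
    proof -
      have "1 - pt t (v t) / z = (z - pt t (v t)) / z" using z0 by (simp add: field_simps)
      then have "(- dpt t (v t) (v' t) / z) / (1 - pt t (v t) / z) = - dpt t (v t) (v' t) / (z - pt t (v t))"
        using z0 by simp
      also have "\<dots> = dpt t (v t) (v' t) / - (z - pt t (v t))" by (metis minus_divide_left minus_divide_right)
      finally show ?thesis by simp
    qed
    ultimately show ?thesis by simp
  qed
  then have "((\<lambda>t. dpt t (v t) (v' t) / (pt t (v t) - z)) has_integral L 1 - L 0) {0..1}"
    by (intro fundamental_theorem_of_calculus) (auto intro: has_vector_derivative_at_within)
  then show ?thesis by (simp add: L_def v_per pt_per)
qed

text \<open>On this curve |w| > |z|, so a primitive splits into the periodic Ln (1 - z/w) and the
  logarithm 2 \<pi> i x of w, whose increment is 2 \<pi> i.\<close>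

lemma kernel_lower: 
  assumes z: "z \<in> Z"
  shows "((\<lambda>t. dpt t (- v t) (- v' t) / (pt t (- v t) - z)) has_integral 2 * pi * \<i>) {0..1}"
proof -
  define L where "L t = Ln (1 - z / pt t (- v t)) + 2 * pi * \<i> * Complex t (- v t)" for t
  have "(L has_vector_derivative dpt t (- v t) (- v' t) / (pt t (- v t) - z)) (at t)" for t
  proof -
    define Q D where "Q = pt t (- v t)" and "D = dpt t (- v t) (- v' t)"
    have Q: "Q \<noteq> 0" "Q - z \<noteq> 0" "cmod (z / Q) < 1"
      using v_strip(1)[OF z, of t] by (auto simp: Q_def norm_divide)
    have mv: "((\<lambda>t. - v t) has_real_derivative - v' t) (at t)" by (intro DERIV_minus v_deriv)
    have c: "((\<lambda>t. pt t (- v t)) has_vector_derivative D) (at t)"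
      using pt_curve[OF mv] by (simp add: D_def)
    have "((\<lambda>w. 1 - z / w) has_field_derivative z / Q\<^sup>2) (at Q)"
      using Q by (auto intro!: derivative_eq_intros simp: power2_eq_square)
    from field_vector_diff_chain_at[OF c this[unfolded Q_def]]
    have 1: "((\<lambda>t. 1 - z / pt t (- v t)) has_vector_derivative D * (z / Q\<^sup>2)) (at t)" by (simp add: o_def Q_def)
    have 2: "((\<lambda>t. Ln (1 - z / pt t (- v t))) has_vector_derivative D * (z / Q\<^sup>2) / (1 - z / Q)) (at t)"
      using Ln_has_vector_derivative[OF 1] Re_one_minus_pos[OF Q(3)] by (simp add: Q_def)
    have 3: "((\<lambda>t. 2 * pi * \<i> * Complex t (- v t)) has_vector_derivative D / Q) (at t)"
    proof -
      have "((\<lambda>t. Complex t (- v t)) has_vector_derivative Complex 1 (- v' t)) (at t)"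
        unfolding Complex_eq using v_deriv[of t] by (auto intro!: derivative_eq_intros simp: has_real_derivative_iff_has_vector_derivative)
      moreover have "D / Q = 2 * pi * \<i> * Complex 1 (- v' t)" using Q by (simp add: D_def dpt_def Q_def)
      ultimately show ?thesis by (simp only: has_vector_derivative_mult_right)
    qed
    have "D * (z / Q\<^sup>2) / (1 - z / Q) + D / Q = D / (Q - z)"
    proof -
      have "1 - z / Q = (Q - z) / Q" using Q by (simp add: field_simps)
      then have "D * (z / Q\<^sup>2) / (1 - z / Q) + D / Q = D * z / (Q * (Q - z)) + D / Q"
        using Q by (simp add: power2_eq_square)
      also have "\<dots> = D / (Q - z)" using Q by (simp add: field_simps)
      finally show ?thesis .
    qed
    then show ?thesis using has_vector_derivative_add[OF 2 3] by (simp add: L_def[abs_def] Q_def D_def)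
  qed
  then have "((\<lambda>t. dpt t (- v t) (- v' t) / (pt t (- v t) - z)) has_integral L 1 - L 0) {0..1}"
    by (intro fundamental_theorem_of_calculus) (auto intro: has_vector_derivative_at_within)
  moreover have "L 1 - L 0 = 2 * pi * \<i>" by (simp add: L_def v_per pt_per complex_eq_iff)
  ultimately show ?thesis by simp
qed

text \<open>The logarithm of the ratio in \<open>ratio_not_nonpos\<close> is a periodic primitive of
  the difference of the two forms. At a column where the curves touch z, flatness of order 2 makes
  the ratio tend to 1, so the primitive extends continuously by 0.\<close>

lemma kernel_inner:
  assumes z: "z \<in> Z"
  shows "((\<lambda>t. if u t = 0 then 0 else dpt t (u t) (u' t) / (pt t (u t) - z) - dpt t (- u t) (- u' t) / (pt t (- u t) - z))
    has_integral 0) {0..1}"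
proof -
  define k where "k t = (if u t = 0 then 0 else dpt t (u t) (u' t) / (pt t (u t) - z) - dpt t (- u t) (- u' t) / (pt t (- u t) - z))" for t
  define r where "r t = (pt t (u t) - z) / (pt t (- u t) - z)" for t
  define L where "L t = (if u t = 0 then 0 else Ln (r t))" for t
  define N where "N = {t. pt t (u t) \<noteq> z \<and> pt t (- u t) \<noteq> z}"
  have pc: "continuous_on UNIV (\<lambda>t. pt t (u t))" "continuous_on UNIV (\<lambda>t. pt t (- u t))"
    by (intro continuous_intros)+
  have oN: "open N"
  proof -
    have "N = {t. pt t (u t) \<noteq> z} \<inter> {t. pt t (- u t) \<noteq> z}" by (auto simp: N_def)
    then show ?thesis using pc by (simp add: open_Int open_Collect_neq)
  qed
  have LN: "L t = Ln (r t)" if "t \<in> N" for t using that by (cases "u t = 0") (simp_all add: L_def N_def r_def)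
  have Lder: "(L has_vector_derivative k t) (at t)" if t: "t \<in> N" for t
  proof -
    define A B A' B' where "A = pt t (u t) - z" and "B = pt t (- u t) - z"
      and "A' = dpt t (u t) (u' t)" and "B' = dpt t (- u t) (- u' t)"
    have nz: "A \<noteq> 0" "B \<noteq> 0" using t by (auto simp: N_def A_def B_def)
    have mu: "((\<lambda>t. - u t) has_real_derivative - u' t) (at t)" by (intro DERIV_minus u_deriv)
    have 1: "((\<lambda>t. pt t (u t) - z) has_vector_derivative A') (at t)"
      using pt_curve[OF u_deriv[of t]] unfolding A'_def by (auto intro!: derivative_eq_intros)
    have 2: "((\<lambda>t. pt t (- u t) - z) has_vector_derivative B') (at t)"
      using pt_curve[OF mu] unfolding B'_def by (auto intro!: derivative_eq_intros)
    have "((\<lambda>w. 1 / w) has_field_derivative - 1 / B\<^sup>2) (at B)"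
      using nz by (auto intro!: derivative_eq_intros simp: power2_eq_square)
    from field_vector_diff_chain_at[OF 2 this[unfolded B_def]]
    have 3: "((\<lambda>t. 1 / (pt t (- u t) - z)) has_vector_derivative B' * (- 1 / B\<^sup>2)) (at t)" by (simp add: o_def B_def)
    have "(r has_vector_derivative A * (B' * (- 1 / B\<^sup>2)) + A' * (1 / B)) (at t)"
      using has_vector_derivative_mult[OF 1 3] by (simp add: r_def[abs_def] A_def B_def)
    moreover have "r t \<notin> \<real>\<^sub>\<le>\<^sub>0" using ratio_not_nonpos[OF z, of t] t by (simp add: r_def N_def)
    ultimately have "((\<lambda>t. Ln (r t)) has_vector_derivative (A * (B' * (- 1 / B\<^sup>2)) + A' * (1 / B)) / r t) (at t)"
      by (rule Ln_has_vector_derivative)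
    moreover have "(A * (B' * (- 1 / B\<^sup>2)) + A' * (1 / B)) / r t = A' / A - B' / B"
    proof -
      have "r t = A / B" by (simp add: r_def A_def B_def)
      then show ?thesis using nz by (simp add: field_simps power2_eq_square)
    qed
    moreover have "A' / A - B' / B = k t"
      using u'_zero[of t] by (simp add: k_def A_def B_def A'_def B'_def)
    ultimately have "((\<lambda>t. Ln (r t)) has_vector_derivative k t) (at t)" by simp
    then show ?thesis by (rule has_vector_derivative_transform_within_open[OF _ oN t]) (simp add: LN)
  qed
  obtain C where C: "C \<ge> 0" "\<And>t. t \<in> {0..1} \<Longrightarrow> cmod (pt t (u t) - pt t (- u t)) \<le> C * u t" using pt_pm_close by blast
  obtain M where M: "\<And>t y. \<bar>y\<bar> \<le> u t \<Longrightarrow> u t + \<bar>u' t\<bar> \<le> M * cmod (pt t y - z) ^ 2" using flat[of 2] z by blast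
  have Lc: "continuous_on {0..1} L"
    unfolding continuous_on_eq_continuous_within
  proof
    fix t :: real assume t: "t \<in> {0..1}"
    show "continuous (at t within {0..1}) L"
    proof (cases "t \<in> N")
      case True
      then show ?thesis using Lder[OF True] has_vector_derivative_continuous continuous_at_imp_continuous_at_within by blast
    next
      case False
      then have ut: "u t = 0" using seg_avoid[OF z, of t "u t"] seg_avoid[OF z, of t "- u t"] u_nonneg[of t] by (auto simp: N_def)
      \<comment> \<open>The deviation is at most C u / B, and u \<le> |M| B^2 turns u / B into at
        most the square root of |M| u.\<close>
      have key: "cmod (r s - 1) \<le> C * sqrt (\<bar>M\<bar> * u s)" if s: "s \<in> {0..1}" "u s \<noteq> 0" for s
      proof -
        define B where "B = cmod (pt s (- u s) - z)"
        have B: "B > 0" using seg_avoid[OF z s(2), of "- u s"] u_nonneg[of s] by (simp add: B_def)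
        have us: "u s > 0" using s(2) u_nonneg[of s] by linarith
        have "u s \<le> M * B\<^sup>2" using M[of "- u s" s] u_nonneg[of s] by (simp add: B_def)
        also have "\<dots> \<le> \<bar>M\<bar> * B\<^sup>2" by (intro mult_right_mono) auto
        finally have uM: "u s \<le> \<bar>M\<bar> * B\<^sup>2" .
        have "u s * u s \<le> u s * (\<bar>M\<bar> * B\<^sup>2)" using us uM by (intro mult_left_mono) auto
        then have "(u s)\<^sup>2 \<le> (\<bar>M\<bar> * u s) * B\<^sup>2" by (simp add: power2_eq_square mult_ac)
        then have "u s \<le> sqrt ((\<bar>M\<bar> * u s) * B\<^sup>2)" by (rule real_le_rsqrt)
        also have "\<dots> = sqrt (\<bar>M\<bar> * u s) * B" using B by (simp add: real_sqrt_mult)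
        finally have "u s \<le> sqrt (\<bar>M\<bar> * u s) * B" .
        then have uB: "u s / B \<le> sqrt (\<bar>M\<bar> * u s)" using B by (simp add: pos_divide_le_eq)
        have "r s - 1 = (pt s (u s) - pt s (- u s)) / (pt s (- u s) - z)" using B by (simp add: r_def B_def field_simps)
        then have "cmod (r s - 1) = cmod (pt s (u s) - pt s (- u s)) / B" by (simp add: norm_divide B_def)
        also have "\<dots> \<le> C * u s / B" using C(2)[OF s(1)] B by (intro divide_right_mono) auto
        also have "\<dots> \<le> C * sqrt (\<bar>M\<bar> * u s)" using uB C(1) mult_left_mono[OF uB C(1)] by simp
        finally show ?thesis .
      qed
      define e where "e s = C * sqrt (\<bar>M\<bar> * u s)" for s
      have "continuous_on UNIV e" unfolding e_def by (intro continuous_intros)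
      then have "(e \<longlongrightarrow> e t) (at t within {0..1})"
        by (metis UNIV_I continuous_on_def tendsto_within_subset top_greatest)
      then have et: "(e \<longlongrightarrow> 0) (at t within {0..1})" using ut by (simp add: e_def)
      have ev: "eventually (\<lambda>s. e s < 1 / 2) (at t within {0..1})" using order_tendstoD(2)[OF et, of "1 / 2"] by simp
      have ev2: "eventually (\<lambda>s. s \<in> {0..1}) (at t within {0..1})" by (simp add: eventually_at_filter)
      have "eventually (\<lambda>s. norm (L s) \<le> 2 * e s) (at t within {0..1})"
        using ev ev2
      proof eventually_elim
        case (elim s)
        show ?case
        proof (cases "u s = 0")
          case True then show ?thesis using C by (simp add: L_def e_def)
        next
          case False
          have "cmod (r s - 1) \<le> e s" using key[OF elim(2) False] by (simp add: e_def)
          moreover have "cmod (Ln (1 + (r s - 1))) \<le> 2 * cmod (r s - 1)"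
            using calculation elim(1) by (intro norm_Ln_le) linarith
          ultimately show ?thesis using False by (simp add: L_def)
        qed
      qed
      moreover have "((\<lambda>s. 2 * e s) \<longlongrightarrow> 0) (at t within {0..1})" using tendsto_mult_right_zero[OF et] .
      ultimately have "(L \<longlongrightarrow> 0) (at t within {0..1})" by (rule Lim_null_comparison)
      then show ?thesis using ut by (simp add: continuous_within L_def)
    qed
  qed
  have "(k has_integral L 1 - L 0) {0..1}"
  proof (rule fundamental_theorem_of_calculus_interior_strong[OF finite_pt_fibre[of z]])
    fix x assume "x \<in> {0<..<1} - {t \<in> {0..1}. \<exists>y. pt t y = z}"
    then show "(L has_vector_derivative k x) (at x)" by (intro Lder) (auto simp: N_def)
  qed (use Lc in auto)
  moreover have "L 1 = L 0" using u_per[of 0] by (simp add: L_def r_def pt_per)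
  ultimately show ?thesis unfolding k_def by simp
qed

lemma kernel_integral:
  assumes z: "z \<in> Z"
  shows "(kernel z has_integral 2 * pi * \<i>) {0..1}"
proof -
  have "(kernel z has_integral 2 * pi * \<i> - 0 + 0) {0..1}"
    unfolding kernel_def[abs_def]
    by (intro has_integral_add has_integral_diff kernel_lower[OF z] kernel_upper[OF z] kernel_inner[OF z])
  then show ?thesis by (simp only: diff_zero add_0_right)
qed

end

section \<open>Integrals of f against powers of the Cauchy kernel\<close>

lemma continuous_on_if_zero_squeeze:
  fixes X :: "'a::metric_space \<Rightarrow> 'b::real_normed_vector" and w \<epsilon> :: "'a \<Rightarrow> real"
  assumes w: "continuous_on S w" and X: "continuous_on {x\<in>S. w x \<noteq> 0} X"
    and le: "\<And>x. x \<in> S \<Longrightarrow> w x \<noteq> 0 \<Longrightarrow> norm (X x) \<le> \<epsilon> x"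
    and \<epsilon>: "continuous_on S \<epsilon>" "\<And>x. x \<in> S \<Longrightarrow> 0 \<le> \<epsilon> x" "\<And>x. x \<in> S \<Longrightarrow> w x = 0 \<Longrightarrow> \<epsilon> x = 0"
  shows "continuous_on S (\<lambda>x. if w x = 0 then 0 else X x)"
  unfolding continuous_on_def
proof
  fix x assume x: "x \<in> S"
  let ?g = "\<lambda>x. if w x = 0 then 0 else X x"
  have wt: "(w \<longlongrightarrow> w x) (at x within S)" using w x by (simp add: continuous_on_def)
  have ev: "eventually (\<lambda>y. y \<in> S) (at x within S)" by (simp add: eventually_at_filter)
  show "(?g \<longlongrightarrow> ?g x) (at x within S)"
  proof (cases "w x = 0")
    case True
    have lim: "(\<epsilon> \<longlongrightarrow> 0) (at x within S)" using \<epsilon> x True by (metis continuous_on_def)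
    have ev2: "eventually (\<lambda>y. norm (?g y) \<le> \<epsilon> y) (at x within S)"
      using ev by eventually_elim (use le \<epsilon> in auto)
    have "(?g \<longlongrightarrow> 0) (at x within S)" by (rule Lim_null_comparison[OF ev2 lim])
    then show ?thesis using True by simp
  next
    case False
    obtain e where e: "e > 0" "\<And>y. y \<in> S \<Longrightarrow> dist y x < e \<Longrightarrow> w y \<noteq> 0"
    proof -
      have "eventually (\<lambda>y. w y \<noteq> 0) (at x within S)" using tendsto_imp_eventually_ne[OF wt False] .
      then obtain e where "e > 0" "\<And>y. y \<in> S \<Longrightarrow> y \<noteq> x \<Longrightarrow> dist y x < e \<Longrightarrow> w y \<noteq> 0"
        unfolding eventually_at by blast
      then show ?thesis using that False by metis
    qed
    have "(X \<longlongrightarrow> X x) (at x within {x\<in>S. w x \<noteq> 0})" using X x False by (simp add: continuous_on_def)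
    moreover have "at x within {x\<in>S. w x \<noteq> 0} = at x within S"
      by (rule at_within_nhd[of _ "ball x e"]) (use e in \<open>auto simp: dist_commute\<close>)
    ultimately have "(X \<longlongrightarrow> X x) (at x within S)" by simp
    moreover have "eventually (\<lambda>y. X y = ?g y) (at x within S)"
      using e by (auto simp: eventually_at)
    ultimately show ?thesis using False by (simp add: tendsto_cong)
  qed
qed

text \<open>Finitely many local constants remain after passing to a subcover; as h is nonnegative,
  the sum of their absolute values dominates each of them.\<close>

lemma compact_local_bound:
  fixes g h :: "'a::metric_space \<Rightarrow> real"
  assumes S: "compact S" and h: "\<And>x. x \<in> S \<Longrightarrow> 0 \<le> h x"
    and loc: "\<And>x. x \<in> S \<Longrightarrow> \<exists>e>0. \<exists>C. \<forall>y\<in>S. dist y x < e \<longrightarrow> g y \<le> C * h y"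
  shows "\<exists>C\<ge>0. \<forall>y\<in>S. g y \<le> C * h y"
proof -
  obtain e C where e: "\<And>x. x \<in> S \<Longrightarrow> e x > 0" and C: "\<And>x y. x \<in> S \<Longrightarrow> y \<in> S \<Longrightarrow> dist y x < e x \<Longrightarrow> g y \<le> C x * h y"
    using loc by metis
  have "S \<subseteq> (\<Union>x\<in>S. ball x (e x))" using e by auto
  then obtain D where D: "D \<subseteq> S" "finite D" "S \<subseteq> (\<Union>x\<in>D. ball x (e x))"
    using compactE_image[OF S, of S "\<lambda>x. ball x (e x)"] by auto
  show ?thesis
  proof (intro exI[of _ "\<Sum>x\<in>D. \<bar>C x\<bar>"] conjI ballI)
    fix y assume y: "y \<in> S"
    then obtain x where x: "x \<in> D" "dist y x < e x" using D(3) by (auto simp: dist_commute)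
    have "g y \<le> C x * h y" using C x D y by blast
    also have "\<dots> \<le> (\<Sum>x\<in>D. \<bar>C x\<bar>) * h y"
    proof (rule mult_right_mono[OF _ h[OF y]])
      have "C x \<le> \<bar>C x\<bar>" by simp
      also have "\<dots> \<le> (\<Sum>x\<in>D. \<bar>C x\<bar>)" by (rule member_le_sum[OF x(1)]) (use D in auto)
      finally show "C x \<le> (\<Sum>x\<in>D. \<bar>C x\<bar>)" .
    qed
    finally show "g y \<le> (\<Sum>x\<in>D. \<bar>C x\<bar>) * h y" .
  qed (simp add: sum_nonneg)
qed

lemma norm_scaleC_diff_le:
  "norm (scaleC a x - scaleC b (y::'b::complex_banach)) \<le> cmod a * norm (x - y) + cmod (a - b) * norm y"
proof -
  have "scaleC a x - scaleC b y = scaleC a (x - y) + scaleC (a - b) y"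
    by (simp add: scaleC.diff_left scaleC.diff_right)
  then show ?thesis by (metis norm_scaleC norm_triangle_ineq)
qed

context flat_contour
begin

definition "wt t y y' = scaleC (dpt t y y') (f (pt t y))"

text \<open>The form \<phi>(q) f(q) dq on all four curves together. Columns with u t > d are
  dropped: their points need not lie in K, and inner and outer curves coincide over them. The inner
  pair is kept together because near z its cancellation is essential.\<close>

definition layer :: "(complex \<Rightarrow> complex) \<Rightarrow> real \<Rightarrow> 'b" where
  "layer \<phi> t = (if u t \<le> d then
      scaleC (\<phi> (pt t (- v t))) (wt t (- v t) (- v' t)) - scaleC (\<phi> (pt t (v t))) (wt t (v t) (v' t)) +
      (if u t = 0 then 0 else scaleC (\<phi> (pt t (u t))) (wt t (u t) (u' t)) - scaleC (\<phi> (pt t (- u t))) (wt t (- u t) (- u' t)))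
    else 0)"

lemma v_abs_ge: "3 / 4 * d \<le> \<bar>v t\<bar>" "3 / 4 * d \<le> \<bar>- v t\<bar>"
  using v_ge[of t] by auto

text \<open>The outer curves are far from Z and the inner ones avoid it where u t \<noteq> 0, so the
  values of \<phi> at z1 and z2, such as 1 / 0, never enter.\<close>

lemma layer_cong:
  assumes "\<And>w. w \<noteq> z1 \<Longrightarrow> w \<noteq> z2 \<Longrightarrow> \<phi> w = \<phi>' w" "z1 \<in> Z" "z2 \<in> Z"
  shows "layer \<phi> t = layer \<phi>' t"
proof -
  have 1: "\<phi> (pt t (v t)) = \<phi>' (pt t (v t))" "\<phi> (pt t (- v t)) = \<phi>' (pt t (- v t))"
    using Z_neq_far[OF assms(2) v_abs_ge(1)] Z_neq_far[OF assms(2) v_abs_ge(2)]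
      Z_neq_far[OF assms(3) v_abs_ge(1)] Z_neq_far[OF assms(3) v_abs_ge(2)] assms(1) by blast+
  have 2: "\<phi> (pt t (u t)) = \<phi>' (pt t (u t))" "\<phi> (pt t (- u t)) = \<phi>' (pt t (- u t))" if "u t \<noteq> 0"
    using seg_avoid[OF assms(2) that] seg_avoid[OF assms(3) that] assms(1) u_nonneg[of t] by auto
  show ?thesis using 1 2 by (auto simp: layer_def)
qed

lemma layer_diff: "layer (\<lambda>w. \<phi> w - \<phi>' w) t = layer \<phi> t - layer \<phi>' t"
  by (simp add: layer_def scaleC.diff_left)

lemma layer_cmult: "layer (\<lambda>w. c * \<phi> w) t = scaleC c (layer \<phi> t)"
  by (simp add: layer_def scaleC.diff_right scaleC.add_right flip: scaleC_scaleC)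

lemma layer_add: "layer (\<lambda>w. \<phi> w + \<phi>' w) t = layer \<phi> t + layer \<phi>' t"
  by (simp add: layer_def scaleC.add_left)

lemma layer_zero: "layer (\<lambda>w. 0) t = 0"
  by (simp add: layer_def)

lemma layer_sum: "layer (\<lambda>w. \<Sum>h\<in>H. c h * \<phi> h w) t = (\<Sum>h\<in>H. scaleC (c h) (layer (\<phi> h) t))"
  by (induction H rule: infinite_finite_induct) (simp_all add: layer_zero layer_add layer_cmult)

text \<open>Write f(w) as (f(w) - f(z)) + f(z). The first part gives \<open>quot\<close> and
  integrates to 0 by \<open>contour_homotopy\<close> with s = 1 and s = -1; the second gives f(z)
  times the integral of \<open>kernel\<close>.\<close>

lemma layer_cauchy:
  assumes z: "z \<in> Z"
  shows "(layer (\<lambda>w. 1 / (w - z)) has_integral scaleC (2 * pi * \<i>) (f z)) {0..1}"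
proof -
  define H where "H s t = (if u t \<le> d then
      scaleC (dpt t (s * v t) (s * v' t)) (quot z (pt t (s * v t))) -
      scaleC (dpt t (s * u t) (s * u' t)) (quot z (pt t (s * u t))) else 0)" for s t
  have H: "(H s has_integral 0) {0..1}" if "s = 1 \<or> s = -1" for s
    using contour_homotopy[OF z that] unfolding H_def[abs_def] dpt_def .
  have "((\<lambda>t. (H (-1) t - H 1 t) + scaleC (kernel z t) (f z)) has_integral (0 - 0) + scaleC (2 * pi * \<i>) (f z)) {0..1}"
    by (intro has_integral_add has_integral_diff H has_integral_scaleC_left kernel_integral z) auto
  moreover have "(H (-1) t - H 1 t) + scaleC (kernel z t) (f z) = layer (\<lambda>w. 1 / (w - z)) t" for t
  proof -
    have q: "scaleC (dpt t y y') (quot z (pt t y)) =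
        scaleC (1 / (pt t y - z)) (wt t y y') - scaleC (dpt t y y' / (pt t y - z)) (f z)" if "pt t y \<noteq> z" for y y'
      using that by (simp add: quot_def wt_def scaleC.diff_right scaleC_scaleC)
    have vz: "pt t (v t) \<noteq> z" "pt t (- v t) \<noteq> z" using Z_neq_far[OF z] v_abs_ge by blast+
    show ?thesis
    proof (cases "u t \<le> d")
      case False
      \<comment> \<open>Over these columns the outer curves are the inner ones, so
        \<open>kernel\<close> is 0 just as \<open>layer\<close> is.\<close>
      then have "v t = u t" "v' t = u' t" "u t \<noteq> 0" using p_zero[of t] d by (auto simp: v_def v'_def)
      then show ?thesis using False by (simp add: H_def layer_def kernel_def)
    next
      case True
      show ?thesis
      proof (cases "u t = 0")
        case u0: True
        then show ?thesis using True u'_zero[OF u0]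
          by (simp add: H_def layer_def kernel_def q[OF vz(1)] q[OF vz(2)] scaleC.diff_left)
      next
        case u0: False
        have uz: "pt t (u t) \<noteq> z" "pt t (- u t) \<noteq> z" using seg_avoid[OF z u0] u_nonneg[of t] by auto
        show ?thesis using True u0
          by (simp add: H_def layer_def kernel_def q[OF vz(1)] q[OF vz(2)] q[OF uz(1)] q[OF uz(2)] scaleC.diff_left scaleC.add_left)
      qed
    qed
  qed
  ultimately show ?thesis by simp
qed

definition "cols = {t\<in>{0..1}. u t \<le> d}"

lemma cols_compact: "compact cols"
proof -
  have "closed ({0..1} \<inter> {x. u x \<le> d})" by (intro closed_Int closed_Collect_le continuous_intros closed_atLeastAtMost)
  moreover have "cols = {0..1} \<inter> {x. u x \<le> d}" by (auto simp: cols_def)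
  ultimately show ?thesis by (metis bounded_closed_interval bounded_Int compact_eq_bounded_closed)
qed

lemma heights: "t \<in> cols \<Longrightarrow> y \<in> {u t, - u t, v t, - v t} \<Longrightarrow> pt t y \<in> K"
  using K_mem[of t y] v_le[of t] u_nonneg[of t] p_nonneg[of t] by (auto simp: cols_def v_def)

lemma f_pt_cont:
  assumes "continuous_on cols y" "\<And>t. t \<in> cols \<Longrightarrow> y t \<in> {u t, - u t, v t, - v t}"
  shows "continuous_on cols (\<lambda>t. f (pt t (y t)))" "continuous_on cols (\<lambda>t. f1 (pt t (y t)))"
proof -
  have "(\<lambda>t. pt t (y t)) ` cols \<subseteq> K" using heights assms(2) by blast
  then show "continuous_on cols (\<lambda>t. f (pt t (y t)))" "continuous_on cols (\<lambda>t. f1 (pt t (y t)))"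
    using assms(1) by (auto intro!: continuous_on_compose2[OF f_cont] continuous_on_compose2[OF f1_cont] continuous_intros)
qed

lemma wt_cont:
  assumes "continuous_on cols y" "continuous_on cols y'" "\<And>t. t \<in> cols \<Longrightarrow> y t \<in> {u t, - u t, v t, - v t}"
  shows "continuous_on cols (\<lambda>t. wt t (y t) (y' t))"
  unfolding wt_def dpt_def Complex_eq using assms by (intro continuous_intros f_pt_cont)

lemma bounded_cols:
  fixes g :: "real \<Rightarrow> 'c::real_normed_vector"
  assumes "continuous_on cols g"
  obtains B where "B \<ge> 0" "\<And>t. t \<in> cols \<Longrightarrow> norm (g t) \<le> B"
proof -
  have "bounded (g ` cols)" using assms cols_compact by (intro compact_imp_bounded compact_continuous_image)
  then obtain B where B: "\<And>t. t \<in> cols \<Longrightarrow> norm (g t) \<le> B" unfolding bounded_iff by blast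
  show ?thesis by (rule that[of "max 0 B"]) (use B in \<open>auto simp: le_max_iff_disj\<close>)
qed

lemma u_cont_on: "continuous_on S u" "continuous_on S (\<lambda>t. - u t)" "continuous_on S u'" "continuous_on S (\<lambda>t. - u' t)"
  "continuous_on S v" "continuous_on S (\<lambda>t. - v t)" "continuous_on S v'" "continuous_on S (\<lambda>t. - v' t)"
  using u_cont[OF continuous_on_id] u'_cont2[OF continuous_on_id] v_cont[OF continuous_on_id] v'_cont[OF continuous_on_id]
  by (auto intro: continuous_on_minus)

lemma f_pm_close: "\<exists>C\<ge>0. \<forall>t\<in>cols. norm (f (pt t (u t)) - f (pt t (- u t))) \<le> C * u t"
proof (rule compact_local_bound[where h = u and g = "\<lambda>t. norm (f (pt t (u t)) - f (pt t (- u t)))", OF cols_compact u_nonneg])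
  fix t0 assume t0: "t0 \<in> cols"
  obtain C0 where C0: "C0 \<ge> 0" "\<And>t. t \<in> {0..1} \<Longrightarrow> cmod (pt t (u t) - pt t (- u t)) \<le> C0 * u t" using pt_pm_close by blast
  have fc: "continuous_on cols (\<lambda>t. f (pt t (u t)))" "continuous_on cols (\<lambda>t. f (pt t (- u t)))"
    "continuous_on cols (\<lambda>t. f1 (pt t (- u t)))"
    by (auto intro!: f_pt_cont u_cont_on)
  show "\<exists>e>0. \<exists>C. \<forall>y\<in>cols. dist y t0 < e \<longrightarrow> norm (f (pt y (u y)) - f (pt y (- u y))) \<le> C * u y"
  proof (cases "u t0 = 0")
    case True
    define z0 where "z0 = pt t0 0"
    have z0: "z0 \<in> K" using heights[OF t0, of "u t0"] True by (simp add: z0_def)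
    obtain \<delta> where \<delta>0: "\<delta> > 0" and \<delta>: "\<And>z1 z2. z1 \<in> K \<Longrightarrow> z2 \<in> K \<Longrightarrow> cmod (z1 - z0) < \<delta> \<Longrightarrow> cmod (z2 - z0) < \<delta> \<Longrightarrow>
          norm (f z2 - f z1 - scaleC (z2 - z1) (f1 z1)) \<le> 1 * cmod (z1 - z2)"
      using C1[OF z0, of 1] by (metis zero_less_one)
    obtain B where B: "B \<ge> 0" "\<And>t. t \<in> cols \<Longrightarrow> norm (f1 (pt t (- u t))) \<le> B" using bounded_cols[OF fc(3)] by blast
    have pc: "continuous_on UNIV (\<lambda>t. pt t (u t))" "continuous_on UNIV (\<lambda>t. pt t (- u t))"
      by (intro continuous_intros)+
    obtain e1 where e1: "e1 > 0" "\<And>t. dist t t0 < e1 \<Longrightarrow> dist (pt t (u t)) (pt t0 (u t0)) < \<delta>"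
      using pc(1) \<delta>0 unfolding continuous_on_iff by blast
    obtain e2 where e2: "e2 > 0" "\<And>t. dist t t0 < e2 \<Longrightarrow> dist (pt t (- u t)) (pt t0 (- u t0)) < \<delta>"
      using pc(2) \<delta>0 unfolding continuous_on_iff by blast
    show ?thesis
    proof (rule exI[of _ "min e1 e2"], intro exI[of _ "(B + 1) * C0"] conjI ballI impI)
      fix t assume t: "t \<in> cols" "dist t t0 < min e1 e2"
      let ?a = "pt t (u t)" and ?b = "pt t (- u t)"
      have ab: "?a \<in> K" "?b \<in> K" using heights[OF t(1)] by auto
      have "cmod (?a - z0) < \<delta>" "cmod (?b - z0) < \<delta>"
        using e1(2)[of t] e2(2)[of t] t True by (simp_all add: z0_def dist_norm)
      then have 1: "norm (f ?a - f ?b - scaleC (?a - ?b) (f1 ?b)) \<le> cmod (?a - ?b)"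
        using \<delta>[OF ab(2,1)] by (simp add: norm_minus_commute[of ?b ?a])
      have "norm (scaleC (?a - ?b) (f1 ?b)) \<le> cmod (?a - ?b) * B"
        unfolding norm_scaleC using B(2)[OF t(1)] by (intro mult_left_mono) auto
      then have "norm (f ?a - f ?b) \<le> (B + 1) * cmod (?a - ?b)"
        using 1 norm_triangle_sub[of "f ?a - f ?b" "scaleC (?a - ?b) (f1 ?b)"] by (simp add: algebra_simps)
      also have "\<dots> \<le> (B + 1) * (C0 * u t)"
        using C0(2)[of t] t B(1) by (intro mult_left_mono) (auto simp: cols_def)
      finally show "norm (f ?a - f ?b) \<le> (B + 1) * C0 * u t" by (simp add: mult.assoc)
    qed (use e1 e2 in auto)
  next
    case False
    then have u0: "u t0 > 0" using u_nonneg[of t0] by linarith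
    obtain B1 where B1: "B1 \<ge> 0" "\<And>t. t \<in> cols \<Longrightarrow> norm (f (pt t (u t))) \<le> B1" using bounded_cols[OF fc(1)] by blast
    obtain B2 where B2: "B2 \<ge> 0" "\<And>t. t \<in> cols \<Longrightarrow> norm (f (pt t (- u t))) \<le> B2" using bounded_cols[OF fc(2)] by blast
    have "continuous_on UNIV u" by (rule u_cont_on)
    moreover have "u t0 / 2 > 0" using u0 by simp
    ultimately obtain e where e: "e > 0" "\<And>t. dist t t0 < e \<Longrightarrow> dist (u t) (u t0) < u t0 / 2"
      unfolding continuous_on_iff by blast
    show ?thesis
    proof (rule exI[of _ e], intro exI[of _ "(B1 + B2) / (u t0 / 2)"] conjI ballI impI)
      fix t assume t: "t \<in> cols" "dist t t0 < e"
      have ut: "u t0 / 2 \<le> u t" using e(2)[OF t(2)] unfolding dist_real_def by linarith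
      have "norm (f (pt t (u t)) - f (pt t (- u t))) \<le> B1 + B2"
        using norm_triangle_ineq4[of "f (pt t (u t))" "f (pt t (- u t))"] B1(2)[OF t(1)] B2(2)[OF t(1)] by linarith
      also have "\<dots> = (B1 + B2) / (u t0 / 2) * (u t0 / 2)" using u0 by simp
      also have "\<dots> \<le> (B1 + B2) / (u t0 / 2) * u t" using ut u0 B1(1) B2(1) by (intro mult_left_mono) auto
      finally show "norm (f (pt t (u t)) - f (pt t (- u t))) \<le> (B1 + B2) / (u t0 / 2) * u t" .
    qed (rule e(1))
  qed
qed

lemma wt_pm_close: "\<exists>C\<ge>0. \<forall>t\<in>cols. norm (wt t (u t) (u' t) - wt t (- u t) (- u' t)) \<le> C * (u t + \<bar>u' t\<bar>)"
proof -
  obtain C0 where C0: "C0 \<ge> 0" "\<And>t. t \<in> {0..1} \<Longrightarrow> cmod (pt t (u t) - pt t (- u t)) \<le> C0 * u t" using pt_pm_close by blast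
  obtain C1 where C1: "C1 \<ge> 0" "\<And>t. t \<in> cols \<Longrightarrow> norm (f (pt t (u t)) - f (pt t (- u t))) \<le> C1 * u t" using f_pm_close by blast
  have c: "continuous_on cols (\<lambda>t. f (pt t (- u t)))" "continuous_on cols (\<lambda>t. dpt t (u t) (u' t))"
    "continuous_on cols (\<lambda>t. pt t (u t))" "continuous_on cols (\<lambda>t. pt t (- u t))"
    unfolding dpt_def Complex_eq by (auto intro!: f_pt_cont u_cont_on continuous_intros)
  obtain B where B: "B \<ge> 0" "\<And>t. t \<in> cols \<Longrightarrow> norm (f (pt t (- u t))) \<le> B" using bounded_cols[OF c(1)] by blast
  obtain D where D: "D \<ge> 0" "\<And>t. t \<in> cols \<Longrightarrow> cmod (dpt t (u t) (u' t)) \<le> D" using bounded_cols[OF c(2)] by blast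
  obtain P1 where P1: "P1 \<ge> 0" "\<And>t. t \<in> cols \<Longrightarrow> cmod (pt t (u t)) \<le> P1" using bounded_cols[OF c(3)] by blast
  obtain P2 where P2: "P2 \<ge> 0" "\<And>t. t \<in> cols \<Longrightarrow> cmod (pt t (- u t)) \<le> P2" using bounded_cols[OF c(4)] by blast
  define X where "X = 2 * pi * (C0 + P1 + P2)"
  have X: "X \<ge> 0" using C0 P1 P2 by (simp add: X_def)
  show ?thesis
  proof (intro exI[of _ "D * C1 + X * B"] conjI ballI)
    fix t assume t: "t \<in> cols"
    let ?e = "u t + \<bar>u' t\<bar>"
    have e: "u t \<le> ?e" "\<bar>u' t\<bar> \<le> ?e" "0 \<le> ?e" using u_nonneg[of t] by auto
    have t01: "t \<in> {0..1}" using t by (simp add: cols_def)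
    \<comment> \<open>The slopes of the two curves are opposite, so in the difference their
      contributions add up; hence |u'| has to be flat along with u.\<close>
    have "dpt t (u t) (u' t) - dpt t (- u t) (- u' t) =
      2 * pi * \<i> * ((pt t (u t) - pt t (- u t)) + \<i> * u' t * (pt t (u t) + pt t (- u t)))"
      by (simp add: dpt_def Complex_eq algebra_simps)
    then have "cmod (dpt t (u t) (u' t) - dpt t (- u t) (- u' t)) =
      2 * pi * cmod ((pt t (u t) - pt t (- u t)) + \<i> * u' t * (pt t (u t) + pt t (- u t)))"
      by (simp add: norm_mult)
    also have "\<dots> \<le> 2 * pi * (C0 * ?e + ?e * (P1 + P2))"
    proof (intro mult_left_mono norm_triangle_le add_mono)
      show "cmod (pt t (u t) - pt t (- u t)) \<le> C0 * ?e"
        using C0(2)[OF t01] mult_left_mono[OF e(1) C0(1)] by linarith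
      have "cmod (pt t (u t) + pt t (- u t)) \<le> P1 + P2"
        using norm_triangle_ineq[of "pt t (u t)" "pt t (- u t)"] P1(2)[OF t] P2(2)[OF t] by linarith
      then show "cmod (\<i> * u' t * (pt t (u t) + pt t (- u t))) \<le> ?e * (P1 + P2)"
        unfolding norm_mult using e P1 P2 by (intro mult_mono) auto
    qed auto
    also have "\<dots> = X * ?e" by (simp add: X_def algebra_simps)
    finally have dd: "cmod (dpt t (u t) (u' t) - dpt t (- u t) (- u' t)) \<le> X * ?e" .
    have "norm (wt t (u t) (u' t) - wt t (- u t) (- u' t)) \<le>
      cmod (dpt t (u t) (u' t)) * norm (f (pt t (u t)) - f (pt t (- u t))) +
      cmod (dpt t (u t) (u' t) - dpt t (- u t) (- u' t)) * norm (f (pt t (- u t)))"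
      unfolding wt_def by (rule norm_scaleC_diff_le)
    also have "\<dots> \<le> D * (C1 * ?e) + (X * ?e) * B"
      using D B C1(2)[OF t] mult_left_mono[OF e(1) C1(1)] dd X e(3) by (intro add_mono mult_mono) (auto simp: t)
    also have "\<dots> = (D * C1 + X * B) * ?e" by (simp add: algebra_simps)
    finally show "norm (wt t (u t) (u' t) - wt t (- u t) (- u' t)) \<le> (D * C1 + X * B) * ?e" .
  qed (use C1 D X B in simp)
qed

text \<open>Flatness handles one singular factor at a time. The largest of the five terms is one of
  them, and the sum is at most 5 times as large.\<close>

lemma flat_power:
  fixes N :: nat
  obtains M where "M \<ge> 0" "\<And>z1 z2 t. z1 \<in> Z \<Longrightarrow> z2 \<in> Z \<Longrightarrow> t \<in> cols \<Longrightarrow> u t \<noteq> 0 \<Longrightarrow>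
    (u t + \<bar>u' t\<bar>) * (1 + cmod (1 / (pt t (u t) - z1)) + cmod (1 / (pt t (u t) - z2)) +
       cmod (1 / (pt t (- u t) - z1)) + cmod (1 / (pt t (- u t) - z2))) ^ N \<le> M"
proof -
  obtain U where U: "U \<ge> 0" "\<And>t. t \<in> {0..1} \<Longrightarrow> u t \<le> U \<and> \<bar>u' t\<bar> \<le> U" using u_bound by blast
  obtain M where M: "\<And>z t y. z \<in> Z \<Longrightarrow> \<bar>y\<bar> \<le> u t \<Longrightarrow> u t + \<bar>u' t\<bar> \<le> M * cmod (pt t y - z) ^ N" using flat[of N] by blast
  show ?thesis
  proof (rule that[of "5 ^ N * (2 * U + \<bar>M\<bar>)"])
    fix z1 z2 t assume z: "z1 \<in> Z" "z2 \<in> Z" and t: "t \<in> cols" and u0: "u t \<noteq> 0"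
    let ?e = "u t + \<bar>u' t\<bar>"
    have e0: "?e \<ge> 0" using u_nonneg[of t] by simp
    define S where "S = {1, cmod (1 / (pt t (u t) - z1)), cmod (1 / (pt t (u t) - z2)), cmod (1 / (pt t (- u t) - z1)), cmod (1 / (pt t (- u t) - z2))}"
    define X where "X = Max S"
    have S: "finite S" "S \<noteq> {}" by (auto simp: S_def)
    have X: "X \<in> S" unfolding X_def using S by (rule Max_in)
    have leX: "s \<le> X" if "s \<in> S" for s unfolding X_def using S that by simp
    have X1: "X \<ge> 1" by (rule leX) (simp add: S_def)
    have inv: "?e * cmod (1 / (pt t y - z)) ^ N \<le> \<bar>M\<bar>" if "z \<in> Z" "\<bar>y\<bar> \<le> u t" for y z
    proof -
      have nz: "cmod (pt t y - z) > 0" using seg_avoid[OF that(1) u0 that(2)] by simp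
      have "?e \<le> \<bar>M\<bar> * cmod (pt t y - z) ^ N"
        using M[OF that] mult_right_mono[OF abs_ge_self[of M], of "cmod (pt t y - z) ^ N"] by simp
      then have "?e * cmod (1 / (pt t y - z)) ^ N \<le> (\<bar>M\<bar> * cmod (pt t y - z) ^ N) * cmod (1 / (pt t y - z)) ^ N"
        by (intro mult_right_mono) auto
      also have "\<dots> = \<bar>M\<bar>" using nz by (simp add: norm_divide power_divide)
      finally show ?thesis .
    qed
    have uu: "\<bar>u t\<bar> \<le> u t" "\<bar>- u t\<bar> \<le> u t" using u_nonneg[of t] by auto
    have "?e * X ^ N \<le> 2 * U + \<bar>M\<bar>"
    proof (cases "X = 1")
      case True
      have "u t + \<bar>u' t\<bar> \<le> 2 * U" using U(2)[of t] t by (simp add: cols_def)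
      then show ?thesis using True abs_ge_zero[of M] by simp
    next
      case False
      then have "?e * X ^ N \<le> \<bar>M\<bar>" using X inv[OF z(1) uu(1)] inv[OF z(2) uu(1)] inv[OF z(1) uu(2)] inv[OF z(2) uu(2)]
        unfolding S_def by blast
      then show ?thesis using U(1) by simp
    qed
    moreover have "(1 + cmod (1 / (pt t (u t) - z1)) + cmod (1 / (pt t (u t) - z2)) +
       cmod (1 / (pt t (- u t) - z1)) + cmod (1 / (pt t (- u t) - z2))) ^ N \<le> (5 * X) ^ N"
    proof (rule power_mono)
      have "cmod (1 / (pt t (u t) - z1)) \<le> X" "cmod (1 / (pt t (u t) - z2)) \<le> X"
        "cmod (1 / (pt t (- u t) - z1)) \<le> X" "cmod (1 / (pt t (- u t) - z2)) \<le> X"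
        by (rule leX, simp add: S_def)+
      then show "1 + cmod (1 / (pt t (u t) - z1)) + cmod (1 / (pt t (u t) - z2)) +
        cmod (1 / (pt t (- u t) - z1)) + cmod (1 / (pt t (- u t) - z2)) \<le> 5 * X" using X1 by linarith
    qed (auto intro!: add_nonneg_nonneg)
    ultimately show "?e * (1 + cmod (1 / (pt t (u t) - z1)) + cmod (1 / (pt t (u t) - z2)) +
       cmod (1 / (pt t (- u t) - z1)) + cmod (1 / (pt t (- u t) - z2))) ^ N \<le> 5 ^ N * (2 * U + \<bar>M\<bar>)"
    proof -
      assume a: "?e * X ^ N \<le> 2 * U + \<bar>M\<bar>" and b: "(1 + cmod (1 / (pt t (u t) - z1)) + cmod (1 / (pt t (u t) - z2)) +
       cmod (1 / (pt t (- u t) - z1)) + cmod (1 / (pt t (- u t) - z2))) ^ N \<le> (5 * X) ^ N"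
      have "?e * (5 * X) ^ N = 5 ^ N * (?e * X ^ N)" by (simp add: power_mult_distrib)
      also have "\<dots> \<le> 5 ^ N * (2 * U + \<bar>M\<bar>)" using a by (intro mult_left_mono) auto
      finally show ?thesis using mult_left_mono[OF b e0] by linarith
    qed
  qed (use U in simp)
qed

text \<open>The difference of the kernel on the two curves carries two more singular factors than
  the kernel, hence k + 2. Doubling this exponent in \<open>flat_power\<close> leaves a square root
  of u + |u'| over, which makes the integrand continuous at columns with u = 0.\<close>

lemma inner_bound:
  assumes "poly_growth \<rho>"
  obtains C where "C \<ge> 0" "\<And>z1 z2 t. z1 \<in> Z \<Longrightarrow> z2 \<in> Z \<Longrightarrow> t \<in> cols \<Longrightarrow> u t \<noteq> 0 \<Longrightarrow>
    norm (scaleC (\<rho> (1 / (pt t (u t) - z1)) (1 / (pt t (u t) - z2))) (wt t (u t) (u' t)) -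
          scaleC (\<rho> (1 / (pt t (- u t) - z1)) (1 / (pt t (- u t) - z2))) (wt t (- u t) (- u' t)))
      \<le> C * sqrt (u t + \<bar>u' t\<bar>)"
proof -
  obtain R k where R: "0 \<le> R" and \<rho>: "\<And>T a b a' b' l. k \<le> l \<Longrightarrow> T \<ge> 1 \<Longrightarrow> cmod a \<le> T \<Longrightarrow> cmod b \<le> T \<Longrightarrow> cmod a' \<le> T \<Longrightarrow> cmod b' \<le> T \<Longrightarrow>
     cmod (\<rho> a b) \<le> R * T ^ l \<and> cmod (\<rho> a b - \<rho> a' b') \<le> R * T ^ l * (cmod (a - a') + cmod (b - b'))"
    using poly_growthE[OF assms] by metis
  obtain M where M: "M \<ge> 0" "\<And>z1 z2 t. z1 \<in> Z \<Longrightarrow> z2 \<in> Z \<Longrightarrow> t \<in> cols \<Longrightarrow> u t \<noteq> 0 \<Longrightarrow>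
    (u t + \<bar>u' t\<bar>) * (1 + cmod (1 / (pt t (u t) - z1)) + cmod (1 / (pt t (u t) - z2)) +
       cmod (1 / (pt t (- u t) - z1)) + cmod (1 / (pt t (- u t) - z2))) ^ (2 * (k + 2)) \<le> M"
    using flat_power[of "2 * (k + 2)"] by blast
  obtain C0 where C0: "C0 \<ge> 0" "\<And>t. t \<in> {0..1} \<Longrightarrow> cmod (pt t (u t) - pt t (- u t)) \<le> C0 * u t" using pt_pm_close by blast
  obtain C1 where C1: "C1 \<ge> 0" "\<And>t. t \<in> cols \<Longrightarrow> norm (wt t (u t) (u' t) - wt t (- u t) (- u' t)) \<le> C1 * (u t + \<bar>u' t\<bar>)"
    using wt_pm_close by blast
  have "continuous_on cols (\<lambda>t. wt t (- u t) (- u' t))" by (intro wt_cont u_cont_on) auto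
  then obtain B where B: "B \<ge> 0" "\<And>t. t \<in> cols \<Longrightarrow> norm (wt t (- u t) (- u' t)) \<le> B" using bounded_cols by blast
  show ?thesis
  proof (rule that[of "(R * C1 + R * 2 * C0 * B) * sqrt M"])
    fix z1 z2 t assume z: "z1 \<in> Z" "z2 \<in> Z" and t: "t \<in> cols" and u0: "u t \<noteq> 0"
    define e where "e = u t + \<bar>u' t\<bar>"
    have e: "u t \<le> e" "0 \<le> e" "0 \<le> u t" using u_nonneg[of t] by (auto simp: e_def)
    define a b a' b' where "a = 1 / (pt t (u t) - z1)" and "b = 1 / (pt t (u t) - z2)"
      and "a' = 1 / (pt t (- u t) - z1)" and "b' = 1 / (pt t (- u t) - z2)"
    define T where "T = 1 + cmod a + cmod b + cmod a' + cmod b'"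
    have T: "T \<ge> 1" "cmod a \<le> T" "cmod b \<le> T" "cmod a' \<le> T" "cmod b' \<le> T" by (auto simp: T_def)
    have eT: "e * T ^ (2 * (k + 2)) \<le> M" using M(2)[OF z t u0] by (simp add: e_def T_def a_def b_def a'_def b'_def)
    have nz: "pt t (u t) \<noteq> z" "pt t (- u t) \<noteq> z" if "z \<in> Z" for z
      using seg_avoid[OF that u0] u_nonneg[of t] by auto
    have dif: "cmod (1 / (pt t (u t) - z) - 1 / (pt t (- u t) - z)) \<le> C0 * e * T\<^sup>2"
      if "z \<in> Z" "cmod (1 / (pt t (u t) - z)) \<le> T" "cmod (1 / (pt t (- u t) - z)) \<le> T" for z
    proof -
      have "1 / (pt t (u t) - z) - 1 / (pt t (- u t) - z) =
        - (pt t (u t) - pt t (- u t)) * (1 / (pt t (u t) - z) * (1 / (pt t (- u t) - z)))"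
        using nz[OF that(1)] by (simp add: field_simps)
      then have "cmod (1 / (pt t (u t) - z) - 1 / (pt t (- u t) - z)) =
        cmod (pt t (u t) - pt t (- u t)) * (cmod (1 / (pt t (u t) - z)) * cmod (1 / (pt t (- u t) - z)))"
        by (simp only: norm_mult norm_minus_cancel)
      also have "\<dots> \<le> (C0 * e) * (T * T)"
      proof (intro mult_mono that)
        show "cmod (pt t (u t) - pt t (- u t)) \<le> C0 * e"
          using C0(2)[of t] t mult_left_mono[OF e(1) C0(1)] by (simp add: cols_def)
      qed (use C0 e T in auto)
      finally show ?thesis by (simp add: power2_eq_square)
    qed
    have da: "cmod (a - a') \<le> C0 * e * T\<^sup>2" "cmod (b - b') \<le> C0 * e * T\<^sup>2"
      using dif[OF z(1)] dif[OF z(2)] T by (auto simp: a_def b_def a'_def b'_def)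
    note \<rho>' = \<rho>[OF order_refl T]
    have Tk: "T ^ k \<le> T ^ (k + 2)" "0 \<le> T ^ k" using T(1) power_increasing[of k "k + 2" T] by auto
    have "norm (scaleC (\<rho> a b) (wt t (u t) (u' t)) - scaleC (\<rho> a' b') (wt t (- u t) (- u' t))) \<le>
      cmod (\<rho> a b) * norm (wt t (u t) (u' t) - wt t (- u t) (- u' t)) + cmod (\<rho> a b - \<rho> a' b') * norm (wt t (- u t) (- u' t))"
      by (rule norm_scaleC_diff_le)
    also have "\<dots> \<le> (R * T ^ (k + 2)) * (C1 * e) + (R * T ^ k * (2 * (C0 * e * T\<^sup>2))) * B"
    proof (intro add_mono mult_mono)
      show "cmod (\<rho> a b) \<le> R * T ^ (k + 2)" using \<rho>' mult_left_mono[OF Tk(1) R] by linarith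
      show "norm (wt t (u t) (u' t) - wt t (- u t) (- u' t)) \<le> C1 * e" using C1(2)[OF t] by (simp add: e_def)
      have "R * T ^ k * (cmod (a - a') + cmod (b - b')) \<le> R * T ^ k * (2 * (C0 * e * T\<^sup>2))"
        using da R Tk by (intro mult_left_mono) auto
      then show "cmod (\<rho> a b - \<rho> a' b') \<le> R * T ^ k * (2 * (C0 * e * T\<^sup>2))" using \<rho>' by linarith
      show "norm (wt t (- u t) (- u' t)) \<le> B" by (rule B(2)[OF t])
    qed (use R C0 C1 B e T Tk in auto)
    also have "\<dots> = (R * C1 + R * 2 * C0 * B) * (e * T ^ (k + 2))" by (simp add: power_add power2_eq_square algebra_simps)
    also have "\<dots> \<le> (R * C1 + R * 2 * C0 * B) * (sqrt M * sqrt e)"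
    proof (rule mult_left_mono)
      have "sqrt e * T ^ (k + 2) = sqrt (e * T ^ (2 * (k + 2)))"
      proof -
        have "T ^ (2 * (k + 2)) = (T ^ (k + 2))\<^sup>2" by (subst mult.commute) (rule power_mult)
        then show ?thesis using T(1) by (simp only: real_sqrt_mult real_sqrt_abs) simp
      qed
      also have "\<dots> \<le> sqrt M" using eT by simp
      finally have A: "sqrt e * (sqrt e * T ^ (k + 2)) \<le> sqrt e * sqrt M" using e by (intro mult_left_mono) auto
      have "sqrt e * sqrt e = e" using e by simp
      then have "sqrt e * (sqrt e * T ^ (k + 2)) = e * T ^ (k + 2)" by (simp only: mult.assoc[symmetric])
      then show "e * T ^ (k + 2) \<le> sqrt M * sqrt e" using A by (simp only: mult.commute[of "sqrt M"])
    qed (use R C0 C1 B in simp)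
    finally show "norm (scaleC (\<rho> (1 / (pt t (u t) - z1)) (1 / (pt t (u t) - z2))) (wt t (u t) (u' t)) -
          scaleC (\<rho> (1 / (pt t (- u t) - z1)) (1 / (pt t (- u t) - z2))) (wt t (- u t) (- u' t)))
      \<le> (R * C1 + R * 2 * C0 * B) * sqrt M * sqrt (u t + \<bar>u' t\<bar>)"
      unfolding a_def b_def a'_def b'_def e_def by (simp only: mult.assoc)
  qed (use R C0 C1 B M in simp)
qed

text \<open>Moduli alone separate the sets: Z lies in |y| \<le> d / 2, the outer curves in |y| \<ge>
  3/4 d.\<close>

lemma outer_far:
  obtains T where "T \<ge> 1" "\<And>z t. z \<in> Z \<Longrightarrow> cmod (1 / (pt t (v t) - z)) \<le> T \<and> cmod (1 / (pt t (- v t) - z)) \<le> T"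
proof -
  define c1 c2 where "c1 = exp (- pi * d) - exp (- pi * (3 / 2 * d))" and "c2 = exp (pi * (3 / 2 * d)) - exp (pi * d)"
  have c: "c1 > 0" "c2 > 0" using d by (simp_all add: c1_def c2_def)
  show ?thesis
  proof (rule that[of "1 + 1 / c1 + 1 / c2"])
    show "1 + 1 / c1 + 1 / c2 \<ge> 1" using c by simp
    fix z t assume z: "z \<in> Z"
    have "2 * pi * (3 / 4 * d) \<le> 2 * pi * v t" using v_ge[of t] by (intro mult_left_mono) auto
    then have vv: "pi * (3 / 2 * d) \<le> 2 * pi * v t" by simp
    have "cmod (pt t (v t)) \<le> exp (- pi * (3 / 2 * d))" "exp (pi * (3 / 2 * d)) \<le> cmod (pt t (- v t))"
      unfolding norm_pt using vv by auto
    then have "c1 \<le> cmod (pt t (v t) - z)" "c2 \<le> cmod (pt t (- v t) - z)"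
      using Z_norm[OF z] norm_triangle_ineq3[of "pt t (v t)" z] norm_triangle_ineq3[of "pt t (- v t)" z]
      unfolding c1_def c2_def by linarith+
    then have "1 / cmod (pt t (v t) - z) \<le> 1 / c1" "1 / cmod (pt t (- v t) - z) \<le> 1 / c2"
      using c by (auto intro!: divide_left_mono mult_pos_pos intro: less_le_trans)
    then have "cmod (1 / (pt t (v t) - z)) \<le> 1 / c1" "cmod (1 / (pt t (- v t) - z)) \<le> 1 / c2"
      unfolding norm_divide norm_one .
    moreover have "1 / c1 > 0" "1 / c2 > 0" using c by auto
    ultimately show "cmod (1 / (pt t (v t) - z)) \<le> 1 + 1 / c1 + 1 / c2 \<and> cmod (1 / (pt t (- v t) - z)) \<le> 1 + 1 / c1 + 1 / c2"
      by linarith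
  qed
qed

text \<open>The uniformity in z1 and z2 is the point: both will vary in Taylor remainders. The inner
  pair is handled by \<open>inner_bound\<close>, the outer one by \<open>outer_far\<close>.\<close>

lemma layer_bound:
  assumes "poly_growth \<rho>"
  obtains C where "C \<ge> 0" "\<And>z1 z2 t. z1 \<in> Z \<Longrightarrow> z2 \<in> Z \<Longrightarrow> t \<in> {0..1} \<Longrightarrow>
    norm (layer (\<lambda>w. \<rho> (1 / (w - z1)) (1 / (w - z2))) t) \<le> C"
proof -
  obtain C1 where C1: "C1 \<ge> 0" "\<And>z1 z2 t. z1 \<in> Z \<Longrightarrow> z2 \<in> Z \<Longrightarrow> t \<in> cols \<Longrightarrow> u t \<noteq> 0 \<Longrightarrow>
    norm (scaleC (\<rho> (1 / (pt t (u t) - z1)) (1 / (pt t (u t) - z2))) (wt t (u t) (u' t)) -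
          scaleC (\<rho> (1 / (pt t (- u t) - z1)) (1 / (pt t (- u t) - z2))) (wt t (- u t) (- u' t)))
      \<le> C1 * sqrt (u t + \<bar>u' t\<bar>)" using inner_bound[OF assms] by blast
  obtain U where U: "U \<ge> 0" "\<And>t. t \<in> {0..1} \<Longrightarrow> u t \<le> U \<and> \<bar>u' t\<bar> \<le> U" using u_bound by blast
  obtain T where T: "T \<ge> 1" "\<And>z t. z \<in> Z \<Longrightarrow> cmod (1 / (pt t (v t) - z)) \<le> T \<and> cmod (1 / (pt t (- v t) - z)) \<le> T"
    using outer_far by blast
  obtain R k where R: "0 \<le> R" and \<rho>: "\<And>T a b a' b' l. k \<le> l \<Longrightarrow> T \<ge> 1 \<Longrightarrow> cmod a \<le> T \<Longrightarrow> cmod b \<le> T \<Longrightarrow> cmod a' \<le> T \<Longrightarrow> cmod b' \<le> T \<Longrightarrow>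
     cmod (\<rho> a b) \<le> R * T ^ l \<and> cmod (\<rho> a b - \<rho> a' b') \<le> R * T ^ l * (cmod (a - a') + cmod (b - b'))"
    using poly_growthE[OF assms] by metis
  have wc: "continuous_on cols (\<lambda>t. wt t (- v t) (- v' t))" "continuous_on cols (\<lambda>t. wt t (v t) (v' t))"
    by (auto intro!: wt_cont u_cont_on)
  obtain B1 where B1: "B1 \<ge> 0" "\<And>t. t \<in> cols \<Longrightarrow> norm (wt t (- v t) (- v' t)) \<le> B1" using bounded_cols[OF wc(1)] by blast
  obtain B2 where B2: "B2 \<ge> 0" "\<And>t. t \<in> cols \<Longrightarrow> norm (wt t (v t) (v' t)) \<le> B2" using bounded_cols[OF wc(2)] by blast
  note B = B1(1) B2(1) B1(2) B2(2)
  define E where "E = R * T ^ k"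
  have E: "E \<ge> 0" using R T by (simp add: E_def)
  show ?thesis
  proof (rule that[of "E * B1 + E * B2 + C1 * sqrt (2 * U)"])
    fix z1 z2 and t :: real assume z: "z1 \<in> Z" "z2 \<in> Z" and t: "t \<in> {0..1}"
    show "norm (layer (\<lambda>w. \<rho> (1 / (w - z1)) (1 / (w - z2))) t) \<le> E * B1 + E * B2 + C1 * sqrt (2 * U)"
    proof (cases "u t \<le> d")
      case False
      then show ?thesis using E B C1 U by (simp add: layer_def)
    next
      case True
      then have tc: "t \<in> cols" using t by (simp add: cols_def)
      have r: "cmod (\<rho> (1 / (pt t y - z1)) (1 / (pt t y - z2))) \<le> E" if "y \<in> {v t, - v t}" for y
        using \<rho>[OF order_refl T(1), of "1 / (pt t y - z1)" "1 / (pt t y - z2)" "1 / (pt t y - z1)" "1 / (pt t y - z2)"]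
          T(2)[OF z(1), of t] T(2)[OF z(2), of t] that unfolding E_def by auto
      define a b c where "a = scaleC (\<rho> (1 / (pt t (- v t) - z1)) (1 / (pt t (- v t) - z2))) (wt t (- v t) (- v' t))"
        and "b = scaleC (\<rho> (1 / (pt t (v t) - z1)) (1 / (pt t (v t) - z2))) (wt t (v t) (v' t))"
        and "c = (if u t = 0 then 0 else scaleC (\<rho> (1 / (pt t (u t) - z1)) (1 / (pt t (u t) - z2))) (wt t (u t) (u' t)) -
          scaleC (\<rho> (1 / (pt t (- u t) - z1)) (1 / (pt t (- u t) - z2))) (wt t (- u t) (- u' t)))"
      have "norm a \<le> E * B1" "norm b \<le> E * B2" unfolding a_def b_def norm_scaleC
        using r B(3,4)[OF tc] E B(1,2) by (auto intro!: mult_mono)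
      moreover have "norm c \<le> C1 * sqrt (2 * U)"
      proof (cases "u t = 0")
        case True
        then show ?thesis using C1 U by (simp add: c_def)
      next
        case False
        have "norm c \<le> C1 * sqrt (u t + \<bar>u' t\<bar>)" using C1(2)[OF z tc False] False by (simp add: c_def)
        also have "\<dots> \<le> C1 * sqrt (2 * U)" using U(2)[OF t] C1(1) by (intro mult_left_mono real_sqrt_le_mono) auto
        finally show ?thesis .
      qed
      moreover have "layer (\<lambda>w. \<rho> (1 / (w - z1)) (1 / (w - z2))) t = a - b + c"
        using True by (simp add: layer_def a_def b_def c_def)
      moreover have "norm (a - b + c) \<le> norm a + norm b + norm c"
        using norm_triangle_ineq[of "a - b" c] norm_triangle_ineq4[of a b] by linarith
      ultimately show ?thesis by simp
    qed
  qed (use E B C1 U in simp)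
qed

text \<open>The integrand is continuous: at columns with u = 0 \<open>inner_bound\<close> squeezes
  the inner pair to 0, and at columns with u = d inner and outer terms cancel, so that pasting with
  0 is possible.\<close>

lemma layer_integrable:
  assumes z: "z \<in> Z"
  shows "layer (\<lambda>w. (1 / (w - z)) ^ n) integrable_on {0..1}"
proof -
  define \<phi> where "\<phi> w = (1 / (w - z)) ^ n" for w
  have "poly_growth (\<lambda>a b. a ^ n)" by (intro poly_growth_power poly_growth_fst)
  then obtain C where C: "C \<ge> 0" "\<And>z1 z2 t. z1 \<in> Z \<Longrightarrow> z2 \<in> Z \<Longrightarrow> t \<in> cols \<Longrightarrow> u t \<noteq> 0 \<Longrightarrow>
    norm (scaleC ((1 / (pt t (u t) - z1)) ^ n) (wt t (u t) (u' t)) -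
          scaleC ((1 / (pt t (- u t) - z1)) ^ n) (wt t (- u t) (- u' t)))
      \<le> C * sqrt (u t + \<bar>u' t\<bar>)" by (rule inner_bound) blast
  define outer where "outer t = scaleC (\<phi> (pt t (- v t))) (wt t (- v t) (- v' t)) - scaleC (\<phi> (pt t (v t))) (wt t (v t) (v' t))" for t
  define inner where "inner t = scaleC (\<phi> (pt t (u t))) (wt t (u t) (u' t)) - scaleC (\<phi> (pt t (- u t))) (wt t (- u t) (- u' t))" for t
  have vz: "pt t (v t) \<noteq> z" "pt t (- v t) \<noteq> z" for t using Z_neq_far[OF z] v_abs_ge by blast+
  have uz: "pt t (u t) \<noteq> z" "pt t (- u t) \<noteq> z" if "u t \<noteq> 0" for t using seg_avoid[OF z that] u_nonneg[of t] by auto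
  have wc: "continuous_on cols (\<lambda>t. wt t (- v t) (- v' t))" "continuous_on cols (\<lambda>t. wt t (v t) (v' t))"
    "continuous_on cols (\<lambda>t. wt t (u t) (u' t))" "continuous_on cols (\<lambda>t. wt t (- u t) (- u' t))"
    by (auto intro!: wt_cont u_cont_on)
  have oc: "continuous_on cols outer"
    unfolding outer_def \<phi>_def using vz wc by (intro continuous_intros) auto
  have ic: "continuous_on cols (\<lambda>t. if u t = 0 then 0 else inner t)"
  proof (rule continuous_on_if_zero_squeeze[where \<epsilon> = "\<lambda>t. C * sqrt (u t + \<bar>u' t\<bar>)"])
    have sub: "{t \<in> cols. u t \<noteq> 0} \<subseteq> cols" by auto
    show "continuous_on {t \<in> cols. u t \<noteq> 0} inner"
      unfolding inner_def \<phi>_def using uz continuous_on_subset[OF wc(3) sub] continuous_on_subset[OF wc(4) sub]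
      by (intro continuous_intros) auto
    show "norm (inner t) \<le> C * sqrt (u t + \<bar>u' t\<bar>)" if "t \<in> cols" "u t \<noteq> 0" for t
      using C(2)[OF z z that] by (simp add: inner_def \<phi>_def)
    show "continuous_on cols (\<lambda>t. C * sqrt (u t + \<bar>u' t\<bar>))" by (intro continuous_intros)
  qed (use C u_nonneg u'_zero u_cont_on in auto)
  have "continuous_on {0..1} (\<lambda>t. if u t \<le> d then outer t + (if u t = 0 then 0 else inner t) else 0)"
  proof (rule continuous_on_paste_zero)
    show "continuous_on {t \<in> {0..1}. u t \<le> d} (\<lambda>t. outer t + (if u t = 0 then 0 else inner t))"
      using continuous_on_add[OF oc ic] unfolding cols_def .
    show "outer t + (if u t = 0 then 0 else inner t) = 0" if "u t = d" for t
      using p_zero[of t] that d by (simp add: outer_def inner_def v_def v'_def)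
  qed (auto intro: u_cont_on)
  moreover have "(\<lambda>t. if u t \<le> d then outer t + (if u t = 0 then 0 else inner t) else 0) = layer (\<lambda>w. (1 / (w - z)) ^ n)"
    by (intro ext) (simp add: layer_def outer_def inner_def \<phi>_def)
  ultimately show ?thesis by (metis integrable_continuous_interval)
qed

section \<open>Derivatives of f and their Taylor remainders\<close>

definition jet :: "nat \<Rightarrow> complex \<Rightarrow> 'b" where
  "jet n z = scaleC (fact n / (2 * pi * \<i>)) (integral {0..1} (layer (\<lambda>w. (1 / (w - z)) ^ Suc n)))"

lemma jet_0: assumes "z \<in> Z" shows "jet 0 z = f z"
proof -
  have "integral {0..1} (layer (\<lambda>w. (1 / (w - z)) ^ Suc 0)) = scaleC (2 * pi * \<i>) (f z)"
    using layer_cauchy[OF assms] by (simp add: integral_unique)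
  then show ?thesis by (simp add: jet_def scaleC_scaleC)
qed

text \<open>Taylor's formula is applied to the kernel under the integral, leaving \<Delta>^(m+1)
  times the layer integral of \<open>kernel_rem\<close>, which \<open>layer_bound\<close> controls.
  No path from z1 to z2 inside Z is involved.\<close>

lemma jet_remainder:
  obtains C where "C \<ge> 0" "\<And>z1 z2. z1 \<in> Z \<Longrightarrow> z2 \<in> Z \<Longrightarrow> norm (taylor_remainder jet n m z1 z2) \<le> C * cmod (z2 - z1) ^ Suc m"
proof -
  obtain C where C: "C \<ge> 0" "\<And>z1 z2 t. z1 \<in> Z \<Longrightarrow> z2 \<in> Z \<Longrightarrow> t \<in> {0..1} \<Longrightarrow>
    norm (layer (\<lambda>w. kernel_rem n m (1 / (w - z1)) (1 / (w - z2))) t) \<le> C"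
    using layer_bound[OF poly_growth_kernel_rem] by metis
  show ?thesis
  proof (rule that[of "fact n * C / (2 * pi)"])
    fix z1 z2 assume z: "z1 \<in> Z" "z2 \<in> Z"
    define \<Delta> where "\<Delta> = z2 - z1"
    define \<phi> where "\<phi> w = fact n * (1 / (w - z2)) ^ Suc n - (\<Sum>h=0..m. (\<Delta> ^ h / fact h * fact (n + h)) * (1 / (w - z1)) ^ Suc (n + h))" for w
    note int = layer_integrable[OF z(1)] layer_integrable[OF z(2)]
    have lay: "layer \<phi> t = scaleC (fact n) (layer (\<lambda>w. (1 / (w - z2)) ^ Suc n) t) -
       (\<Sum>h=0..m. scaleC (\<Delta> ^ h / fact h * fact (n + h)) (layer (\<lambda>w. (1 / (w - z1)) ^ Suc (n + h)) t))" for t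
      unfolding \<phi>_def layer_diff layer_sum layer_cmult ..
    have I: "(layer \<phi> has_integral scaleC (fact n) (integral {0..1} (layer (\<lambda>w. (1 / (w - z2)) ^ Suc n))) -
       (\<Sum>h=0..m. scaleC (\<Delta> ^ h / fact h * fact (n + h)) (integral {0..1} (layer (\<lambda>w. (1 / (w - z1)) ^ Suc (n + h)))))) {0..1}"
      unfolding lay[abs_def]
      by (intro has_integral_diff has_integral_sum has_integral_scaleC_right integrable_integral int) auto
    have "taylor_remainder jet n m z1 z2 = scaleC (1 / (2 * pi * \<i>)) (integral {0..1} (layer \<phi>))"
      unfolding integral_unique[OF I] taylor_remainder_def jet_def \<Delta>_def
      by (simp add: scaleC.diff_right scaleC.sum_right scaleC_scaleC mult_ac)
    moreover have "norm (integral {0..1} (layer \<phi>)) \<le> (fact n * C * cmod \<Delta> ^ Suc m) * measure lborel (cbox (0::real) 1)"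
    proof (rule has_integral_bound[where f = "layer \<phi>"])
      show "0 \<le> fact n * C * cmod \<Delta> ^ Suc m" using C(1) by simp
      show "(layer \<phi> has_integral integral {0..1} (layer \<phi>)) (cbox 0 1)"
        using integrable_integral[OF has_integral_integrable[OF I]] unfolding box_real(2) .
      have "layer \<phi> t = scaleC (\<Delta> ^ Suc m * fact n) (layer (\<lambda>w. kernel_rem n m (1 / (w - z1)) (1 / (w - z2))) t)" for t
        unfolding layer_cmult[symmetric]
      proof (rule layer_cong[OF _ z])
        fix w assume w: "w \<noteq> z1" "w \<noteq> z2"
        have "1 / (w - z2) - 1 / (w - z1) = \<Delta> * (1 / (w - z1)) * (1 / (w - z2))"
          using w by (simp add: \<Delta>_def field_simps)
        from kernel_taylor[OF this, of n m]
        show "\<phi> w = \<Delta> ^ Suc m * fact n * kernel_rem n m (1 / (w - z1)) (1 / (w - z2))"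
          by (simp only: \<phi>_def mult.assoc)
      qed
      then show "norm (layer \<phi> t) \<le> fact n * C * cmod \<Delta> ^ Suc m" if "t \<in> cbox 0 1" for t
      proof -
        assume e: "\<And>t. layer \<phi> t = scaleC (\<Delta> ^ Suc m * fact n) (layer (\<lambda>w. kernel_rem n m (1 / (w - z1)) (1 / (w - z2))) t)"
        have "norm (layer \<phi> t) = cmod \<Delta> ^ Suc m * fact n * norm (layer (\<lambda>w. kernel_rem n m (1 / (w - z1)) (1 / (w - z2))) t)"
          unfolding e norm_scaleC norm_mult norm_power by simp
        also have "\<dots> \<le> cmod \<Delta> ^ Suc m * fact n * C" using C(2)[OF z, of t] that by (intro mult_left_mono) auto
        finally show ?thesis by (simp add: mult_ac)
      qed
    qed
    ultimately show "norm (taylor_remainder jet n m z1 z2) \<le> fact n * C / (2 * pi) * cmod (z2 - z1) ^ Suc m"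
      by (simp add: norm_scaleC norm_divide norm_mult \<Delta>_def divide_right_mono)
  qed (use C in simp)
qed

text \<open>The remainder is one order better than required, and the surplus factor |z1 - z2| < 2
  \<delta> pays for \<epsilon>. Order 0 already makes every \<open>jet n\<close> Lipschitz.\<close>

lemma Cinf_holomorphic: "Cinf_holomorphic_on f Z"
  unfolding Cinf_holomorphic_on_def
proof (intro exI[of _ jet] conjI allI ballI impI)
  fix n
  obtain C where C: "C \<ge> 0" "\<And>z1 z2. z1 \<in> Z \<Longrightarrow> z2 \<in> Z \<Longrightarrow> norm (taylor_remainder jet n 0 z1 z2) \<le> C * cmod (z2 - z1) ^ Suc 0"
    using jet_remainder by blast
  have "C-lipschitz_on Z (jet n)"
  proof (rule lipschitz_onI[OF _ C(1)])
    fix x y assume "x \<in> Z" "y \<in> Z"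
    from C(2)[OF this(2,1)] show "dist (jet n x) (jet n y) \<le> C * dist x y"
      by (simp add: taylor_remainder_def dist_norm)
  qed
  then show "continuous_on Z (jet n)" by (rule lipschitz_on_continuous_on)
next
  fix z assume "z \<in> Z" then show "jet 0 z = f z" by (rule jet_0)
next
  fix n m z and \<epsilon> :: real assume \<epsilon>: "\<epsilon> > 0"
  obtain C where C: "C \<ge> 0" "\<And>z1 z2. z1 \<in> Z \<Longrightarrow> z2 \<in> Z \<Longrightarrow> norm (taylor_remainder jet n m z1 z2) \<le> C * cmod (z2 - z1) ^ Suc m"
    using jet_remainder by blast
  define \<delta> where "\<delta> = \<epsilon> / (2 * (C + 1))"
  have \<delta>: "\<delta> > 0" using \<epsilon> C by (simp add: \<delta>_def)
  show "\<exists>\<delta>>0. \<forall>z1\<in>Z. \<forall>z2\<in>Z. cmod (z1 - z) < \<delta> \<longrightarrow> cmod (z2 - z) < \<delta> \<longrightarrow>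
      norm (taylor_remainder jet n m z1 z2) \<le> \<epsilon> * cmod (z1 - z2) ^ m"
  proof (intro exI[of _ \<delta>] conjI ballI impI)
    fix z1 z2 assume z: "z1 \<in> Z" "z2 \<in> Z" "cmod (z1 - z) < \<delta>" "cmod (z2 - z) < \<delta>"
    have "cmod (z1 - z2) \<le> 2 * \<delta>" using z(3,4) norm_triangle_ineq4[of "z1 - z" "z2 - z"] by simp
    then have "(C + 1) * cmod (z1 - z2) \<le> (C + 1) * (2 * \<delta>)" using C(1) by (intro mult_left_mono) auto
    also have "\<dots> = \<epsilon>" using C(1) by (simp add: \<delta>_def field_simps)
    finally have "C * cmod (z1 - z2) \<le> \<epsilon>" using norm_ge_zero[of "z1 - z2"] unfolding distrib_right by linarith
    then have "C * cmod (z1 - z2) * cmod (z1 - z2) ^ m \<le> \<epsilon> * cmod (z1 - z2) ^ m" by (intro mult_right_mono) auto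
    then show "norm (taylor_remainder jet n m z1 z2) \<le> \<epsilon> * cmod (z1 - z2) ^ m"
      using C(2)[OF z(1,2)] by (simp add: norm_minus_commute[of z2 z1] mult.assoc)
  qed (rule \<delta>)
qed

end

section \<open>The theorem\<close>

lemma sin_ge_quarter:
  fixes x :: real
  assumes "\<bar>x\<bar> \<le> pi / 2"
  shows "\<bar>x\<bar> / 4 \<le> \<bar>sin x\<bar>"
proof -
  have *: "y / 4 \<le> sin y" if y: "0 \<le> y" "y \<le> pi / 2" for y :: real
  proof (cases "y \<le> 1")
    case True
    then show ?thesis using sin_ge_half[of y] y by simp
  next
    case False
    have "sin 1 \<le> sin y" using False y pi_gt3 by (intro sin_monotone_2pi_le) auto
    then show ?thesis using sin_ge_half[of 1] y pi_less_4 by simp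
  qed
  show ?thesis using *[of x] *[of "- x"] assms by (cases "x \<ge> 0") auto
qed

text \<open>The modulus of exp w - 1 dominates |exp p - 1|, and its square contains 4 exp p sin^2
  (q/2). The constant 5 = 1 + 4 adds up the two resulting bounds.\<close>

lemma norm_exp_minus_1_ge:
  assumes "\<bar>Re w\<bar> \<le> P" "\<bar>Im w\<bar> \<le> pi"
  shows "exp (- P) / 5 * cmod w \<le> cmod (exp w - 1)"
proof -
  define p q where "p = Re w" and "q = Im w"
  have P: "0 \<le> P" using assms by linarith
  have eP: "exp (- P) \<le> exp p" using assms by (simp add: p_def)
  have 1: "exp (- P) * \<bar>p\<bar> \<le> cmod (exp w - 1)"
  proof -
    have "exp (- P) * \<bar>p\<bar> \<le> \<bar>exp p - 1\<bar>"
    proof (cases "p \<ge> 0")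
      case True
      have "exp (- P) * \<bar>p\<bar> \<le> 1 * \<bar>p\<bar>" using P by (intro mult_right_mono) auto
      then show ?thesis using True exp_ge_add_one_self[of p] by linarith
    next
      case False
      have "exp (- P) * \<bar>p\<bar> \<le> exp p * (exp (- p) - 1)"
        using eP False exp_ge_add_one_self[of "- p"] by (intro mult_mono) auto
      also have "\<dots> = 1 - exp p" by (simp add: algebra_simps flip: exp_add)
      finally show ?thesis by linarith
    qed
    also have "\<dots> \<le> cmod (exp w - 1)" using norm_triangle_ineq3[of "exp w" 1] by (simp add: p_def)
    finally show ?thesis .
  qed
  have 2: "exp (- P) * \<bar>q\<bar> \<le> 4 * cmod (exp w - 1)"
  proof -
    have "(cmod (exp w - 1))\<^sup>2 = (exp p * cos q - 1)\<^sup>2 + (exp p * sin q)\<^sup>2"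
      by (simp add: cmod_power2 Re_exp Im_exp p_def q_def)
    also have "\<dots> = (exp p)\<^sup>2 * ((sin q)\<^sup>2 + (cos q)\<^sup>2) - 2 * exp p * cos q + 1"
      by algebra
    also have "\<dots> = (exp p - 1)\<^sup>2 + 2 * exp p * (1 - cos q)"
      unfolding sin_cos_squared_add by (simp add: power2_eq_square algebra_simps)
    also have "1 - cos q = 2 * (sin (q / 2))\<^sup>2" using cos_double_sin[of "q / 2"] by simp
    finally have e: "(cmod (exp w - 1))\<^sup>2 = (exp p - 1)\<^sup>2 + 4 * exp p * (sin (q / 2))\<^sup>2" by simp
    have "\<bar>q / 2\<bar> / 4 \<le> \<bar>sin (q / 2)\<bar>" using assms by (intro sin_ge_quarter) (simp add: q_def)
    then have "(\<bar>q\<bar> / 8)\<^sup>2 \<le> \<bar>sin (q / 2)\<bar>\<^sup>2" by (intro power_mono) auto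
    then have s: "(\<bar>q\<bar> / 8)\<^sup>2 \<le> (sin (q / 2))\<^sup>2" by simp
    have "(exp (- P) * (\<bar>q\<bar> / 4))\<^sup>2 = 4 * (exp (- P))\<^sup>2 * (\<bar>q\<bar> / 8)\<^sup>2" by (simp add: power2_eq_square)
    also have "\<dots> \<le> 4 * exp p * (sin (q / 2))\<^sup>2"
    proof (rule mult_mono[OF _ s])
      have "(exp (- P))\<^sup>2 \<le> exp (- P) * 1" unfolding power2_eq_square using P by (intro mult_left_mono) auto
      then show "4 * (exp (- P))\<^sup>2 \<le> 4 * exp p" using eP by linarith
    qed auto
    also have "\<dots> \<le> (cmod (exp w - 1))\<^sup>2" unfolding e by simp
    finally have "exp (- P) * (\<bar>q\<bar> / 4) \<le> cmod (exp w - 1)" by (rule power2_le_imp_le) simp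
    then show ?thesis by simp
  qed
  have "exp (- P) * cmod w \<le> exp (- P) * (\<bar>p\<bar> + \<bar>q\<bar>)"
    unfolding p_def q_def by (intro mult_left_mono cmod_le) auto
  then show ?thesis using 1 2 by (simp add: distrib_left)
qed

text \<open>As \<open>pt\<close> is injective only modulo 1, t is first shifted by the nearest
  integer, which brings the imaginary part of w into [-\<pi>, \<pi>]. The 6 in the exponent is 2
  from the modulus of \<open>pt a b\<close> plus 4 from the real part of w; the factor 1/5 is
  regained from 2 \<pi> \<ge> 5.\<close>

lemma norm_pt_diff_ge:
  assumes "\<bar>y\<bar> \<le> H" "\<bar>b\<bar> \<le> H"
  shows "\<exists>n::int. exp (- (6 * pi * H)) * cmod (Complex (t - of_int n) y - Complex a b) \<le> cmod (pt t y - pt a b)"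
proof -
  define n where "n = round (t - a)"
  define s where "s = Complex (t - of_int n) y - Complex a b"
  define w where "w = 2 * pi * \<i> * s"
  have Rew: "Re w = 2 * pi * (b - y)" and Imw: "Im w = 2 * pi * (t - of_int n - a)"
    by (simp_all add: w_def s_def algebra_simps)
  have "\<bar>t - a - of_int n\<bar> \<le> 1 / 2" using of_int_round_abs_le[of "t - a"] by (simp add: n_def abs_minus_commute)
  then have "2 * pi * \<bar>t - of_int n - a\<bar> \<le> 2 * pi * (1 / 2)" by (intro mult_left_mono) (auto simp: algebra_simps)
  then have I: "\<bar>Im w\<bar> \<le> pi" by (simp add: Imw abs_mult)
  have "2 * pi * \<bar>b - y\<bar> \<le> 2 * pi * (2 * H)" using assms by (intro mult_left_mono) auto
  then have R: "\<bar>Re w\<bar> \<le> 4 * pi * H" by (simp add: Rew abs_mult)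
  have "2 * pi * \<i> * Complex t y = 2 * pi * \<i> * Complex a b + w + of_int n * (2 * pi * \<i>)"
    by (simp add: w_def s_def complex_eq_iff algebra_simps)
  then have "pt t y = pt a b * exp w * exp (of_int n * (2 * pi * \<i>))" by (simp only: pt_def exp_add)
  moreover have "exp (of_int n * (2 * pi * \<i>)) = 1"
    unfolding exp_eq_1 by (auto intro!: exI[of _ n])
  ultimately have e: "pt t y - pt a b = pt a b * (exp w - 1)" by (simp add: algebra_simps)
  have "2 * pi * b \<le> 2 * pi * H" using assms by (intro mult_left_mono) auto
  then have nb: "exp (- (2 * pi * H)) \<le> cmod (pt a b)" by (simp add: norm_pt)
  have "exp (- (6 * pi * H)) * cmod s = exp (- (2 * pi * H)) * (exp (- (4 * pi * H)) * cmod s)"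
    by (simp flip: exp_add mult.assoc)
  also have "\<dots> \<le> cmod (pt a b) * cmod (exp w - 1)"
  proof (rule mult_mono[OF nb])
    have "cmod w = 2 * pi * cmod s" by (simp add: w_def norm_mult)
    then have "5 * cmod s \<le> cmod w" using pi_gt3 by (simp add: mult_right_mono)
    then have "exp (- (4 * pi * H)) / 5 * (5 * cmod s) \<le> exp (- (4 * pi * H)) / 5 * cmod w" by (intro mult_left_mono) auto
    also have "\<dots> \<le> cmod (exp w - 1)" by (rule norm_exp_minus_1_ge[OF R I])
    finally show "exp (- (4 * pi * H)) * cmod s \<le> cmod (exp w - 1)" by simp
  qed auto
  also have "\<dots> = cmod (pt t y - pt a b)" unfolding e by (simp add: norm_mult)
  finally show ?thesis unfolding s_def by blast
qed

lemma periodic_int: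
  fixes g :: "real \<Rightarrow> 'a"
  assumes "\<And>t. g (t + 1) = g t"
  shows "g (t - of_int n) = g t"
proof -
  have nat: "g (s + of_nat k) = g s" for s k
  proof (induction k)
    case (Suc k)
    then show ?case using assms[of "s + of_nat k"] by (simp add: algebra_simps)
  qed simp
  show ?thesis
  proof (cases "n \<ge> 0")
    case True
    then obtain k where "n = int k" by (metis nonneg_int_cases)
    then show ?thesis using nat[of "t - of_int n" k] by simp
  next
    case False
    then obtain k where "n = - int k" by (metis int_cases not_le of_nat_less_0_iff zless_iff_Suc_zadd nonpos_int_cases linear)
    then show ?thesis using nat[of t k] by simp
  qed
qed

theorem theorem2p3:
  fixes \<gamma> \<kappa> d \<alpha> :: real and \<psi> :: "nat \<Rightarrow> real"
    and A :: "(nat \<Rightarrow>\<^sub>C real) set" and K Kstar :: "complex set"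
  assumes "0 < \<gamma>" "\<gamma> < 1" "0 < \<kappa>" "\<kappa> < 1" "0 < d"
    and "approximation_function \<psi>" and "\<forall>m\<ge>1. \<psi> m = \<gamma> * exp (- \<alpha> * real m)"
    and "K = {exp (2 * pi * \<i> * x) | x. x \<in> cone_thickening (C_set \<psi>) \<kappa> d}"
    and "totally_bounded A" and "closedin (top_of_set c0) A" and "\<forall>s\<in>A. norm s \<le> \<alpha>"
    and "Kstar = {exp (2 * pi * \<i> * x) | x. x \<in> cone_thickening (W_set A (8 * \<gamma>)) \<kappa> (d / 2)}"
  shows "Kstar \<subseteq> K \<and>
    (\<forall>f :: complex \<Rightarrow> 'b::complex_banach. C1_holomorphic_on f K \<longrightarrow> Cinf_holomorphic_on f Kstar)"
proof -
  interpret exp_approximation \<gamma> \<alpha> \<psi> using assms by unfold_locales auto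
  have sub: "A \<subseteq> c0" using closedin_subset[OF assms(10)] by simp
  note A = assms(9) sub assms(11)
  define W where "W = W_set A (8 * \<gamma>)"
  have WC: "W \<subseteq> C_set \<psi>" unfolding W_def by (rule W_set_subset_C_set[OF A])
  have K_iff: "pt t y \<in> K" if "x \<in> C_set \<psi>" "\<kappa> * \<bar>t - x\<bar> \<le> \<bar>y\<bar>" "\<bar>y\<bar> \<le> d" for t y x
  proof -
    have "Complex t y \<in> cone_thickening (C_set \<psi>) \<kappa> d" using that by (auto simp: cone_thickening_def)
    then show ?thesis unfolding assms(8) pt_def by blast
  qed
  have Kstar_E: "\<exists>a b y. z = pt a b \<and> y \<in> W \<and> \<kappa> * \<bar>a - y\<bar> \<le> \<bar>b\<bar> \<and> \<bar>b\<bar> \<le> d / 2" if z: "z \<in> Kstar" for z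
  proof -
    obtain x y where "z = exp (2 * pi * \<i> * x)" "y \<in> W" "\<kappa> * \<bar>Re x - y\<bar> \<le> \<bar>Im x\<bar>" "\<bar>Im x\<bar> \<le> d / 2"
      using z unfolding assms(12) cone_thickening_def W_def by auto
    then show ?thesis by (intro exI[of _ "Re x"] exI[of _ "Im x"] exI[of _ y]) (simp add: pt_def)
  qed
  have Kstar_sub: "Kstar \<subseteq> K"
  proof
    fix z assume "z \<in> Kstar"
    then obtain a b y where "z = pt a b" "y \<in> W" "\<kappa> * \<bar>a - y\<bar> \<le> \<bar>b\<bar>" "\<bar>b\<bar> \<le> d / 2" using Kstar_E by blast
    then show "z \<in> K" using K_iff[of y a b] WC assms(5) by auto
  qed
  obtain u u' where u: "\<And>t. (u has_real_derivative u' t) (at t)" "continuous_on UNIV u'"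
    "\<And>t. u (t + 1) = u t" "\<And>t. 0 \<le> u t"
    "\<And>t. \<exists>x\<in>C_set \<psi>. \<kappa> * \<bar>t - x\<bar> \<le> u t"
    "\<And>N. \<exists>M. \<forall>y\<in>W. \<forall>t. u t > 0 \<longrightarrow>
       0 < \<kappa> * \<bar>t - y\<bar> - u t \<and> u t + \<bar>u' t\<bar> \<le> M * (\<kappa> * \<bar>t - y\<bar> - u t) ^ N"
    using flat_majorant[OF A assms(3,4)] unfolding W_def by blast
  have u'_per: "u' (t + 1) = u' t" for t
  proof -
    have "((\<lambda>s. u (s + 1)) has_real_derivative u' (t + 1)) (at t)"
      using u(1)[of "t + 1"] by (simp add: DERIV_shift)
    then show ?thesis using u(1)[of t] u(3) by (simp add: DERIV_unique)
  qed
  have u'_zero: "u' t = 0" if "u t = 0" for t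
    using DERIV_local_min[OF u(1)[of t], of 1] u(4) that by simp
  obtain U where U: "\<And>t. u t \<le> U"
  proof -
    have "continuous_on {0..1} u" by (rule DERIV_continuous_on) (rule has_field_derivative_at_within[OF u(1)])
    then have "bounded (u ` {0..1})" by (intro compact_imp_bounded compact_continuous_image) auto
    then obtain B where B: "\<And>t. t \<in> {0..1} \<Longrightarrow> norm (u t) \<le> B" unfolding bounded_iff by blast
    have "u t \<le> B" for t
    proof -
      have "u (t - of_int \<lfloor>t\<rfloor>) = u t" by (rule periodic_int[of u, OF u(3)])
      moreover have "t - of_int \<lfloor>t\<rfloor> \<in> {0..1}" by (simp add: le_diff_eq diff_le_eq) linarith
      ultimately show ?thesis using B[of "t - of_int \<lfloor>t\<rfloor>"] by simp
    qed
    then show ?thesis using that by blast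
  qed
  \<comment> \<open>The quantity \<kappa> |t - y0| - u t from \<open>flat_majorant\<close> is at
    most twice the distance in x from a point of the removed column to z, and by
    \<open>norm_pt_diff_ge\<close> that is bounded by a multiple of the distance in q.\<close>
  have flat: "\<exists>M. \<forall>z\<in>Kstar. \<forall>t y. \<bar>y\<bar> \<le> u t \<longrightarrow> u t + \<bar>u' t\<bar> \<le> M * cmod (pt t y - z) ^ N" for N
  proof -
    obtain M where M: "\<And>y t. y \<in> W \<Longrightarrow> u t > 0 \<Longrightarrow>
       0 < \<kappa> * \<bar>t - y\<bar> - u t \<and> u t + \<bar>u' t\<bar> \<le> M * (\<kappa> * \<bar>t - y\<bar> - u t) ^ N" using u(6)[of N] by blast
    define H where "H = max U d"
    define c where "c = exp (- (6 * pi * H))"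
    have c: "c > 0" by (simp add: c_def)
    show ?thesis
    proof (intro exI[of _ "\<bar>M\<bar> * (2 / c) ^ N"] ballI allI impI)
      fix z t y assume z: "z \<in> Kstar" and y: "\<bar>y\<bar> \<le> u t"
      show "u t + \<bar>u' t\<bar> \<le> \<bar>M\<bar> * (2 / c) ^ N * cmod (pt t y - z) ^ N"
      proof (cases "u t = 0")
        case True
        then show ?thesis using u'_zero[OF True] c by simp
      next
        case False
        then have u0: "u t > 0" using u(4)[of t] by linarith
        obtain a b y0 where ab: "z = pt a b" "y0 \<in> W" "\<kappa> * \<bar>a - y0\<bar> \<le> \<bar>b\<bar>" "\<bar>b\<bar> \<le> d / 2" using Kstar_E[OF z] by blast
        have "\<bar>y\<bar> \<le> H" "\<bar>b\<bar> \<le> H" using y U[of t] ab(4) assms(5) by (auto simp: H_def)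
        then obtain n :: int where n: "c * cmod (Complex (t - of_int n) y - Complex a b) \<le> cmod (pt t y - pt a b)"
          using norm_pt_diff_ge unfolding c_def by blast
        define t' where "t' = t - of_int n"
        define \<tau> where "\<tau> = cmod (Complex t' y - Complex a b)"
        have per: "u t' = u t" "u' t' = u' t"
          unfolding t'_def by (rule periodic_int[of u, OF u(3)], rule periodic_int[of u', OF u'_per])
        have re: "\<bar>t' - a\<bar> \<le> \<tau>" using abs_Re_le_cmod[of "Complex t' y - Complex a b"] by (simp add: \<tau>_def)
        have im: "\<bar>y - b\<bar> \<le> \<tau>" using abs_Im_le_cmod[of "Complex t' y - Complex a b"] by (simp add: \<tau>_def)
        have "\<kappa> * \<bar>t' - y0\<bar> \<le> \<kappa> * (\<bar>t' - a\<bar> + \<bar>a - y0\<bar>)" using assms(3) by (intro mult_left_mono) auto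
        also have "\<dots> = \<kappa> * \<bar>t' - a\<bar> + \<kappa> * \<bar>a - y0\<bar>" by (rule distrib_left)
        also have "\<dots> \<le> 1 * \<tau> + \<bar>b\<bar>" using assms(3,4) re ab(3) by (intro add_mono mult_mono) auto
        \<comment> \<open>Here |b| \<le> |y| + \<tau> \<le> u t + \<tau>, so u t cancels.\<close>
        finally have k: "\<kappa> * \<bar>t' - y0\<bar> - u t' \<le> 2 * \<tau>" using im y per by linarith
        have \<tau>le: "\<tau> \<le> cmod (pt t y - z) / c" using n c by (simp add: \<tau>_def t'_def ab(1) pos_le_divide_eq mult.commute)
        note M' = M[OF ab(2), of t', unfolded per, OF u0]
        have "u t + \<bar>u' t\<bar> \<le> M * (\<kappa> * \<bar>t' - y0\<bar> - u t) ^ N" using M' by simp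
        also have "\<dots> \<le> \<bar>M\<bar> * (2 / c * cmod (pt t y - z)) ^ N"
        proof (rule mult_mono)
          have "\<kappa> * \<bar>t' - y0\<bar> - u t \<le> 2 / c * cmod (pt t y - z)" using k \<tau>le per by simp
          then show "(\<kappa> * \<bar>t' - y0\<bar> - u t) ^ N \<le> (2 / c * cmod (pt t y - z)) ^ N"
            using M' by (intro power_mono) auto
        qed (use M' in auto)
        finally show ?thesis by (simp only: power_mult_distrib mult.assoc)
      qed
    qed
  qed
  have "Cinf_holomorphic_on f Kstar" if f: "C1_holomorphic_on f K" for f :: "complex \<Rightarrow> 'b"
  proof -
    obtain f1 where f1: "continuous_on K f" "continuous_on K f1"
      "\<And>z \<epsilon>. z \<in> K \<Longrightarrow> \<epsilon> > 0 \<Longrightarrow> \<exists>\<delta>>0. \<forall>z1\<in>K. \<forall>z2\<in>K. cmod (z1 - z) < \<delta> \<longrightarrow> cmod (z2 - z) < \<delta> \<longrightarrow>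
          norm (f z2 - f z1 - scaleC (z2 - z1) (f1 z1)) \<le> \<epsilon> * cmod (z1 - z2)"
      using f unfolding C1_holomorphic_on_def by blast
    interpret flat_contour K Kstar d u u' f f1
    proof
      show "pt t y \<in> K" if "u t \<le> \<bar>y\<bar>" "\<bar>y\<bar> \<le> d" for t y
      proof -
        obtain x where x: "x \<in> C_set \<psi>" "\<kappa> * \<bar>t - x\<bar> \<le> u t" using u(5) by blast
        show ?thesis by (rule K_iff[OF x(1) order_trans[OF x(2) that(1)] that(2)])
      qed
      show "\<exists>t y. z = pt t y \<and> \<bar>y\<bar> \<le> d / 2" if "z \<in> Kstar" for z using Kstar_E[OF that] by blast
    qed (use assms(5) u Kstar_sub flat f1 in blast)+
    show ?thesis by (rule Cinf_holomorphic)
  qed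
  then show ?thesis using Kstar_sub by blast
qed

end
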